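(* Let $p$ be a prime different from $\operatorname{char}(\Bbbk)$, let $S$ be a (commutative) separable $\mathbb{A}_X$-algebra which is finitely generated and projective as an $\mathbb{A}_X$-module, and let $G$ be a cyclic group of order $p$ acting on $S$ by $\mathbb{A}_X$-algebra automorphisms. For a closed point $x\in X$ put $S_x=S\otimes_{\mathbb{A}_X}K_x$. Then the following are equivalent: (1) $S$ is a $G$-Galois ring extension of $\mathbb{A}_X$. (2) $S_x$ is a $G$-Galois ring extension of $K_x$ for all closed points $x\in X$. If this is the case, then $S^{\chi}$ is a free $\mathbb{A}_X$-module of rank $1$ for all characters $\chi:G\to\mu_p\subseteq\Bbbk^*$, and thus $S$ is a free $\mathbb{A}_X$-module of rank $p$.
   Context: $\Bbbk$ is an algebraically closed field and $X$ is a projective, irreducible, non-singular curve over $\Bbbk$. For a closed point $x$ of $X$, $A_x$ is the completion of the local ring of $X$ at $x$ and $K_x$ is the fraction field of $A_x$. The adele ring is $\mathbb{A}_X=\{(\alpha_x)_x\in\prod_{x}K_x : \alpha_x\in A_x \text{ for all but finitely many } x\}$, the product running over closed points. $\Bbbk$ is embedded diagonally in $\mathbb{A}_X$, and $K_x$ is an $\mathbb{A}_X$-algebra via projection to the $x$-component. $G$ acts on $S_x$ through the first tensor factor. $\mu_p$ is the group of $p$th roots of unity in $\Bbbk^*$. Separable: a commutative $R$-algebra $S$ is separable if it is projective as an $S\otimes_R S$-module. Galois extension: for a commutative ring $R$, a commutative ring extension $S$ of $R$ with an action of a finite group $G$ is a $G$-Galois extension of $R$ if $G$ acts faithfully on $S$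 by $R$-algebra automorphisms, $S^G=R$, $S$ is a separable $R$-algebra, and the elements of $G$ are pairwise strongly distinct, i.e. for all $g\neq h$ in $G$ and every nonzero idempotent $e\in S$ there is $s\in S$ with $g(s)e\neq h(s)e$. For a character $\chi:G\to\mu_p$, $S^\chi=\{\alpha\in S: g(\alpha)=\chi(g)\alpha\ \forall g\in G\}$. *)

theory Defs
  imports
    "HOL-Algebra.Algebra"
    "HOL-Computational_Algebra.Computational_Algebra"
    "HOL-Library.Poly_Mapping"
    "HOL-Library.Extended_Nat"
begin

section \<open>Projective curves over an algebraically closed field\<close>

text \<open>
  Varieties are taken in the classical sense: zero loci of homogeneous polynomials in
  $\mathbf{P}^n(k)$. Over an algebraically closed field their points are the closed points of the
  corresponding scheme. The homogeneous coordinates are indexed by a finite type \<open>'v\<close> with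
  $n + 1$ elements, and a point of $\mathbf{P}^n(k)$ is a line of \<open>'v \<Rightarrow> 'k\<close> with the origin removed.
\<close>

type_synonym ('v, 'k) point = "('v \<Rightarrow> 'k) set"
type_synonym ('v, 'k) mpol = "('v \<Rightarrow>\<^sub>0 nat) \<Rightarrow>\<^sub>0 'k"

definition proj_space :: "('v::finite, 'k::field) point set" where
  "proj_space = {{\<lambda>i. c * v i | c. c \<noteq> 0} | v. v \<noteq> (\<lambda>_. 0)}"

definition mpol_eval :: "('v::finite, 'k::field) mpol \<Rightarrow> ('v \<Rightarrow> 'k) \<Rightarrow> 'k" where
  "mpol_eval f v = (\<Sum>m\<in>Poly_Mapping.keys f.
     Poly_Mapping.lookup f m * (\<Prod>i\<in>UNIV. v i ^ Poly_Mapping.lookup m i))"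

definition homogeneous :: "nat \<Rightarrow> ('v::finite, 'k::field) mpol \<Rightarrow> bool" where
  "homogeneous d f \<longleftrightarrow> (\<forall>m\<in>Poly_Mapping.keys f. (\<Sum>i\<in>UNIV. Poly_Mapping.lookup m i) = d)"

definition zariski_closed :: "('v::finite, 'k::field) point set \<Rightarrow> bool" where
  "zariski_closed Z \<longleftrightarrow> (\<exists>T. (\<forall>f\<in>T. \<exists>d. homogeneous d f) \<and>
     Z = {P \<in> proj_space. \<forall>f\<in>T. \<forall>v\<in>P. mpol_eval f v = 0})"

definition irreducible_closed :: "('v::finite, 'k::field) point set \<Rightarrow> bool" where
  "irreducible_closed Z \<longleftrightarrow> zariski_closed Z \<and> Z \<noteq> {} \<and>
     (\<forall>A B. zariski_closed A \<and> zariski_closed B \<and> Z = A \<union> B \<longrightarrow> Z = A \<or> Z = B)"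

definition zariski_dim :: "('v::finite, 'k::field) point set \<Rightarrow> enat" where
  "zariski_dim C = (SUP n \<in> {n. \<exists>Z. (\<forall>i\<le>n. irreducible_closed (Z i) \<and> Z i \<subseteq> C) \<and>
     (\<forall>i<n. Z i \<subset> Z (Suc i))}. enat n)"

definition zariski_nhd ::
  "('v::finite, 'k::field) point set \<Rightarrow> ('v, 'k) point \<Rightarrow> ('v, 'k) point set \<Rightarrow> bool" where
  "zariski_nhd C P U \<longleftrightarrow> P \<in> U \<and> U \<subseteq> C \<and> zariski_closed (C - U)"

definition regular_at ::
  "('v::finite, 'k::field) point set \<Rightarrow> ('v, 'k) point \<Rightarrow> (('v, 'k) point \<Rightarrow> 'k) \<Rightarrow> bool" where
  "regular_at C P f \<longleftrightarrow> (\<exists>U d g h. zariski_nhd C P U \<and> homogeneous d g \<and> homogeneous d h \<and>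
     (\<forall>Q\<in>U. \<forall>v\<in>Q. mpol_eval h v \<noteq> 0 \<and> f Q = mpol_eval g v / mpol_eval h v))"

text \<open>
  The local ring at \<open>P\<close> is the ring of germs at \<open>P\<close> of regular functions. It is the quotient of the
  ring of all functions that are regular at \<open>P\<close> (their values away from \<open>P\<close> being arbitrary) by the
  ideal of functions that vanish in a neighbourhood of \<open>P\<close>.
\<close>

definition regular_ring ::
  "('v::finite, 'k::field) point set \<Rightarrow> ('v, 'k) point \<Rightarrow> (('v, 'k) point \<Rightarrow> 'k) ring" where
  "regular_ring C P =
     \<lparr>carrier = {f. regular_at C P f}, monoid.mult = (\<lambda>f g Q. f Q * g Q), one = (\<lambda>_. 1),
      ring.zero = (\<lambda>_. 0), add = (\<lambda>f g Q. f Q + g Q)\<rparr>"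

definition germ_null ::
  "('v::finite, 'k::field) point set \<Rightarrow> ('v, 'k) point \<Rightarrow> (('v, 'k) point \<Rightarrow> 'k) set" where
  "germ_null C P = {f. \<exists>U. zariski_nhd C P U \<and> (\<forall>Q\<in>U. f Q = 0)}"

definition local_ring_at ::
  "('v::finite, 'k::field) point set \<Rightarrow> ('v, 'k) point \<Rightarrow> (('v, 'k) point \<Rightarrow> 'k) set ring" where
  "local_ring_at C P = regular_ring C P Quot germ_null C P"

definition local_ring_const ::
  "('v::finite, 'k::field) point set \<Rightarrow> ('v, 'k) point \<Rightarrow> 'k \<Rightarrow> (('v, 'k) point \<Rightarrow> 'k) set" where
  "local_ring_const C P c = germ_null C P +>\<^bsub>regular_ring C P\<^esub> (\<lambda>_. c)"

text \<open>The maximal ideal, for a local ring.\<close>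

definition nonunits :: "('a, 'm) ring_scheme \<Rightarrow> 'a set" where
  "nonunits R = carrier R - Units R"

definition ideal_pow :: "('a, 'm) ring_scheme \<Rightarrow> 'a set \<Rightarrow> nat \<Rightarrow> 'a set" where
  "ideal_pow R I n = I [^]\<^bsub>ideals_set R\<^esub> n"

text \<open>
  \<open>P\<close> is non-singular if the Zariski cotangent space $\mathfrak{m}/\mathfrak{m}^2$, considered
  inside the $k$-algebra $\mathcal{O}_P/\mathfrak{m}^2$, has $k$-dimension
  $\dim C$. For irreducible \<open>C\<close>, $\dim C$ is also the Krull dimension of the local ring at each point.
\<close>

definition nonsingular_at :: "('v::finite, 'k::field) point set \<Rightarrow> ('v, 'k) point \<Rightarrow> bool" where
  "nonsingular_at C P \<longleftrightarrow>
     (let Ox = local_ring_at C P; m = nonunits Ox; m2 = ideal_pow Ox m 2 in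
      \<exists>n. zariski_dim C = enat n \<and>
        ring.dimension (Ox Quot m2) n
          (range (\<lambda>c. m2 +>\<^bsub>Ox\<^esub> local_ring_const C P c)) ((\<lambda>a. m2 +>\<^bsub>Ox\<^esub> a) ` m))"

definition nonsingular_projective_curve :: "('v::finite, 'k::alg_closed_field) point set \<Rightarrow> bool" where
  "nonsingular_projective_curve C \<longleftrightarrow>
     irreducible_closed C \<and> zariski_dim C = 1 \<and> (\<forall>P\<in>C. nonsingular_at C P)"


section \<open>Completions, fraction fields and the adele ring\<close>

text \<open>
  $\varprojlim_n R/I^n$: the containment \<open>a (Suc n) \<subseteq> a n\<close> of cosets says that \<open>a (Suc n)\<close> is mapped
  to \<open>a n\<close> under $R/I^{n+1} \to R/I^n$.
\<close>

definition adic_completion :: "('a, 'm) ring_scheme \<Rightarrow> 'a set \<Rightarrow> (nat \<Rightarrow> 'a set) ring" where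
  "adic_completion R I =
     \<lparr>carrier = {a. \<forall>n. a n \<in> carrier (R Quot ideal_pow R I n) \<and> a (Suc n) \<subseteq> a n},
      monoid.mult = (\<lambda>a b n. a n \<otimes>\<^bsub>R Quot ideal_pow R I n\<^esub> b n),
      one = (\<lambda>n. \<one>\<^bsub>R Quot ideal_pow R I n\<^esub>),
      ring.zero = (\<lambda>n. \<zero>\<^bsub>R Quot ideal_pow R I n\<^esub>),
      add = (\<lambda>a b n. a n \<oplus>\<^bsub>R Quot ideal_pow R I n\<^esub> b n)\<rparr>"

definition frac :: "('a, 'm) ring_scheme \<Rightarrow> 'a \<Rightarrow> 'a \<Rightarrow> ('a \<times> 'a) set" where
  "frac R a b = {(c, d). c \<in> carrier R \<and> d \<in> carrier R - {\<zero>\<^bsub>R\<^esub>} \<and> a \<otimes>\<^bsub>R\<^esub> d = c \<otimes>\<^bsub>R\<^esub> b}"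

definition fraction_field :: "('a, 'm) ring_scheme \<Rightarrow> ('a \<times> 'a) set ring" where
  "fraction_field R =
     \<lparr>carrier = {frac R a b | a b. a \<in> carrier R \<and> b \<in> carrier R - {\<zero>\<^bsub>R\<^esub>}},
      monoid.mult = (\<lambda>x y. \<Union>(a, b)\<in>x. \<Union>(c, d)\<in>y. frac R (a \<otimes>\<^bsub>R\<^esub> c) (b \<otimes>\<^bsub>R\<^esub> d)),
      one = frac R \<one>\<^bsub>R\<^esub> \<one>\<^bsub>R\<^esub>,
      ring.zero = frac R \<zero>\<^bsub>R\<^esub> \<one>\<^bsub>R\<^esub>,
      add = (\<lambda>x y. \<Union>(a, b)\<in>x. \<Union>(c, d)\<in>y.
        frac R (a \<otimes>\<^bsub>R\<^esub> d \<oplus>\<^bsub>R\<^esub> c \<otimes>\<^bsub>R\<^esub> b) (b \<otimes>\<^bsub>R\<^esub> d))\<rparr>"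

type_synonym ('v, 'k) germ = "(('v, 'k) point \<Rightarrow> 'k) set"
type_synonym ('v, 'k) complete_germ = "nat \<Rightarrow> ('v, 'k) germ set"
type_synonym ('v, 'k) local_elt = "(('v, 'k) complete_germ \<times> ('v, 'k) complete_germ) set"
type_synonym ('v, 'k) adele = "('v, 'k) point \<Rightarrow> ('v, 'k) local_elt"

definition completed_local_ring ::
  "('v::finite, 'k::field) point set \<Rightarrow> ('v, 'k) point \<Rightarrow> ('v, 'k) complete_germ ring" where
  "completed_local_ring C x = adic_completion (local_ring_at C x) (nonunits (local_ring_at C x))"

definition local_field ::
  "('v::finite, 'k::field) point set \<Rightarrow> ('v, 'k) point \<Rightarrow> ('v, 'k) local_elt ring" where
  "local_field C x = fraction_field (completed_local_ring C x)"

definition local_integers ::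
  "('v::finite, 'k::field) point set \<Rightarrow> ('v, 'k) point \<Rightarrow> ('v, 'k) local_elt set" where
  "local_integers C x =
     (\<lambda>a. frac (completed_local_ring C x) a \<one>\<^bsub>completed_local_ring C x\<^esub>) `
       carrier (completed_local_ring C x)"

definition adele_ring :: "('v::finite, 'k::field) point set \<Rightarrow> ('v, 'k) adele ring" where
  "adele_ring C =
     \<lparr>carrier = {\<alpha> \<in> (\<Pi>\<^sub>E x\<in>C. carrier (local_field C x)). finite {x \<in> C. \<alpha> x \<notin> local_integers C x}},
      monoid.mult = (\<lambda>\<alpha> \<beta>. \<lambda>x\<in>C. \<alpha> x \<otimes>\<^bsub>local_field C x\<^esub> \<beta> x),
      one = (\<lambda>x\<in>C. \<one>\<^bsub>local_field C x\<^esub>),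
      ring.zero = (\<lambda>x\<in>C. \<zero>\<^bsub>local_field C x\<^esub>),
      add = (\<lambda>\<alpha> \<beta>. \<lambda>x\<in>C. \<alpha> x \<oplus>\<^bsub>local_field C x\<^esub> \<beta> x)\<rparr>"

definition adele_const :: "('v::finite, 'k::field) point set \<Rightarrow> 'k \<Rightarrow> ('v, 'k) adele" where
  "adele_const C c =
     (\<lambda>x\<in>C. let Ox = local_ring_at C x in
        frac (completed_local_ring C x)
          (\<lambda>n. ideal_pow Ox (nonunits Ox) n +>\<^bsub>Ox\<^esub> local_ring_const C x c)
          \<one>\<^bsub>completed_local_ring C x\<^esub>)"


section \<open>Modules and algebras\<close>

definition module_homs ::
  "('r, 'x) ring_scheme \<Rightarrow> ('r, 'm, 'y) module_scheme \<Rightarrow> ('r, 'n, 'z) module_scheme \<Rightarrow> ('m \<Rightarrow> 'n) set"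
  where
  "module_homs R M N = {f \<in> carrier M \<rightarrow> carrier N.
     (\<forall>a\<in>carrier M. \<forall>b\<in>carrier M. f (a \<oplus>\<^bsub>M\<^esub> b) = f a \<oplus>\<^bsub>N\<^esub> f b) \<and>
     (\<forall>r\<in>carrier R. \<forall>a\<in>carrier M. f (r \<odot>\<^bsub>M\<^esub> a) = r \<odot>\<^bsub>N\<^esub> f a)}"

text \<open>
  The library's module records extend rings; the multiplicative fields are junk here.
\<close>

definition free_module :: "('r, 'x) ring_scheme \<Rightarrow> 'i set \<Rightarrow> ('r, 'i \<Rightarrow> 'r) module" where
  "free_module R I =
     \<lparr>carrier = {f \<in> I \<rightarrow>\<^sub>E carrier R. finite {i \<in> I. f i \<noteq> \<zero>\<^bsub>R\<^esub>}},
      monoid.mult = undefined, one = undefined,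
      ring.zero = (\<lambda>i\<in>I. \<zero>\<^bsub>R\<^esub>), add = (\<lambda>f g. \<lambda>i\<in>I. f i \<oplus>\<^bsub>R\<^esub> g i),
      module.smult = (\<lambda>r f. \<lambda>i\<in>I. r \<otimes>\<^bsub>R\<^esub> f i)\<rparr>"

text \<open>
  Projective means being a direct summand of a free module. Index sets in the type of \<open>M\<close> suffice,
  since a projective module is a direct summand of the free module on its own carrier.
\<close>

definition projective_module ::
  "('r, 'x) ring_scheme \<Rightarrow> ('r, 'm, 'y) module_scheme \<Rightarrow> bool" where
  "projective_module R M \<longleftrightarrow> module R M \<and>
     (\<exists>I :: 'm set. \<exists>i \<in> module_homs R M (free_module R I). \<exists>q \<in> module_homs R (free_module R I) M.
        \<forall>m\<in>carrier M. q (i m) = m)"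

definition finitely_generated_module ::
  "('r, 'x) ring_scheme \<Rightarrow> ('r, 'm, 'y) module_scheme \<Rightarrow> bool" where
  "finitely_generated_module R M \<longleftrightarrow> module R M \<and>
     (\<exists>B. finite B \<and> B \<subseteq> carrier M \<and>
        (\<forall>m\<in>carrier M. \<exists>c \<in> B \<rightarrow> carrier R. m = (\<Oplus>\<^bsub>M\<^esub>b\<in>B. c b \<odot>\<^bsub>M\<^esub> b)))"

definition free_of_rank ::
  "('r, 'x) ring_scheme \<Rightarrow> ('r, 'm, 'y) module_scheme \<Rightarrow> nat \<Rightarrow> bool" where
  "free_of_rank R M n \<longleftrightarrow> module R M \<and>
     (\<exists>f \<in> module_homs R (free_module R {..<n}) M.
        bij_betw f (carrier (free_module R {..<n})) (carrier M))"

definition algebra_via :: "('s, 'x) ring_scheme \<Rightarrow> ('r \<Rightarrow> 's) \<Rightarrow> ('r, 's) module" where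
  "algebra_via S f =
     \<lparr>carrier = carrier S, monoid.mult = monoid.mult S, one = \<one>\<^bsub>S\<^esub>, ring.zero = \<zero>\<^bsub>S\<^esub>, add = ring.add S,
      module.smult = (\<lambda>r s. f r \<otimes>\<^bsub>S\<^esub> s)\<rparr>"

text \<open>
  The tensor product of two commutative \<open>R\<close>-algebras \<open>S\<close> and \<open>T\<close>: the integral monoid ring on the
  multiplicative monoid \<open>S \<times> T\<close>, that is, the free abelian group on the pairs \<open>(s, t)\<close> with
  $(s,t)(s',t') = (ss',tt')$, modulo the usual relations. The multiples of a relation by a pair are
  again relations, so the ideal generated by the relations is the subgroup they generate.
\<close>

definition pair_ring ::
  "('s, 'x) ring_scheme \<Rightarrow> ('t, 'y) ring_scheme \<Rightarrow> ('s \<times> 't \<Rightarrow>\<^sub>0 int) ring" where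
  "pair_ring S T =
     \<lparr>carrier = {f. Poly_Mapping.keys f \<subseteq> carrier S \<times> carrier T},
      monoid.mult = (\<lambda>f g. frag_extend (\<lambda>(s, t).
        frag_extend (\<lambda>(s', t'). frag_of (s \<otimes>\<^bsub>S\<^esub> s', t \<otimes>\<^bsub>T\<^esub> t')) g) f),
      one = frag_of (\<one>\<^bsub>S\<^esub>, \<one>\<^bsub>T\<^esub>), ring.zero = 0, add = (+)\<rparr>"

definition tensor_relations ::
  "('r, 'z) ring_scheme \<Rightarrow> ('r, 's, 'x) module_scheme \<Rightarrow> ('r, 't, 'y) module_scheme
     \<Rightarrow> ('s \<times> 't \<Rightarrow>\<^sub>0 int) set" where
  "tensor_relations R S T =
     {frag_of (s \<oplus>\<^bsub>S\<^esub> s', t) - frag_of (s, t) - frag_of (s', t) | s s' t.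
        s \<in> carrier S \<and> s' \<in> carrier S \<and> t \<in> carrier T} \<union>
     {frag_of (s, t \<oplus>\<^bsub>T\<^esub> t') - frag_of (s, t) - frag_of (s, t') | s t t'.
        s \<in> carrier S \<and> t \<in> carrier T \<and> t' \<in> carrier T} \<union>
     {frag_of (r \<odot>\<^bsub>S\<^esub> s, t) - frag_of (s, r \<odot>\<^bsub>T\<^esub> t) | r s t.
        r \<in> carrier R \<and> s \<in> carrier S \<and> t \<in> carrier T}"

definition tensor_ideal ::
  "('r, 'z) ring_scheme \<Rightarrow> ('r, 's, 'x) module_scheme \<Rightarrow> ('r, 't, 'y) module_scheme
     \<Rightarrow> ('s \<times> 't \<Rightarrow>\<^sub>0 int) set" where
  "tensor_ideal R S T = Idl\<^bsub>pair_ring S T\<^esub> (tensor_relations R S T)"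

definition tensor_ring ::
  "('r, 'z) ring_scheme \<Rightarrow> ('r, 's, 'x) module_scheme \<Rightarrow> ('r, 't, 'y) module_scheme
     \<Rightarrow> ('s \<times> 't \<Rightarrow>\<^sub>0 int) set ring" where
  "tensor_ring R S T = pair_ring S T Quot tensor_ideal R S T"

definition pure_tensor ::
  "('r, 'z) ring_scheme \<Rightarrow> ('r, 's, 'x) module_scheme \<Rightarrow> ('r, 't, 'y) module_scheme
     \<Rightarrow> 's \<Rightarrow> 't \<Rightarrow> ('s \<times> 't \<Rightarrow>\<^sub>0 int) set" where
  "pure_tensor R S T s t = tensor_ideal R S T +>\<^bsub>pair_ring S T\<^esub> frag_of (s, t)"

definition base_change ::
  "('r, 'z) ring_scheme \<Rightarrow> ('r, 's, 'x) module_scheme \<Rightarrow> ('r, 't, 'y) module_scheme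
     \<Rightarrow> ('t, ('s \<times> 't \<Rightarrow>\<^sub>0 int) set) module" where
  "base_change R S T = algebra_via (tensor_ring R S T) (\<lambda>t. pure_tensor R S T \<one>\<^bsub>S\<^esub> t)"

text \<open>The map $u \otimes \mathrm{id}_T$; it is well defined on cosets for \<open>R\<close>-linear \<open>u\<close>.\<close>

definition tensor_map_left ::
  "('r, 'z) ring_scheme \<Rightarrow> ('r, 's, 'x) module_scheme \<Rightarrow> ('r, 't, 'y) module_scheme
     \<Rightarrow> ('s \<Rightarrow> 's) \<Rightarrow> ('s \<times> 't \<Rightarrow>\<^sub>0 int) set \<Rightarrow> ('s \<times> 't \<Rightarrow>\<^sub>0 int) set" where
  "tensor_map_left R S T u = (\<lambda>c \<in> carrier (tensor_ring R S T).
     \<Union>f\<in>c. tensor_ideal R S T +>\<^bsub>pair_ring S T\<^esub> frag_extend (\<lambda>(s, t). frag_of (u s, t)) f)"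

text \<open>The ring homomorphism $S \otimes_R S \to S$, $s \otimes s' \mapsto ss'$.\<close>

definition tensor_mult ::
  "('r, 's, 'x) module_scheme \<Rightarrow> ('s \<times> 's \<Rightarrow>\<^sub>0 int) set \<Rightarrow> 's" where
  "tensor_mult S c = the_elem ((\<lambda>f. \<Oplus>\<^bsub>S\<^esub>p\<in>Poly_Mapping.keys f.
     [Poly_Mapping.lookup f p] \<cdot>\<^bsub>S\<^esub> (fst p \<otimes>\<^bsub>S\<^esub> snd p)) ` c)"

definition separable_algebra ::
  "('r, 'z) ring_scheme \<Rightarrow> ('r, 's, 'x) module_scheme \<Rightarrow> bool" where
  "separable_algebra R S \<longleftrightarrow> algebra R S \<and>
     projective_module (tensor_ring R S S) (algebra_via S (tensor_mult S))"


section \<open>Galois extensions of commutative rings\<close>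

definition acts_by_algebra_automorphisms ::
  "('g, 'w) monoid_scheme \<Rightarrow> ('r, 'z) ring_scheme \<Rightarrow> ('r, 's, 'x) module_scheme
     \<Rightarrow> ('g \<Rightarrow> 's \<Rightarrow> 's) \<Rightarrow> bool" where
  "acts_by_algebra_automorphisms G R S \<rho> \<longleftrightarrow> group_action G (carrier S) \<rho> \<and>
     (\<forall>g\<in>carrier G. \<rho> g \<in> ring_hom S S \<and>
        (\<forall>r\<in>carrier R. \<forall>s\<in>carrier S. \<rho> g (r \<odot>\<^bsub>S\<^esub> s) = r \<odot>\<^bsub>S\<^esub> \<rho> g s))"

definition strongly_distinct ::
  "('s, 'x) ring_scheme \<Rightarrow> ('s \<Rightarrow> 's) \<Rightarrow> ('s \<Rightarrow> 's) \<Rightarrow> bool" where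
  "strongly_distinct S u w \<longleftrightarrow> (\<forall>e\<in>carrier S. e \<otimes>\<^bsub>S\<^esub> e = e \<and> e \<noteq> \<zero>\<^bsub>S\<^esub> \<longrightarrow>
     (\<exists>s\<in>carrier S. u s \<otimes>\<^bsub>S\<^esub> e \<noteq> w s \<otimes>\<^bsub>S\<^esub> e))"

definition galois_extension ::
  "('g, 'w) monoid_scheme \<Rightarrow> ('r, 'z) ring_scheme \<Rightarrow> ('r, 's, 'x) module_scheme
     \<Rightarrow> ('g \<Rightarrow> 's \<Rightarrow> 's) \<Rightarrow> bool" where
  "galois_extension G R S \<rho> \<longleftrightarrow>
     algebra R S \<and> inj_on (\<lambda>r. r \<odot>\<^bsub>S\<^esub> \<one>\<^bsub>S\<^esub>) (carrier R) \<and>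
     finite (carrier G) \<and>
     acts_by_algebra_automorphisms G R S \<rho> \<and> faithful_action G (carrier S) \<rho> \<and>
     {s \<in> carrier S. \<forall>g\<in>carrier G. \<rho> g s = s} = (\<lambda>r. r \<odot>\<^bsub>S\<^esub> \<one>\<^bsub>S\<^esub>) ` carrier R \<and>
     separable_algebra R S \<and>
     (\<forall>g\<in>carrier G. \<forall>h\<in>carrier G. g \<noteq> h \<longrightarrow> strongly_distinct S (\<rho> g) (\<rho> h))"

text \<open>$K_x$ as an algebra over the adele ring, and $S_x = S \otimes_{\mathbf{A}_C} K_x$.\<close>

definition local_field_algebra ::
  "('v::finite, 'k::field) point set \<Rightarrow> ('v, 'k) point \<Rightarrow> (('v, 'k) adele, ('v, 'k) local_elt) module"
  where
  "local_field_algebra C x = algebra_via (local_field C x) (\<lambda>\<alpha>. \<alpha> x)"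

definition localised_algebra ::
  "('v::finite, 'k::field) point set \<Rightarrow> (('v, 'k) adele, 's, 'w) module_scheme \<Rightarrow> ('v, 'k) point
     \<Rightarrow> (('v, 'k) local_elt, ('s \<times> ('v, 'k) local_elt \<Rightarrow>\<^sub>0 int) set) module" where
  "localised_algebra C S x = base_change (adele_ring C) S (local_field_algebra C x)"

definition localised_action ::
  "('v::finite, 'k::field) point set \<Rightarrow> (('v, 'k) adele, 's, 'w) module_scheme \<Rightarrow> ('g \<Rightarrow> 's \<Rightarrow> 's)
     \<Rightarrow> ('v, 'k) point
     \<Rightarrow> 'g \<Rightarrow> ('s \<times> ('v, 'k) local_elt \<Rightarrow>\<^sub>0 int) set \<Rightarrow> ('s \<times> ('v, 'k) local_elt \<Rightarrow>\<^sub>0 int) set" where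
  "localised_action C S \<rho> x g =
     tensor_map_left (adele_ring C) S (local_field_algebra C x) (\<rho> g)"

definition roots_of_unity_group :: "nat \<Rightarrow> 'k::field monoid" where
  "roots_of_unity_group p = \<lparr>carrier = {z. z ^ p = 1}, monoid.mult = (*), one = 1\<rparr>"

definition eigen_module ::
  "('v::finite, 'k::field) point set \<Rightarrow> ('g, 'z) monoid_scheme \<Rightarrow> (('v, 'k) adele, 's) module
     \<Rightarrow> ('g \<Rightarrow> 's \<Rightarrow> 's) \<Rightarrow> ('g \<Rightarrow> 'k) \<Rightarrow> (('v, 'k) adele, 's) module" where
  "eigen_module C G S \<rho> \<chi> =
     S\<lparr>carrier := {s \<in> carrier S. \<forall>g\<in>carrier G. \<rho> g s = adele_const C (\<chi> g) \<odot>\<^bsub>S\<^esub> s}\<rparr>"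

end

theory Submission
  imports Defs
begin

text \<open>
  Each local field \<open>K\<^sub>x\<close> is a direct factor of the adele ring \<open>A\<close>, cut out by an idempotent \<open>\<epsilon>\<^sub>x\<close>, so
  \<open>S\<^sub>x\<close> is identified with \<open>\<epsilon>\<^sub>x S\<close> and the Galois property passes from \<open>S\<close> to \<open>S\<^sub>x\<close>. Conversely,
  projectivity embeds \<open>S\<close> into the product of the \<open>S\<^sub>x\<close>, and the only condition that is not checked
  componentwise is \<open>S\<^sup>G = A\<close>. For \<open>t \<in> S\<^sup>G\<close> and every linear \<open>f : S \<rightarrow> A\<close> one has \<open>f(t) 1 = f(1) t\<close>,
  as this holds at every \<open>x\<close>; writing \<open>1 = \<Sum> f\<^sub>j(1) t\<^sub>j\<close> with averaged \<open>t\<^sub>j \<in> S\<^sup>G\<close> gives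
  \<open>t = \<Sum> f\<^sub>j(1) t\<^sub>j t = \<Sum> f\<^sub>j(t\<^sub>j t) 1\<close>.

  If \<open>S\<close> is Galois, the separability idempotent yields \<open>\<Sum> x\<^sub>i g(y\<^sub>i) = \<delta>\<^sub>g\<^sub>,\<^sub>1\<close>, hence
  \<open>\<Sum> u\<^sub>i v\<^sub>i = 1\<close> with \<open>u\<^sub>i \<in> S\<^sup>\<chi>\<close> and \<open>v\<^sub>i\<close> in the inverse eigenspace. The products \<open>u\<^sub>i v\<^sub>i\<close> are
  adeles; as the integers at \<open>x\<close> form a local ring and \<open>K\<^sub>x\<close> is a field, one of them is a unit at each \<open>x\<close>,
  integrally so at almost all \<open>x\<close>. Patching with idempotents gives \<open>u v = 1\<close>, so \<open>S\<^sup>\<chi> = A u\<close>, and the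
  powers of such a \<open>u\<close> for a faithful \<open>\<chi>\<close> form a basis of \<open>S\<close>.
\<close>

section \<open>Tensor products of commutative algebras\<close>

text \<open>The obstacle in \<open>S^G = A\<close> is integrality. At each \<open>x\<close> a fixed
  element \<open>t\<close> is a scalar \<open>k_x\<close>, but nothing local says that the family of
  these scalars is an adele. Linear functionals get around this: their values on \<open>S\<close>
  are adeles from the start, and the local scalars are used only to verify identities.

  The same concern shapes the patching of units: inverses chosen place by place form an adele only
  if almost all of them are integral. This is where the local ring of germs enters; its nonunits
  form an ideal, so \<open>A_x\<close> is local.

  The structure of the factors is read off from the adele ring, which is a commutative ring because
  \<open>S\<close> is an algebra over it. Extension by zero gives the ring axioms of
  \<open>K_x\<close>, closure of its multiplication excludes zero divisors in \<open>A_x\<close>,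
  and then \<open>K_x\<close> is a field.

  Projectivity over \<open>S \<otimes> S\<close> is traded for a separability idempotent, which can
  be pushed along surjections and evaluated against each \<open>g\<close>. Averaging uses
  \<open>1/p\<close>, available as \<open>p\<close> differs from the characteristic; a nontrivial
  \<open>p\<close>-th root of unity comes from algebraic closedness.\<close>

lemma frag_extend_fun_add:
  "frag_extend (\<lambda>p. a p + b p) f = frag_extend a f + frag_extend b f"
  by (simp add: frag_extend_def frag_cmul_distrib2 sum.distrib)

lemma frag_extend_fun_diff:
  "frag_extend (\<lambda>p. a p - b p) f = frag_extend a f - frag_extend b f"
proof -
  have "frag_extend (\<lambda>p. a p - b p) f + frag_extend b f = frag_extend a f"
    unfolding frag_extend_fun_add [symmetric] by simp
  then show ?thesis by (simp add: algebra_simps)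
qed

section \<open>The monoid ring on pairs\<close>

lemma pair_ring_carrier_iff: "f \<in> carrier (pair_ring S T) \<longleftrightarrow> Poly_Mapping.keys f \<subseteq> carrier S \<times> carrier T"
  by (simp add: pair_ring_def)

lemma pair_ring_add [simp]: "f \<oplus>\<^bsub>pair_ring S T\<^esub> g = f + g"
  and pair_ring_zero [simp]: "\<zero>\<^bsub>pair_ring S T\<^esub> = 0"
  and pair_ring_one: "\<one>\<^bsub>pair_ring S T\<^esub> = frag_of (\<one>\<^bsub>S\<^esub>, \<one>\<^bsub>T\<^esub>)"
  by (simp_all add: pair_ring_def)

lemma pair_ring_mult_of [simp]:
  "frag_of (s, t) \<otimes>\<^bsub>pair_ring S T\<^esub> frag_of (s', t') = frag_of (s \<otimes>\<^bsub>S\<^esub> s', t \<otimes>\<^bsub>T\<^esub> t')"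
  by (simp add: pair_ring_def)

lemma pair_ring_mult_left:
  "(f - g) \<otimes>\<^bsub>pair_ring S T\<^esub> h = f \<otimes>\<^bsub>pair_ring S T\<^esub> h - g \<otimes>\<^bsub>pair_ring S T\<^esub> h"
  "(f + g) \<otimes>\<^bsub>pair_ring S T\<^esub> h = f \<otimes>\<^bsub>pair_ring S T\<^esub> h + g \<otimes>\<^bsub>pair_ring S T\<^esub> h"
  "0 \<otimes>\<^bsub>pair_ring S T\<^esub> h = 0"
  by (simp_all add: pair_ring_def frag_extend_diff frag_extend_add)

text \<open>The product is an extension in its left factor first. Linearity on the right is
  linearity of \<open>frag_extend\<close> in the function being extended, hence the rules for sums
  and differences of functions.\<close>

lemma pair_ring_mult_right:
  "h \<otimes>\<^bsub>pair_ring S T\<^esub> (f - g) = h \<otimes>\<^bsub>pair_ring S T\<^esub> f - h \<otimes>\<^bsub>pair_ring S T\<^esub> g"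
  "h \<otimes>\<^bsub>pair_ring S T\<^esub> (f + g) = h \<otimes>\<^bsub>pair_ring S T\<^esub> f + h \<otimes>\<^bsub>pair_ring S T\<^esub> g"
  "h \<otimes>\<^bsub>pair_ring S T\<^esub> 0 = 0"
proof -
  show "h \<otimes>\<^bsub>pair_ring S T\<^esub> (f - g) = h \<otimes>\<^bsub>pair_ring S T\<^esub> f - h \<otimes>\<^bsub>pair_ring S T\<^esub> g"
    by (simp add: pair_ring_def frag_extend_diff case_prod_unfold frag_extend_fun_diff)
  show "h \<otimes>\<^bsub>pair_ring S T\<^esub> (f + g) = h \<otimes>\<^bsub>pair_ring S T\<^esub> f + h \<otimes>\<^bsub>pair_ring S T\<^esub> g"
    by (simp add: pair_ring_def frag_extend_add case_prod_unfold frag_extend_fun_add)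
  show "h \<otimes>\<^bsub>pair_ring S T\<^esub> 0 = 0"
    by (simp add: pair_ring_def frag_extend_eq_0 case_prod_unfold)
qed

lemma pair_ring_diff_closed:
  "f \<in> carrier (pair_ring S T) \<Longrightarrow> g \<in> carrier (pair_ring S T) \<Longrightarrow> f - g \<in> carrier (pair_ring S T)"
  using keys_diff [of f g] by (auto simp: pair_ring_carrier_iff)

text \<open>Differences generate sums and integer multiples, so an additive statement needs checking
  on single pairs only. The case \<open>one\<close> is that of one generator, not of the
  unit.\<close>

lemma pair_ring_induct [consumes 1, case_names zero one diff]:
  assumes "f \<in> carrier (pair_ring S T)"
    and "P 0" "\<And>s t. s \<in> carrier S \<Longrightarrow> t \<in> carrier T \<Longrightarrow> P (frag_of (s, t))"
    and "\<And>a b. \<lbrakk>a \<in> carrier (pair_ring S T); b \<in> carrier (pair_ring S T); P a; P b\<rbrakk> \<Longrightarrow> P (a - b)"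
  shows "P f"
proof -
  have "f \<in> carrier (pair_ring S T) \<and> P f"
    by (rule frag_induction [of f "carrier S \<times> carrier T"])
      (use assms in \<open>auto intro: pair_ring_diff_closed simp: pair_ring_carrier_iff [symmetric]\<close>,
       auto simp: pair_ring_carrier_iff)
  then show ?thesis ..
qed

context
  fixes S :: "('s, 'x) ring_scheme" and T :: "('t, 'y) ring_scheme"
  assumes S: "cring S" and T: "cring T"
begin

interpretation S: cring S by (rule S)
interpretation T: cring T by (rule T)

lemma pair_ring_mult_closed:
  assumes "f \<in> carrier (pair_ring S T)" "g \<in> carrier (pair_ring S T)"
  shows "f \<otimes>\<^bsub>pair_ring S T\<^esub> g \<in> carrier (pair_ring S T)"
  using assms(1)
proof (induction rule: pair_ring_induct)
  case zero
  show ?case by (simp add: pair_ring_mult_left pair_ring_carrier_iff)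
next
  case (one s t)
  note st = one
  show ?case using assms(2)
  proof (induction rule: pair_ring_induct)
    case zero
    show ?case by (simp add: pair_ring_mult_right pair_ring_carrier_iff)
  next
    case (one s' t')
    then show ?case using st by (simp add: pair_ring_carrier_iff)
  next
    case (diff a b)
    then show ?case by (simp add: pair_ring_mult_right pair_ring_diff_closed)
  qed
next
  case (diff a b)
  then show ?case by (simp add: pair_ring_mult_left pair_ring_diff_closed)
qed

lemma pair_ring_comm:
  assumes "f \<in> carrier (pair_ring S T)" "g \<in> carrier (pair_ring S T)"
  shows "f \<otimes>\<^bsub>pair_ring S T\<^esub> g = g \<otimes>\<^bsub>pair_ring S T\<^esub> f"
  using assms(1)
proof (induction rule: pair_ring_induct)
  case (one s t)
  note st = one
  show ?case using assms(2)
  proof (induction rule: pair_ring_induct)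
    case (one s' t')
    then show ?case using st by (simp add: S.m_comm T.m_comm)
  qed (simp_all add: pair_ring_mult_right pair_ring_mult_left)
qed (simp_all add: pair_ring_mult_right pair_ring_mult_left)

lemma pair_ring_assoc:
  assumes "f \<in> carrier (pair_ring S T)" "g \<in> carrier (pair_ring S T)" "h \<in> carrier (pair_ring S T)"
  shows "(f \<otimes>\<^bsub>pair_ring S T\<^esub> g) \<otimes>\<^bsub>pair_ring S T\<^esub> h = f \<otimes>\<^bsub>pair_ring S T\<^esub> (g \<otimes>\<^bsub>pair_ring S T\<^esub> h)"
  using assms(1)
proof (induction rule: pair_ring_induct)
  case (one s t)
  note st = one
  show ?case using assms(2)
  proof (induction rule: pair_ring_induct)
    case (one s' t')
    note st' = one
    show ?case using assms(3)
    proof (induction rule: pair_ring_induct)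
      case (one s'' t'')
      then show ?case using st st' by (simp add: S.m_assoc T.m_assoc)
    qed (simp_all add: pair_ring_mult_right pair_ring_mult_left)
  qed (simp_all add: pair_ring_mult_right pair_ring_mult_left)
qed (simp_all add: pair_ring_mult_right pair_ring_mult_left)

lemma pair_ring_l_one:
  assumes "f \<in> carrier (pair_ring S T)"
  shows "\<one>\<^bsub>pair_ring S T\<^esub> \<otimes>\<^bsub>pair_ring S T\<^esub> f = f"
  using assms
  by (induction rule: pair_ring_induct) (simp_all add: pair_ring_mult_right pair_ring_one)

lemma pair_ring_cring: "cring (pair_ring S T)"
proof (rule cringI)
  show "abelian_group (pair_ring S T)"
  proof (rule abelian_groupI)
    show "\<exists>y\<in>carrier (pair_ring S T). y \<oplus>\<^bsub>pair_ring S T\<^esub> x = \<zero>\<^bsub>pair_ring S T\<^esub>"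
      if "x \<in> carrier (pair_ring S T)" for x
      using that by (intro bexI [of _ "- x"]) (auto simp: pair_ring_carrier_iff)
    show "x \<oplus>\<^bsub>pair_ring S T\<^esub> y \<in> carrier (pair_ring S T)"
      if "x \<in> carrier (pair_ring S T)" "y \<in> carrier (pair_ring S T)" for x y
      using that Poly_Mapping.keys_add [of x y] by (auto simp: pair_ring_carrier_iff)
  qed (auto simp: pair_ring_carrier_iff algebra_simps)
  show "comm_monoid (pair_ring S T)"
    by (rule comm_monoidI)
      (auto simp: pair_ring_mult_closed pair_ring_assoc pair_ring_l_one intro: pair_ring_comm,
       simp add: pair_ring_one pair_ring_carrier_iff)
qed (simp add: pair_ring_mult_left)

lemma pair_ring_a_minus:
  assumes "f \<in> carrier (pair_ring S T)" "g \<in> carrier (pair_ring S T)"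
  shows "f \<ominus>\<^bsub>pair_ring S T\<^esub> g = f - g"
proof -
  interpret P: cring "pair_ring S T" by (rule pair_ring_cring)
  have "\<ominus>\<^bsub>pair_ring S T\<^esub> g = - g"
    using assms by (intro P.minus_equality) (auto simp: pair_ring_carrier_iff)
  then show ?thesis by (simp add: a_minus_def)
qed

end

text \<open>The additive extension of \<open>\<beta>\<close> from the generators to the free abelian
  group, with values in any ring. It is spelled out over the support so that
  \<open>tensor_mult\<close> becomes an instance.\<close>

definition frag_lift :: "('w, 'x) ring_scheme \<Rightarrow> ('p \<Rightarrow> 'w) \<Rightarrow> ('p \<Rightarrow>\<^sub>0 int) \<Rightarrow> 'w" where
  "frag_lift W \<beta> f = (\<Oplus>\<^bsub>W\<^esub>p\<in>Poly_Mapping.keys f. [Poly_Mapping.lookup f p] \<cdot>\<^bsub>W\<^esub> \<beta> p)"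

lemma (in cring) frag_lift_superset:
  assumes "finite K" "Poly_Mapping.keys f \<subseteq> K" "\<beta> \<in> K \<rightarrow> carrier R"
  shows "frag_lift R \<beta> f = (\<Oplus>p\<in>K. [Poly_Mapping.lookup f p] \<cdot> \<beta> p)"
  unfolding frag_lift_def
proof (rule add.finprod_mono_neutral_cong_left)
  show "\<And>i. i \<in> K - Poly_Mapping.keys f \<Longrightarrow> [Poly_Mapping.lookup f i] \<cdot> \<beta> i = \<zero>"
    by (simp add: in_keys_iff add_pow_def int_pow_def)
  show "(\<lambda>p. [Poly_Mapping.lookup f p] \<cdot> \<beta> p) \<in> K \<rightarrow> carrier R"
    using assms(3) by (auto intro: add.int_pow_closed)
qed (use assms in auto)

lemma (in cring) frag_lift_closed:
  assumes "\<beta> \<in> Poly_Mapping.keys f \<rightarrow> carrier R"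
  shows "frag_lift R \<beta> f \<in> carrier R"
  unfolding frag_lift_def using assms by (auto intro!: finsum_closed add.int_pow_closed)

lemma (in cring) frag_lift_zero [simp]: "frag_lift R \<beta> 0 = \<zero>"
  by (simp add: frag_lift_def)

lemma (in cring) frag_lift_of [simp]: "\<beta> p \<in> carrier R \<Longrightarrow> frag_lift R \<beta> (frag_of p) = \<beta> p"
  by (simp add: frag_lift_def)

text \<open>Cancellation may shrink the support of \<open>f - g\<close>, so all three sums are first
  taken over the union of the supports of \<open>f\<close> and \<open>g\<close>.\<close>

lemma (in cring) frag_lift_diff:
  fixes \<beta> :: "'p \<Rightarrow> 'a"
  assumes "\<beta> \<in> A \<rightarrow> carrier R" "Poly_Mapping.keys f \<subseteq> A" "Poly_Mapping.keys g \<subseteq> A"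
  shows "frag_lift R \<beta> (f - g) = frag_lift R \<beta> f \<ominus> frag_lift R \<beta> g"
proof -
  let ?K = "Poly_Mapping.keys f \<union> Poly_Mapping.keys g"
  have K: "finite ?K" "\<beta> \<in> ?K \<rightarrow> carrier R" using assms by auto
  have cl: "(\<lambda>p. [Poly_Mapping.lookup h p] \<cdot> \<beta> p) \<in> ?K \<rightarrow> carrier R" for h :: "'p \<Rightarrow>\<^sub>0 int"
    using K by (auto intro: add.int_pow_closed)
  have "frag_lift R \<beta> f = frag_lift R \<beta> (f - g) \<oplus> frag_lift R \<beta> g"
  proof -
    have "frag_lift R \<beta> (f - g) \<oplus> frag_lift R \<beta> g
        = (\<Oplus>p\<in>?K. [Poly_Mapping.lookup (f - g) p] \<cdot> \<beta> p \<oplus> [Poly_Mapping.lookup g p] \<cdot> \<beta> p)"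
      unfolding finsum_addf [OF cl cl] using K keys_diff [of f g]
      by (subst (1 2) frag_lift_superset [of ?K]) auto
    also have "\<dots> = (\<Oplus>p\<in>?K. [Poly_Mapping.lookup f p] \<cdot> \<beta> p)"
    proof (rule finsum_cong')
      fix p assume "p \<in> ?K"
      then have "\<beta> p \<in> carrier R" using K by blast
      then show "[Poly_Mapping.lookup (f - g) p] \<cdot> \<beta> p \<oplus> [Poly_Mapping.lookup g p] \<cdot> \<beta> p
          = [Poly_Mapping.lookup f p] \<cdot> \<beta> p"
        unfolding lookup_minus by (metis add.int_pow_mult diff_add_cancel)
    qed (use cl in auto)
    finally show ?thesis using K by (simp add: frag_lift_superset [of ?K])
  qed
  moreover have "frag_lift R \<beta> h \<in> carrier R" if "Poly_Mapping.keys h \<subseteq> A" for h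
    using that assms(1) by (intro frag_lift_closed) auto
  moreover have "Poly_Mapping.keys (f - g) \<subseteq> A" using keys_diff [of f g] assms by auto
  ultimately show ?thesis using assms
    by (simp add: a_minus_def a_assoc r_neg)
qed


text \<open>Both sides are additive in \<open>f\<close> and in \<open>g\<close>, which leaves only
  the hypothesis on pairs.\<close>

lemma (in cring) frag_lift_mult:
  assumes ST: "cring S" "cring T"
    and \<beta>: "\<beta> \<in> carrier S \<times> carrier T \<rightarrow> carrier R"
    and mult: "\<And>s s' t t'. \<lbrakk>s \<in> carrier S; s' \<in> carrier S; t \<in> carrier T; t' \<in> carrier T\<rbrakk>
      \<Longrightarrow> \<beta> (s \<otimes>\<^bsub>S\<^esub> s', t \<otimes>\<^bsub>T\<^esub> t') = \<beta> (s, t) \<otimes> \<beta> (s', t')"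
    and fg: "f \<in> carrier (pair_ring S T)" "g \<in> carrier (pair_ring S T)"
  shows "frag_lift R \<beta> (f \<otimes>\<^bsub>pair_ring S T\<^esub> g) = frag_lift R \<beta> f \<otimes> frag_lift R \<beta> g"
proof -
  interpret S: cring S by (rule ST)
  interpret T: cring T by (rule ST)
  have cl: "frag_lift R \<beta> h \<in> carrier R" if "h \<in> carrier (pair_ring S T)" for h
    using that \<beta> by (intro frag_lift_closed) (auto simp: pair_ring_carrier_iff)
  have of_cl: "\<beta> (s, t) \<in> carrier R" if "s \<in> carrier S" "t \<in> carrier T" for s t
    using \<beta> that by auto
  have diff: "frag_lift R \<beta> (h - h') = frag_lift R \<beta> h \<ominus> frag_lift R \<beta> h'"
    if "h \<in> carrier (pair_ring S T)" "h' \<in> carrier (pair_ring S T)" for h h'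
    using that \<beta> by (intro frag_lift_diff [of _ "carrier S \<times> carrier T"]) (auto simp: pair_ring_carrier_iff)
  note closed = pair_ring_mult_closed [OF ST]
  show ?thesis using fg(1)
  proof (induction rule: pair_ring_induct)
    case zero
    show ?case using cl [OF fg(2)] by (simp add: pair_ring_mult_left)
  next
    case (one s t)
    note st = one
    then have st': "frag_of (s, t) \<in> carrier (pair_ring S T)" by (simp add: pair_ring_carrier_iff)
    show ?case using fg(2)
    proof (induction rule: pair_ring_induct)
      case zero
      show ?case using cl [OF st'] by (simp add: pair_ring_mult_right)
    next
      case (one s' t')
      then show ?case using st by (simp add: of_cl mult)
    next
      case (diff a b)
      then show ?case
        by (simp add: pair_ring_mult_right \<open>\<And>h h'. _ \<Longrightarrow> _ \<Longrightarrow> frag_lift R \<beta> (h - h') = _\<close> closed st'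
            cl [OF st', simplified] r_distr a_minus_def cl r_minus)
    qed
  next
    case (diff a b)
    then show ?case
      by (simp add: pair_ring_mult_left \<open>\<And>h h'. _ \<Longrightarrow> _ \<Longrightarrow> frag_lift R \<beta> (h - h') = _\<close> closed fg(2)
          l_distr a_minus_def cl l_minus)
  qed
qed

section \<open>Tensor products and pure tensors\<close>

locale tensor_product =
  fixes R :: "('r, 'z) ring_scheme" and S :: "('r, 's, 'x) module_scheme"
    and T :: "('r, 't, 'y) module_scheme"
  assumes alg_left: "algebra R S" and alg_right: "algebra R T"
begin

sublocale S: cring S by (rule algebra.M_cring [OF alg_left])
sublocale T: cring T by (rule algebra.M_cring [OF alg_right])
sublocale P: cring "pair_ring S T" by (rule pair_ring_cring) unfold_locales

lemma smult_left_closed [simp]: "r \<in> carrier R \<Longrightarrow> s \<in> carrier S \<Longrightarrow> r \<odot>\<^bsub>S\<^esub> s \<in> carrier S"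
  using module.smult_closed [OF algebra.module [OF alg_left]] .

lemma smult_right_closed [simp]: "r \<in> carrier R \<Longrightarrow> t \<in> carrier T \<Longrightarrow> r \<odot>\<^bsub>T\<^esub> t \<in> carrier T"
  using module.smult_closed [OF algebra.module [OF alg_right]] .

abbreviation I where "I \<equiv> tensor_ideal R S T"
abbreviation TR where "TR \<equiv> tensor_ring R S T"
abbreviation pt where "pt \<equiv> pure_tensor R S T"

lemma pair_in_pair_ring [simp]:
  "s \<in> carrier S \<Longrightarrow> t \<in> carrier T \<Longrightarrow> frag_of (s, t) \<in> carrier (pair_ring S T)"
  by (simp add: pair_ring_carrier_iff)

lemma diff_closed' [simp]:
  "f \<in> carrier (pair_ring S T) \<Longrightarrow> g \<in> carrier (pair_ring S T) \<Longrightarrow> f - g \<in> carrier (pair_ring S T)"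
  by (rule pair_ring_diff_closed)

lemma tensor_relations_carrier: "tensor_relations R S T \<subseteq> carrier (pair_ring S T)"
  unfolding tensor_relations_def by auto

sublocale I: ideal I "pair_ring S T"
  unfolding tensor_ideal_def by (rule P.genideal_ideal [OF tensor_relations_carrier])

lemma tensor_relations_in_ideal: "tensor_relations R S T \<subseteq> I"
  unfolding tensor_ideal_def by (rule P.genideal_self [OF tensor_relations_carrier])

lemma tensor_ideal_minimal: "ideal J (pair_ring S T) \<Longrightarrow> tensor_relations R S T \<subseteq> J \<Longrightarrow> I \<subseteq> J"
  unfolding tensor_ideal_def by (rule P.genideal_minimal)

sublocale TR: cring TR
  unfolding tensor_ring_def by (rule I.quotient_is_cring) unfold_locales

definition proj where "proj f = I +>\<^bsub>pair_ring S T\<^esub> f"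

lemma proj_hom: "proj \<in> ring_hom (pair_ring S T) TR"
  unfolding tensor_ring_def proj_def [abs_def] by (rule I.rcos_ring_hom)

lemma proj_closed [simp]: "f \<in> carrier (pair_ring S T) \<Longrightarrow> proj f \<in> carrier TR"
  using proj_hom by (rule ring_hom_closed)

lemma proj_add: "f \<in> carrier (pair_ring S T) \<Longrightarrow> g \<in> carrier (pair_ring S T)
    \<Longrightarrow> proj (f + g) = proj f \<oplus>\<^bsub>TR\<^esub> proj g"
  using ring_hom_add [OF proj_hom] by simp

lemma proj_mult: "f \<in> carrier (pair_ring S T) \<Longrightarrow> g \<in> carrier (pair_ring S T)
    \<Longrightarrow> proj (f \<otimes>\<^bsub>pair_ring S T\<^esub> g) = proj f \<otimes>\<^bsub>TR\<^esub> proj g"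
  using ring_hom_mult [OF proj_hom] by simp

lemma proj_zero: "proj 0 = \<zero>\<^bsub>TR\<^esub>"
  using ring_hom_zero [OF proj_hom P.ring_axioms TR.ring_axioms] by simp

lemma proj_diff: "f \<in> carrier (pair_ring S T) \<Longrightarrow> g \<in> carrier (pair_ring S T)
    \<Longrightarrow> proj (f - g) = proj f \<ominus>\<^bsub>TR\<^esub> proj g"
proof -
  assume fg: "f \<in> carrier (pair_ring S T)" "g \<in> carrier (pair_ring S T)"
  interpret h: ring_hom_cring "pair_ring S T" TR proj
    by unfold_locales (rule proj_hom)
  show ?thesis
    unfolding pair_ring_a_minus [OF S.cring_axioms T.cring_axioms fg, symmetric]
    using fg by (simp add: a_minus_def del: pair_ring_add)
qed

lemma proj_eqI:
  assumes "f \<in> carrier (pair_ring S T)" "g \<in> carrier (pair_ring S T)" "f - g \<in> I"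
  shows "proj f = proj g"
  unfolding proj_def
  using assms P.quotient_eq_iff_same_a_r_cos [OF I.is_ideal assms(1,2)]
  by (simp add: pair_ring_a_minus S.cring_axioms T.cring_axioms)

lemma proj_eqD:
  assumes "f \<in> carrier (pair_ring S T)" "g \<in> carrier (pair_ring S T)" "proj f = proj g"
  shows "f - g \<in> I"
  using assms P.quotient_eq_iff_same_a_r_cos [OF I.is_ideal assms(1,2)]
  by (simp add: proj_def pair_ring_a_minus S.cring_axioms T.cring_axioms)

lemma pt_eq: "pt s t = proj (frag_of (s, t))"
  by (simp add: pure_tensor_def proj_def)

lemma pt_closed [simp]: "s \<in> carrier S \<Longrightarrow> t \<in> carrier T \<Longrightarrow> pt s t \<in> carrier TR"
  by (simp add: pt_eq)

lemma pt_mult: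
  "\<lbrakk>s \<in> carrier S; t \<in> carrier T; s' \<in> carrier S; t' \<in> carrier T\<rbrakk>
    \<Longrightarrow> pt s t \<otimes>\<^bsub>TR\<^esub> pt s' t' = pt (s \<otimes>\<^bsub>S\<^esub> s') (t \<otimes>\<^bsub>T\<^esub> t')"
  by (simp add: pt_eq proj_mult [symmetric])

lemma pt_one: "pt \<one>\<^bsub>S\<^esub> \<one>\<^bsub>T\<^esub> = \<one>\<^bsub>TR\<^esub>"
  using ring_hom_one [OF proj_hom] by (simp add: pt_eq pair_ring_one)

lemma pt_add_left:
  assumes "s \<in> carrier S" "s' \<in> carrier S" "t \<in> carrier T"
  shows "pt (s \<oplus>\<^bsub>S\<^esub> s') t = pt s t \<oplus>\<^bsub>TR\<^esub> pt s' t"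
proof -
  have "frag_of (s \<oplus>\<^bsub>S\<^esub> s', t) - frag_of (s, t) - frag_of (s', t) \<in> I"
    using assms by (intro subsetD [OF tensor_relations_in_ideal]) (auto simp: tensor_relations_def)
  moreover have "frag_of (s, t) + frag_of (s', t) \<in> carrier (pair_ring S T)"
    using assms P.a_closed [of "frag_of (s, t)" "frag_of (s', t)"] by simp
  ultimately show ?thesis
    using assms by (simp add: pt_eq proj_add [symmetric] proj_eqI diff_diff_eq)
qed

lemma pt_add_right:
  assumes "s \<in> carrier S" "t \<in> carrier T" "t' \<in> carrier T"
  shows "pt s (t \<oplus>\<^bsub>T\<^esub> t') = pt s t \<oplus>\<^bsub>TR\<^esub> pt s t'"
proof -
  have "frag_of (s, t \<oplus>\<^bsub>T\<^esub> t') - frag_of (s, t) - frag_of (s, t') \<in> I"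
    using assms by (intro subsetD [OF tensor_relations_in_ideal]) (auto simp: tensor_relations_def)
  moreover have "frag_of (s, t) + frag_of (s, t') \<in> carrier (pair_ring S T)"
    using assms P.a_closed [of "frag_of (s, t)" "frag_of (s, t')"] by simp
  ultimately show ?thesis
    using assms by (simp add: pt_eq proj_add [symmetric] proj_eqI diff_diff_eq)
qed

lemma pt_smult:
  assumes "r \<in> carrier R" "s \<in> carrier S" "t \<in> carrier T"
  shows "pt (r \<odot>\<^bsub>S\<^esub> s) t = pt s (r \<odot>\<^bsub>T\<^esub> t)"
proof -
  have "frag_of (r \<odot>\<^bsub>S\<^esub> s, t) - frag_of (s, r \<odot>\<^bsub>T\<^esub> t) \<in> I"
    using assms by (intro subsetD [OF tensor_relations_in_ideal]) (auto simp: tensor_relations_def)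
  then show ?thesis using assms by (simp add: pt_eq proj_eqI)
qed

lemma proj_surj: "c \<in> carrier TR \<Longrightarrow> \<exists>f\<in>carrier (pair_ring S T). c = proj f"
  by (auto simp: tensor_ring_def proj_def FactRing_def A_RCOSETS_def')

lemma tensor_induct [consumes 1, case_names zero pure diff]:
  assumes "c \<in> carrier TR"
    and "P \<zero>\<^bsub>TR\<^esub>" "\<And>s t. s \<in> carrier S \<Longrightarrow> t \<in> carrier T \<Longrightarrow> P (pt s t)"
    and "\<And>a b. \<lbrakk>a \<in> carrier TR; b \<in> carrier TR; P a; P b\<rbrakk> \<Longrightarrow> P (a \<ominus>\<^bsub>TR\<^esub> b)"
  shows "P c"
proof -
  obtain f where f: "f \<in> carrier (pair_ring S T)" "c = proj f" using proj_surj assms(1) by blast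
  from f(1) have "P (proj f)"
    by (induction rule: pair_ring_induct)
      (use assms in \<open>simp_all add: proj_zero proj_diff pt_eq [symmetric]\<close>)
  then show ?thesis using f by simp
qed

end

text \<open>Elements of a tensor product are cosets. For balanced \<open>\<beta>\<close> the
  extension is constant on each of them, so \<open>the_elem\<close> is applied to a singleton; lemma
  \<open>L_proj\<close> establishes this.\<close>

definition tensor_lift :: "('w, 'x) ring_scheme \<Rightarrow> ('s \<times> 't \<Rightarrow> 'w) \<Rightarrow> ('s \<times> 't \<Rightarrow>\<^sub>0 int) set \<Rightarrow> 'w" where
  "tensor_lift W \<beta> c = the_elem (frag_lift W \<beta> ` c)"

lemma tensor_mult_eq_lift: "tensor_mult S = tensor_lift S (\<lambda>p. fst p \<otimes>\<^bsub>S\<^esub> snd p)"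
  by (rule ext) (simp add: tensor_mult_def tensor_lift_def frag_lift_def [abs_def])

text \<open>\<open>W\<close> carries no \<open>R\<close>-module structure: balance is an equation
  between values of \<open>\<beta>\<close>, which allows targets over another base ring.
  Multiplicativity on pairs makes the induced map multiplicative.\<close>

locale tensor_bilinear = tensor_product R S T + W: cring W
  for R :: "('r, 'z) ring_scheme" and S :: "('r, 's, 'x) module_scheme"
    and T :: "('r, 't, 'y) module_scheme" and W :: "('w, 'v) ring_scheme" +
  fixes \<beta> :: "'s \<times> 't \<Rightarrow> 'w"
  assumes \<beta>_closed: "\<And>s t. \<lbrakk>s \<in> carrier S; t \<in> carrier T\<rbrakk> \<Longrightarrow> \<beta> (s, t) \<in> carrier W"
    and \<beta>_add_left: "\<And>s s' t. \<lbrakk>s \<in> carrier S; s' \<in> carrier S; t \<in> carrier T\<rbrakk>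
      \<Longrightarrow> \<beta> (s \<oplus>\<^bsub>S\<^esub> s', t) = \<beta> (s, t) \<oplus>\<^bsub>W\<^esub> \<beta> (s', t)"
    and \<beta>_add_right: "\<And>s t t'. \<lbrakk>s \<in> carrier S; t \<in> carrier T; t' \<in> carrier T\<rbrakk>
      \<Longrightarrow> \<beta> (s, t \<oplus>\<^bsub>T\<^esub> t') = \<beta> (s, t) \<oplus>\<^bsub>W\<^esub> \<beta> (s, t')"
    and \<beta>_smult: "\<And>r s t. \<lbrakk>r \<in> carrier R; s \<in> carrier S; t \<in> carrier T\<rbrakk>
      \<Longrightarrow> \<beta> (r \<odot>\<^bsub>S\<^esub> s, t) = \<beta> (s, r \<odot>\<^bsub>T\<^esub> t)"
    and \<beta>_mult: "\<And>s s' t t'. \<lbrakk>s \<in> carrier S; s' \<in> carrier S; t \<in> carrier T; t' \<in> carrier T\<rbrakk>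
      \<Longrightarrow> \<beta> (s \<otimes>\<^bsub>S\<^esub> s', t \<otimes>\<^bsub>T\<^esub> t') = \<beta> (s, t) \<otimes>\<^bsub>W\<^esub> \<beta> (s', t')"
begin

abbreviation F where "F \<equiv> frag_lift W \<beta>"
abbreviation L where "L \<equiv> tensor_lift W \<beta>"

lemma \<beta>_funcset: "\<beta> \<in> carrier S \<times> carrier T \<rightarrow> carrier W"
  using \<beta>_closed by auto

lemma F_closed [simp]: "f \<in> carrier (pair_ring S T) \<Longrightarrow> F f \<in> carrier W"
  using \<beta>_funcset by (intro W.frag_lift_closed) (auto simp: pair_ring_carrier_iff)

lemma F_diff: "f \<in> carrier (pair_ring S T) \<Longrightarrow> g \<in> carrier (pair_ring S T)
    \<Longrightarrow> F (f - g) = F f \<ominus>\<^bsub>W\<^esub> F g"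
  using W.frag_lift_diff [OF \<beta>_funcset] by (simp add: pair_ring_carrier_iff)

lemma F_mult: "f \<in> carrier (pair_ring S T) \<Longrightarrow> g \<in> carrier (pair_ring S T)
    \<Longrightarrow> F (f \<otimes>\<^bsub>pair_ring S T\<^esub> g) = F f \<otimes>\<^bsub>W\<^esub> F g"
  using W.frag_lift_mult [OF S.cring_axioms T.cring_axioms \<beta>_funcset \<beta>_mult] .

text \<open>The zeros of \<open>F\<close> form an ideal because \<open>F\<close> is additive and
  multiplicative. It contains the defining relations by bilinearity and balance, hence also the
  ideal they generate.\<close>

lemma F_ideal: "f \<in> I \<Longrightarrow> F f = \<zero>\<^bsub>W\<^esub>"
proof -
  let ?J = "{f \<in> carrier (pair_ring S T). F f = \<zero>\<^bsub>W\<^esub>}"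
  have neg: "\<ominus>\<^bsub>pair_ring S T\<^esub> f = 0 - f" if "f \<in> carrier (pair_ring S T)" for f
    using that pair_ring_a_minus [OF S.cring_axioms T.cring_axioms P.zero_closed that] P.a_inv_closed [OF that]
    by (simp add: a_minus_def)
  have add: "F (f + g) = F f \<oplus>\<^bsub>W\<^esub> F g"
    if "f \<in> carrier (pair_ring S T)" "g \<in> carrier (pair_ring S T)" for f g
  proof -
    have "F f = F ((f + g) - g)" by simp
    also have "\<dots> = F (f + g) \<ominus>\<^bsub>W\<^esub> F g" using that P.a_closed [OF that] by (intro F_diff) auto
    finally show ?thesis using that P.a_closed [OF that]
      by (simp add: a_minus_def W.a_assoc W.l_neg)
  qed
  have J: "ideal ?J (pair_ring S T)"
  proof (rule idealI)
    show "ring (pair_ring S T)" by (rule P.ring_axioms)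
    show "subgroup ?J (add_monoid (pair_ring S T))"
    proof (rule group.subgroupI)
      show "group (add_monoid (pair_ring S T))" by (rule P.add.group_axioms)
      show "inv\<^bsub>add_monoid (pair_ring S T)\<^esub> a \<in> ?J" if "a \<in> ?J" for a
        using that neg [of a] P.zero_closed P.a_inv_closed [of a] F_diff [of 0 a]
        by (simp add: a_inv_def a_minus_def W.minus_zero)
      show "a \<otimes>\<^bsub>add_monoid (pair_ring S T)\<^esub> b \<in> ?J" if "a \<in> ?J" "b \<in> ?J" for a b
        using that add [of a b] P.a_closed [of a b] by simp
      show "?J \<noteq> {}" using P.zero_closed by (auto intro!: exI [of _ 0])
    qed auto
  qed (auto simp: F_mult)
  have *: "(x \<oplus>\<^bsub>W\<^esub> y) \<ominus>\<^bsub>W\<^esub> x \<ominus>\<^bsub>W\<^esub> y = \<zero>\<^bsub>W\<^esub>" "x \<ominus>\<^bsub>W\<^esub> x = \<zero>\<^bsub>W\<^esub>"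
    if "x \<in> carrier W" "y \<in> carrier W" for x y
    using that by (simp_all add: a_minus_def W.a_assoc W.a_comm [of "\<ominus>\<^bsub>W\<^esub> x"] W.r_neg2 W.r_neg)
  have "tensor_relations R S T \<subseteq> ?J"
    unfolding tensor_relations_def
    by (auto simp: * F_diff \<beta>_closed \<beta>_add_left \<beta>_add_right \<beta>_smult)
  with J have "I \<subseteq> ?J" by (rule tensor_ideal_minimal)
  then show "f \<in> I \<Longrightarrow> F f = \<zero>\<^bsub>W\<^esub>" by blast
qed

lemma L_proj: "f \<in> carrier (pair_ring S T) \<Longrightarrow> L (proj f) = F f"
proof -
  assume f: "f \<in> carrier (pair_ring S T)"
  have "F g = F f" if "g \<in> proj f" for g
  proof -
    have g: "g \<in> carrier (pair_ring S T)"
      using that f P.a_r_coset_subset_G [OF I.a_subset f] by (auto simp: proj_def)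
    have "proj g = proj f"
      using that f I.a_repr_independence' by (simp add: proj_def)
    then have "g - f \<in> I" using f g by (rule_tac proj_eqD)
    then have "F g \<ominus>\<^bsub>W\<^esub> F f = \<zero>\<^bsub>W\<^esub>" using F_ideal F_diff [OF g f] by simp
    then show ?thesis using f g by simp
  qed
  moreover have "f \<in> proj f" using f I.a_rcos_self by (simp add: proj_def)
  ultimately have "F ` proj f = {F f}" by blast
  then show ?thesis by (simp add: tensor_lift_def)
qed

lemma L_pt: "s \<in> carrier S \<Longrightarrow> t \<in> carrier T \<Longrightarrow> L (pt s t) = \<beta> (s, t)"
  by (simp add: pt_eq L_proj \<beta>_closed)

lemma L_closed [simp]: "c \<in> carrier TR \<Longrightarrow> L c \<in> carrier W"
  by (metis proj_surj L_proj F_closed)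

lemma L_zero: "L \<zero>\<^bsub>TR\<^esub> = \<zero>\<^bsub>W\<^esub>"
  using L_proj [OF P.zero_closed] by (simp add: proj_zero)

lemma L_diff: "c \<in> carrier TR \<Longrightarrow> d \<in> carrier TR \<Longrightarrow> L (c \<ominus>\<^bsub>TR\<^esub> d) = L c \<ominus>\<^bsub>W\<^esub> L d"
  by (metis proj_surj L_proj F_diff proj_diff diff_closed')

lemma L_add: "c \<in> carrier TR \<Longrightarrow> d \<in> carrier TR \<Longrightarrow> L (c \<oplus>\<^bsub>TR\<^esub> d) = L c \<oplus>\<^bsub>W\<^esub> L d"
proof -
  assume cd: "c \<in> carrier TR" "d \<in> carrier TR"
  have "(c \<oplus>\<^bsub>TR\<^esub> d) \<ominus>\<^bsub>TR\<^esub> d = c"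
    using cd by (simp add: a_minus_def TR.a_assoc TR.r_neg)
  moreover have "L ((c \<oplus>\<^bsub>TR\<^esub> d) \<ominus>\<^bsub>TR\<^esub> d) = L (c \<oplus>\<^bsub>TR\<^esub> d) \<ominus>\<^bsub>W\<^esub> L d"
    using cd by (intro L_diff) simp_all
  ultimately have "L c = L (c \<oplus>\<^bsub>TR\<^esub> d) \<ominus>\<^bsub>W\<^esub> L d" by (simp only:)
  then show ?thesis using cd by (simp add: a_minus_def W.a_assoc W.l_neg)
qed

lemma L_mult: "c \<in> carrier TR \<Longrightarrow> d \<in> carrier TR \<Longrightarrow> L (c \<otimes>\<^bsub>TR\<^esub> d) = L c \<otimes>\<^bsub>W\<^esub> L d"
  by (metis proj_surj L_proj F_mult proj_mult P.m_closed)

lemma L_hom: "\<beta> (\<one>\<^bsub>S\<^esub>, \<one>\<^bsub>T\<^esub>) = \<one>\<^bsub>W\<^esub> \<Longrightarrow> L \<in> ring_hom TR W"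
  by (rule ring_hom_memI) (auto simp: L_add L_mult L_pt pt_one [symmetric])

end

context tensor_product
begin

lemma tensor_map_left_bilinear:
  assumes u: "u \<in> ring_hom S S"
    and lin: "\<And>r s. r \<in> carrier R \<Longrightarrow> s \<in> carrier S \<Longrightarrow> u (r \<odot>\<^bsub>S\<^esub> s) = r \<odot>\<^bsub>S\<^esub> u s"
  shows "tensor_bilinear R S T TR (\<lambda>p. pt (u (fst p)) (snd p))"
  by unfold_locales
    (use assms in \<open>auto simp: ring_hom_closed ring_hom_add ring_hom_mult pt_add_left pt_add_right
       pt_smult pt_mult\<close>)

text \<open>\<open>tensor_map_left\<close> acts on representatives and takes the union of the
  resulting cosets. Every representative yields the same coset, the value of the map induced by
  \<open>(s, t) \<mapsto> u(s) \<otimes> t\<close>, so the union is that coset.\<close>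

lemma tensor_map_left_eq:
  assumes u: "u \<in> ring_hom S S"
    and lin: "\<And>r s. r \<in> carrier R \<Longrightarrow> s \<in> carrier S \<Longrightarrow> u (r \<odot>\<^bsub>S\<^esub> s) = r \<odot>\<^bsub>S\<^esub> u s"
    and c: "c \<in> carrier TR"
  shows "tensor_map_left R S T u c = tensor_lift TR (\<lambda>p. pt (u (fst p)) (snd p)) c"
proof -
  let ?E = "frag_extend (\<lambda>(s, t). frag_of (u s, t))"
  interpret L: tensor_bilinear R S T TR "\<lambda>p. pt (u (fst p)) (snd p)"
    by (rule tensor_map_left_bilinear [OF u lin])
  have E: "?E f \<in> carrier (pair_ring S T) \<and> proj (?E f) = L.F f" if "f \<in> carrier (pair_ring S T)" for f
    using that
  proof (induction rule: pair_ring_induct)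
    case zero
    show ?case by (simp add: pair_ring_carrier_iff proj_zero)
  next
    case (one s t)
    then show ?case using u by (simp add: ring_hom_closed pt_eq)
  next
    case (diff a b)
    then show ?case by (simp add: frag_extend_diff proj_diff L.F_diff)
  qed
  obtain f where f: "f \<in> carrier (pair_ring S T)" "c = proj f" using proj_surj c by blast
  have "g \<in> carrier (pair_ring S T) \<and> c = proj g" if "g \<in> c" for g
    using that f I.a_repr_independence' [of g f] P.a_r_coset_subset_G [OF I.a_subset f(1)]
    by (auto simp: proj_def)
  then have "proj (?E g) = L.L c" if "g \<in> c" for g
    using that E [of g] L.L_proj [of g] by auto
  moreover have "f \<in> c" using f I.a_rcos_self by (simp add: proj_def)
  ultimately have "(\<Union>g\<in>c. proj (?E g)) = L.L c" by blast
  then show ?thesis using c by (simp add: tensor_map_left_def proj_def)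
qed

end

lemma algebra_via_simps [simp]:
  "carrier (algebra_via S f) = carrier S" "monoid.mult (algebra_via S f) = monoid.mult S"
  "\<one>\<^bsub>algebra_via S f\<^esub> = \<one>\<^bsub>S\<^esub>" "\<zero>\<^bsub>algebra_via S f\<^esub> = \<zero>\<^bsub>S\<^esub>" "ring.add (algebra_via S f) = ring.add S"
  "r \<odot>\<^bsub>algebra_via S f\<^esub> s = f r \<otimes>\<^bsub>S\<^esub> s"
  by (simp_all add: algebra_via_def)

lemma algebra_via_cring:
  assumes "cring S" shows "cring (algebra_via S f)"
proof -
  interpret S: cring S by (rule assms)
  show ?thesis
  proof (rule cringI)
    show "abelian_group (algebra_via S f)"
      by (rule abelian_groupI) (auto simp: S.a_ac intro: S.l_neg)
    show "comm_monoid (algebra_via S f)"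
      by (rule comm_monoidI) (auto simp: S.m_ac)
  qed (auto simp: S.l_distr)
qed

lemma algebra_via_algebra:
  assumes "cring R" "cring S" "h \<in> ring_hom R S"
  shows "algebra R (algebra_via S h)"
proof -
  interpret S: cring S by (rule assms)
  show ?thesis
    by (rule algebraI [OF assms(1) algebra_via_cring [OF assms(2)]])
      (use assms(3) in \<open>auto simp: ring_hom_closed ring_hom_add ring_hom_mult ring_hom_one
         S.l_distr S.r_distr S.m_assoc\<close>)
qed

lemma module_homsD:
  assumes "f \<in> module_homs R M N"
  shows "a \<in> carrier M \<Longrightarrow> f a \<in> carrier N"
    "a \<in> carrier M \<Longrightarrow> b \<in> carrier M \<Longrightarrow> f (a \<oplus>\<^bsub>M\<^esub> b) = f a \<oplus>\<^bsub>N\<^esub> f b"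
    "r \<in> carrier R \<Longrightarrow> a \<in> carrier M \<Longrightarrow> f (r \<odot>\<^bsub>M\<^esub> a) = r \<odot>\<^bsub>N\<^esub> f a"
  using assms by (auto simp: module_homs_def)

section \<open>Projective modules and separable algebras\<close>

definition unit_vector :: "('r, 'x) ring_scheme \<Rightarrow> 'i set \<Rightarrow> 'i \<Rightarrow> 'i \<Rightarrow> 'r" where
  "unit_vector R I j = (\<lambda>i\<in>I. if i = j then \<one>\<^bsub>R\<^esub> else \<zero>\<^bsub>R\<^esub>)"

lemma unit_vector_closed:
  assumes "ring R"
  shows "unit_vector R I j \<in> carrier (free_module R I)"
proof -
  interpret ring R by (rule assms)
  have "finite {i \<in> I. unit_vector R I j i \<noteq> \<zero>\<^bsub>R\<^esub>}"
    by (rule finite_subset [of _ "{j}"]) (auto simp: unit_vector_def)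
  then show ?thesis by (auto simp: free_module_def unit_vector_def)
qed

text \<open>Induction peels one coordinate off \<open>f\<close> at a time. The set \<open>J\<close>
  may exceed the support, since a coordinate in \<open>J\<close> may already be zero.\<close>

lemma free_module_expand:
  assumes M: "module R M" and q: "q \<in> module_homs R (free_module R I) M"
    and J: "finite J" "J \<subseteq> I" and f: "f \<in> I \<rightarrow>\<^sub>E carrier R" "{i \<in> I. f i \<noteq> \<zero>\<^bsub>R\<^esub>} \<subseteq> J"
  shows "q f = (\<Oplus>\<^bsub>M\<^esub>j\<in>J. f j \<odot>\<^bsub>M\<^esub> q (unit_vector R I j))"
  using J f
proof (induction J arbitrary: f rule: finite_induct)
  interpret module R M by (rule M)
  {
    case empty
    have z: "(\<lambda>i\<in>I. \<zero>\<^bsub>R\<^esub>) \<in> carrier (free_module R I)"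
      by (auto simp: free_module_def)
    \<comment> \<open>\<open>module_homs\<close> has no clause for zero, so the zero vector is
      presented as a multiple by the scalar zero.\<close>
    have "f = \<zero>\<^bsub>R\<^esub> \<odot>\<^bsub>free_module R I\<^esub> (\<lambda>i\<in>I. \<zero>\<^bsub>R\<^esub>)"
      using empty by (auto simp: free_module_def fun_eq_iff PiE_def extensional_def)
    then have "q f = \<zero>\<^bsub>R\<^esub> \<odot>\<^bsub>M\<^esub> q (\<lambda>i\<in>I. \<zero>\<^bsub>R\<^esub>)"
      using module_homsD(3) [OF q R.zero_closed z] by simp
    then show ?case using module_homsD(1) [OF q z] by simp
  next
    case (insert j J)
    let ?\<delta> = "unit_vector R I"
    define g where "g = f(j := \<zero>\<^bsub>R\<^esub>)"
    note \<delta> = unit_vector_closed [OF R.ring_axioms, of I]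
    have fj: "f k \<in> carrier R" if "k \<in> I" for k using insert that by auto
    have g: "g \<in> I \<rightarrow>\<^sub>E carrier R" "{i \<in> I. g i \<noteq> \<zero>\<^bsub>R\<^esub>} \<subseteq> J"
      using insert by (auto simp: g_def PiE_def extensional_def)
    have gf: "g \<in> carrier (free_module R I)"
      using g insert.hyps finite_subset [OF g(2)] by (simp add: free_module_def)
    have fd: "f j \<odot>\<^bsub>free_module R I\<^esub> ?\<delta> j \<in> carrier (free_module R I)"
    proof -
      have "finite {i \<in> I. (f j \<odot>\<^bsub>free_module R I\<^esub> ?\<delta> j) i \<noteq> \<zero>\<^bsub>R\<^esub>}"
        by (rule finite_subset [of _ "{j}"]) (use insert.prems fj in \<open>auto simp: free_module_def unit_vector_def\<close>)
      then show ?thesis using insert.prems fj by (auto simp: free_module_def unit_vector_def)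
    qed
    have "f = g \<oplus>\<^bsub>free_module R I\<^esub> (f j \<odot>\<^bsub>free_module R I\<^esub> ?\<delta> j)"
      using insert.prems fj by (auto simp: free_module_def unit_vector_def g_def fun_eq_iff PiE_def extensional_def)
    then have "q f = q g \<oplus>\<^bsub>M\<^esub> f j \<odot>\<^bsub>M\<^esub> q (?\<delta> j)"
      using module_homsD(2) [OF q gf fd] module_homsD(3) [OF q fj \<delta>] insert.prems by simp
    also have "q g = (\<Oplus>\<^bsub>M\<^esub>k\<in>J. g k \<odot>\<^bsub>M\<^esub> q (?\<delta> k))"
      by (rule insert.IH) (use g insert.prems in auto)
    also have "\<dots> = (\<Oplus>\<^bsub>M\<^esub>k\<in>J. f k \<odot>\<^bsub>M\<^esub> q (?\<delta> k))"
      using insert fj module_homsD(1) [OF q \<delta>] by (intro M.finsum_cong') (auto simp: g_def)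
    finally show ?case
      using insert fj module_homsD(1) [OF q \<delta>]
      by (subst M.finsum_insert) (auto intro!: M.a_comm M.finsum_closed)
  }
qed

definition linear_functionals :: "('r, 'x) ring_scheme \<Rightarrow> ('r, 'm, 'y) module_scheme \<Rightarrow> ('m \<Rightarrow> 'r) set" where
  "linear_functionals R M = module_homs R M (algebra_via R (\<lambda>r. r))"

lemma linear_functionalsD:
  assumes "f \<in> linear_functionals R M"
  shows "a \<in> carrier M \<Longrightarrow> f a \<in> carrier R"
    "a \<in> carrier M \<Longrightarrow> b \<in> carrier M \<Longrightarrow> f (a \<oplus>\<^bsub>M\<^esub> b) = f a \<oplus>\<^bsub>R\<^esub> f b"
    "r \<in> carrier R \<Longrightarrow> a \<in> carrier M \<Longrightarrow> f (r \<odot>\<^bsub>M\<^esub> a) = r \<otimes>\<^bsub>R\<^esub> f a"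
  using module_homsD [OF assms [unfolded linear_functionals_def]] by simp_all

text \<open>The dual basis lemma at a single element. The functionals are the coordinates of the
  splitting \<open>i\<close>; those in the support of \<open>i m\<close> are kept, so
  \<open>J\<close> is finite but depends on \<open>m\<close>.\<close>

lemma projective_module_dual_basis:
  fixes M :: "('r, 'm, 'y) module_scheme"
  assumes "projective_module R M" "m \<in> carrier M"
  obtains J :: "'m set" and \<phi> a where "finite J" "\<phi> \<in> J \<rightarrow> linear_functionals R M" "a \<in> J \<rightarrow> carrier M"
    "m = (\<Oplus>\<^bsub>M\<^esub>j\<in>J. \<phi> j m \<odot>\<^bsub>M\<^esub> a j)"
proof -
  from assms obtain I :: "'m set" and i q where M: "module R M"
    and i: "i \<in> module_homs R M (free_module R I)"
    and q: "q \<in> module_homs R (free_module R I) M" and qi: "q (i m) = m"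
    unfolding projective_module_def by blast
  interpret module R M by (rule M)
  let ?J = "{j \<in> I. i m j \<noteq> \<zero>\<^bsub>R\<^esub>}"
  have im: "i m \<in> carrier (free_module R I)" using module_homsD(1) [OF i assms(2)] .
  show thesis
  proof (rule that)
    show fin: "finite ?J" using im by (simp add: free_module_def)
    have "(\<lambda>x. i x j) \<in> linear_functionals R M" if "j \<in> ?J" for j
    proof -
      have *: "i x j \<in> carrier R" if "x \<in> carrier M" for x
        using module_homsD(1) [OF i that] \<open>j \<in> ?J\<close> by (auto simp: free_module_def)
      then show ?thesis
        using that module_homsD(2,3) [OF i]
        by (auto simp: linear_functionals_def module_homs_def free_module_def)
    qed
    then show "(\<lambda>j x. i x j) \<in> ?J \<rightarrow> linear_functionals R M" by blast
    show "(\<lambda>j. q (unit_vector R I j)) \<in> ?J \<rightarrow> carrier M"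
      using module_homsD(1) [OF q unit_vector_closed [OF R.ring_axioms]] by blast
    show "m = (\<Oplus>\<^bsub>M\<^esub>j\<in>?J. i m j \<odot>\<^bsub>M\<^esub> q (unit_vector R I j))"
      using free_module_expand [OF M q fin, of "i m"] im qi by (auto simp: free_module_def)
  qed
qed

section \<open>Separability idempotents\<close>

locale comm_algebra =
  fixes R :: "('r, 'z) ring_scheme" and S :: "('r, 's, 'x) module_scheme"
  assumes alg: "algebra R S"
begin

sublocale R: cring R by (rule algebra.R_cring [OF alg])
sublocale S: cring S by (rule algebra.M_cring [OF alg])
sublocale Mod: module R S by (rule algebra.module [OF alg])
sublocale TP: tensor_product R S S by (rule tensor_product.intro) (rule alg)+

lemma smult_mult_left: "\<lbrakk>r \<in> carrier R; s \<in> carrier S; t \<in> carrier S\<rbrakk>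
    \<Longrightarrow> (r \<odot>\<^bsub>S\<^esub> s) \<otimes>\<^bsub>S\<^esub> t = r \<odot>\<^bsub>S\<^esub> (s \<otimes>\<^bsub>S\<^esub> t)"
  using algebra.smult_assoc2 [OF alg] .

lemma smult_mult_right: "\<lbrakk>r \<in> carrier R; s \<in> carrier S; t \<in> carrier S\<rbrakk>
    \<Longrightarrow> s \<otimes>\<^bsub>S\<^esub> (r \<odot>\<^bsub>S\<^esub> t) = r \<odot>\<^bsub>S\<^esub> (s \<otimes>\<^bsub>S\<^esub> t)"
  using smult_mult_left [of r t s] S.m_comm by simp

sublocale Mu: tensor_bilinear R S S S "\<lambda>p. fst p \<otimes>\<^bsub>S\<^esub> snd p"
  by unfold_locales (auto simp: S.l_distr S.r_distr smult_mult_left smult_mult_right S.m_ac)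

lemma tensor_mult_hom: "tensor_mult S \<in> ring_hom (tensor_ring R S S) S"
  unfolding tensor_mult_eq_lift by (rule Mu.L_hom) simp

lemma tensor_mult_pt: "s \<in> carrier S \<Longrightarrow> t \<in> carrier S \<Longrightarrow> tensor_mult S (TP.pt s t) = s \<otimes>\<^bsub>S\<^esub> t"
  unfolding tensor_mult_eq_lift by (simp add: Mu.L_pt)

lemma tensor_mult_diff: "c \<in> carrier TP.TR \<Longrightarrow> d \<in> carrier TP.TR
    \<Longrightarrow> tensor_mult S (c \<ominus>\<^bsub>TP.TR\<^esub> d) = tensor_mult S c \<ominus>\<^bsub>S\<^esub> tensor_mult S d"
  unfolding tensor_mult_eq_lift by (rule Mu.L_diff)

end

text \<open>The separability idempotent. That \<open>e\<close> is idempotent follows from the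
  conditions: balance gives \<open>e e = \<mu>(e) e\<close>, where \<open>\<mu>\<close> is the
  multiplication map and \<open>\<mu>(e) = 1\<close>.\<close>

definition separability_element ::
  "('r, 'z) ring_scheme \<Rightarrow> ('r, 's, 'x) module_scheme \<Rightarrow> ('s \<times> 's \<Rightarrow>\<^sub>0 int) set \<Rightarrow> bool" where
  "separability_element R S e \<longleftrightarrow> e \<in> carrier (tensor_ring R S S) \<and> tensor_mult S e = \<one>\<^bsub>S\<^esub> \<and>
     (\<forall>s\<in>carrier S. pure_tensor R S S s \<one>\<^bsub>S\<^esub> \<otimes>\<^bsub>tensor_ring R S S\<^esub> e
       = pure_tensor R S S \<one>\<^bsub>S\<^esub> s \<otimes>\<^bsub>tensor_ring R S S\<^esub> e)"

text \<open>Expand \<open>1\<close> in a dual basis of \<open>S\<close> over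
  \<open>S \<otimes> S\<close> and lift the vectors:
  \<open>e = \<Sum> \<phi>_j(1) (a_j \<otimes> 1)\<close> multiplies out to \<open>1\<close>.
  Balance holds because each functional is linear over both tensor factors, so \<open>(s \<otimes>
  1) \<phi>_j(1) = \<phi>_j(s) = (1 \<otimes> s) \<phi>_j(1)\<close>.\<close>

lemma (in comm_algebra) separable_imp_separability_element:
  assumes "separable_algebra R S"
  shows "\<exists>e. separability_element R S e"
proof -
  let ?V = "algebra_via S (tensor_mult S)"
  have proj: "projective_module TP.TR ?V" using assms by (simp add: separable_algebra_def)
  interpret h: ring_hom_cring TP.TR S "tensor_mult S"
    by unfold_locales (rule tensor_mult_hom)
  obtain J :: "'s set" and \<phi> a where J: "finite J" "\<phi> \<in> J \<rightarrow> linear_functionals TP.TR ?V" "a \<in> J \<rightarrow> carrier S"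
    "\<one>\<^bsub>S\<^esub> = (\<Oplus>\<^bsub>?V\<^esub>j\<in>J. tensor_mult S (\<phi> j \<one>\<^bsub>S\<^esub>) \<otimes>\<^bsub>S\<^esub> a j)"
    by (rule projective_module_dual_basis [OF proj, unfolded algebra_via_simps, OF S.one_closed])
  note \<phi> = linear_functionalsD [OF funcset_mem [OF J(2)], simplified]
  note a = funcset_mem [OF J(3)]
  define e where "e = (\<Oplus>\<^bsub>TP.TR\<^esub>j\<in>J. \<phi> j \<one>\<^bsub>S\<^esub> \<otimes>\<^bsub>TP.TR\<^esub> TP.pt (a j) \<one>\<^bsub>S\<^esub>)"
  have cl: "(\<lambda>j. \<phi> j \<one>\<^bsub>S\<^esub> \<otimes>\<^bsub>TP.TR\<^esub> TP.pt (a j) \<one>\<^bsub>S\<^esub>) \<in> J \<rightarrow> carrier TP.TR"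
    using \<phi>(1) a by auto
  have e: "e \<in> carrier TP.TR" unfolding e_def by (rule TP.TR.finsum_closed [OF cl])
  have fs: "finsum ?V f J = finsum S f J" for f
    by (simp add: finsum_def finprod_def)
  have "tensor_mult S e = (\<Oplus>\<^bsub>S\<^esub>j\<in>J. tensor_mult S (\<phi> j \<one>\<^bsub>S\<^esub> \<otimes>\<^bsub>TP.TR\<^esub> TP.pt (a j) \<one>\<^bsub>S\<^esub>))"
    unfolding e_def using cl by (simp add: comp_def)
  also have "\<dots> = (\<Oplus>\<^bsub>S\<^esub>j\<in>J. tensor_mult S (\<phi> j \<one>\<^bsub>S\<^esub>) \<otimes>\<^bsub>S\<^esub> a j)"
    by (rule S.finsum_cong') (use \<phi>(1) a in \<open>auto simp: tensor_mult_pt\<close>)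
  finally have "tensor_mult S e = \<one>\<^bsub>S\<^esub>" using J(4) by (simp add: fs)
  moreover have "TP.pt s \<one>\<^bsub>S\<^esub> \<otimes>\<^bsub>TP.TR\<^esub> e = TP.pt \<one>\<^bsub>S\<^esub> s \<otimes>\<^bsub>TP.TR\<^esub> e" if s: "s \<in> carrier S" for s
  proof -
    have "TP.pt s \<one>\<^bsub>S\<^esub> \<otimes>\<^bsub>TP.TR\<^esub> e
        = (\<Oplus>\<^bsub>TP.TR\<^esub>j\<in>J. TP.pt s \<one>\<^bsub>S\<^esub> \<otimes>\<^bsub>TP.TR\<^esub> (\<phi> j \<one>\<^bsub>S\<^esub> \<otimes>\<^bsub>TP.TR\<^esub> TP.pt (a j) \<one>\<^bsub>S\<^esub>))"
      unfolding e_def using s cl J(1) by (intro TP.TR.finsum_rdistr) auto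
    also have "\<dots> = (\<Oplus>\<^bsub>TP.TR\<^esub>j\<in>J. TP.pt \<one>\<^bsub>S\<^esub> s \<otimes>\<^bsub>TP.TR\<^esub> (\<phi> j \<one>\<^bsub>S\<^esub> \<otimes>\<^bsub>TP.TR\<^esub> TP.pt (a j) \<one>\<^bsub>S\<^esub>))"
    proof (rule TP.TR.finsum_cong')
      fix j assume j: "j \<in> J"
      have "TP.pt s \<one>\<^bsub>S\<^esub> \<otimes>\<^bsub>TP.TR\<^esub> \<phi> j \<one>\<^bsub>S\<^esub> = \<phi> j s"
        using \<phi>(3) [OF j, of "TP.pt s \<one>\<^bsub>S\<^esub>" "\<one>\<^bsub>S\<^esub>"] s by (simp add: tensor_mult_pt)
      moreover have "TP.pt \<one>\<^bsub>S\<^esub> s \<otimes>\<^bsub>TP.TR\<^esub> \<phi> j \<one>\<^bsub>S\<^esub> = \<phi> j s"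
        using \<phi>(3) [OF j, of "TP.pt \<one>\<^bsub>S\<^esub> s" "\<one>\<^bsub>S\<^esub>"] s by (simp add: tensor_mult_pt)
      ultimately show "TP.pt s \<one>\<^bsub>S\<^esub> \<otimes>\<^bsub>TP.TR\<^esub> (\<phi> j \<one>\<^bsub>S\<^esub> \<otimes>\<^bsub>TP.TR\<^esub> TP.pt (a j) \<one>\<^bsub>S\<^esub>)
          = TP.pt \<one>\<^bsub>S\<^esub> s \<otimes>\<^bsub>TP.TR\<^esub> (\<phi> j \<one>\<^bsub>S\<^esub> \<otimes>\<^bsub>TP.TR\<^esub> TP.pt (a j) \<one>\<^bsub>S\<^esub>)"
        using \<phi>(1) [OF j] a [OF j] s by (simp add: TP.TR.m_assoc [symmetric])
    qed (use s cl in auto)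
    also have "\<dots> = TP.pt \<one>\<^bsub>S\<^esub> s \<otimes>\<^bsub>TP.TR\<^esub> e"
      unfolding e_def using s cl J(1) by (intro TP.TR.finsum_rdistr [symmetric]) auto
    finally show ?thesis .
  qed
  ultimately show ?thesis using e by (auto simp: separability_element_def)
qed

text \<open>On \<open>e\<close> the elements \<open>t \<otimes> 1\<close> and
  \<open>1 \<otimes> t\<close> act alike, so \<open>s \<otimes> t\<close> acts as
  \<open>st \<otimes> 1\<close>; additivity does the rest.\<close>

lemma (in comm_algebra) separability_element_mult:
  assumes e: "separability_element R S e" and c: "c \<in> carrier TP.TR"
  shows "c \<otimes>\<^bsub>TP.TR\<^esub> e = TP.pt (tensor_mult S c) \<one>\<^bsub>S\<^esub> \<otimes>\<^bsub>TP.TR\<^esub> e"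
  using c
proof (induction rule: TP.tensor_induct)
  interpret h: ring_hom_cring TP.TR S "tensor_mult S"
    by unfold_locales (rule tensor_mult_hom)
  interpret l: ring_hom_cring S TP.TR "\<lambda>s. TP.pt s \<one>\<^bsub>S\<^esub>"
    by unfold_locales (auto intro!: ring_hom_memI simp: TP.pt_add_left TP.pt_mult TP.pt_one)
  have ecl: "e \<in> carrier TP.TR" and bal: "\<And>s. s \<in> carrier S \<Longrightarrow>
      TP.pt s \<one>\<^bsub>S\<^esub> \<otimes>\<^bsub>TP.TR\<^esub> e = TP.pt \<one>\<^bsub>S\<^esub> s \<otimes>\<^bsub>TP.TR\<^esub> e"
    using e by (auto simp: separability_element_def)
  {
    case zero
    show ?case using ecl by simp
  next
    case (pure s t)
    have "TP.pt s t \<otimes>\<^bsub>TP.TR\<^esub> e = TP.pt s \<one>\<^bsub>S\<^esub> \<otimes>\<^bsub>TP.TR\<^esub> (TP.pt \<one>\<^bsub>S\<^esub> t \<otimes>\<^bsub>TP.TR\<^esub> e)"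
      using pure ecl by (simp add: TP.TR.m_assoc [symmetric] TP.pt_mult)
    also have "TP.pt \<one>\<^bsub>S\<^esub> t \<otimes>\<^bsub>TP.TR\<^esub> e = TP.pt t \<one>\<^bsub>S\<^esub> \<otimes>\<^bsub>TP.TR\<^esub> e"
      by (rule bal [OF pure(2), symmetric])
    also have "TP.pt s \<one>\<^bsub>S\<^esub> \<otimes>\<^bsub>TP.TR\<^esub> \<dots> = (TP.pt s \<one>\<^bsub>S\<^esub> \<otimes>\<^bsub>TP.TR\<^esub> TP.pt t \<one>\<^bsub>S\<^esub>) \<otimes>\<^bsub>TP.TR\<^esub> e"
      using pure ecl by (intro TP.TR.m_assoc [symmetric]) auto
    also have "\<dots> = TP.pt (s \<otimes>\<^bsub>S\<^esub> t) \<one>\<^bsub>S\<^esub> \<otimes>\<^bsub>TP.TR\<^esub> e"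
      using pure by (simp add: TP.pt_mult del: l.hom_mult)
    finally show ?case using pure by (simp add: tensor_mult_pt)
  next
    case (diff a b)
    then show ?case using ecl
      by (simp add: a_minus_def TP.TR.l_distr TP.TR.l_minus)
  }
qed

text \<open>The map \<open>s \<mapsto> (s \<otimes> 1) e\<close> is linear over
  \<open>S \<otimes> S\<close> by the preceding rule and splits the multiplication because
  \<open>e\<close> multiplies out to \<open>1\<close>. So \<open>S\<close> is a summand of a free
  module of rank one, indexed by a singleton in the type of \<open>S\<close>.\<close>

lemma (in comm_algebra) separability_element_imp_separable:
  assumes e: "separability_element R S e"
  shows "separable_algebra R S"
proof -
  let ?V = "algebra_via S (tensor_mult S)"
  let ?I = "{\<one>\<^bsub>S\<^esub>}"
  interpret V: algebra TP.TR ?V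
    by (rule algebra_via_algebra [OF TP.TR.cring_axioms S.cring_axioms tensor_mult_hom])
  interpret h: ring_hom_cring TP.TR S "tensor_mult S"
    by unfold_locales (rule tensor_mult_hom)
  have ecl: "e \<in> carrier TP.TR" and e1: "tensor_mult S e = \<one>\<^bsub>S\<^esub>"
    using e by (auto simp: separability_element_def)
  define i where "i s = (\<lambda>j\<in>?I. TP.pt s \<one>\<^bsub>S\<^esub> \<otimes>\<^bsub>TP.TR\<^esub> e)" for s
  define q where "q f = tensor_mult S (f \<one>\<^bsub>S\<^esub>)" for f
  have lin: "TP.pt (tensor_mult S r \<otimes>\<^bsub>S\<^esub> s) \<one>\<^bsub>S\<^esub> \<otimes>\<^bsub>TP.TR\<^esub> e = r \<otimes>\<^bsub>TP.TR\<^esub> (TP.pt s \<one>\<^bsub>S\<^esub> \<otimes>\<^bsub>TP.TR\<^esub> e)"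
    if "r \<in> carrier TP.TR" "s \<in> carrier S" for r s
  proof -
    have "r \<otimes>\<^bsub>TP.TR\<^esub> (TP.pt s \<one>\<^bsub>S\<^esub> \<otimes>\<^bsub>TP.TR\<^esub> e) = TP.pt s \<one>\<^bsub>S\<^esub> \<otimes>\<^bsub>TP.TR\<^esub> (r \<otimes>\<^bsub>TP.TR\<^esub> e)"
      using that ecl by (intro TP.TR.m_lcomm) auto
    also have "\<dots> = TP.pt s \<one>\<^bsub>S\<^esub> \<otimes>\<^bsub>TP.TR\<^esub> (TP.pt (tensor_mult S r) \<one>\<^bsub>S\<^esub> \<otimes>\<^bsub>TP.TR\<^esub> e)"
      by (subst separability_element_mult [OF e that(1)]) (rule refl)
    also have "\<dots> = TP.pt (s \<otimes>\<^bsub>S\<^esub> tensor_mult S r) \<one>\<^bsub>S\<^esub> \<otimes>\<^bsub>TP.TR\<^esub> e"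
      using that ecl by (simp add: TP.TR.m_assoc [symmetric] TP.pt_mult)
    finally show ?thesis using that by (simp add: S.m_comm)
  qed
  have "i \<in> module_homs TP.TR ?V (free_module TP.TR ?I)"
    using ecl lin
    by (auto simp: module_homs_def free_module_def i_def TP.pt_add_left TP.TR.l_distr fun_eq_iff)
  moreover have "q \<in> module_homs TP.TR (free_module TP.TR ?I) ?V"
    by (auto simp: module_homs_def free_module_def q_def PiE_iff)
  moreover have "q (i s) = s" if "s \<in> carrier ?V" for s
    using that ecl e1 by (simp add: i_def q_def tensor_mult_pt)
  ultimately have "projective_module TP.TR ?V"
    unfolding projective_module_def using V.module by blast
  then show ?thesis by (simp add: separable_algebra_def alg)
qed

text \<open>A separability element is pushed forward by \<open>h \<otimes> h\<close>. Surjectivity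
  of \<open>h\<close> carries the balance condition to every element of \<open>S'\<close>. The base
  ring changes along \<open>k\<close>, as base change to a factor requires.\<close>

lemma separable_algebra_surj:
  fixes R :: "('r, 'z) ring_scheme" and S :: "('r, 's, 'x) module_scheme"
    and R' :: "('q, 'w) ring_scheme" and S' :: "('q, 't, 'y) module_scheme"
  assumes sep: "separable_algebra R S" and alg': "algebra R' S'"
    and h: "h \<in> ring_hom S S'" and surj: "h ` carrier S = carrier S'"
    and k: "\<And>r. r \<in> carrier R \<Longrightarrow> k r \<in> carrier R'"
    and semilin: "\<And>r s. r \<in> carrier R \<Longrightarrow> s \<in> carrier S \<Longrightarrow> h (r \<odot>\<^bsub>S\<^esub> s) = k r \<odot>\<^bsub>S'\<^esub> h s"
  shows "separable_algebra R' S'"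
proof -
  interpret A: comm_algebra R S by (rule comm_algebra.intro) (use sep in \<open>simp add: separable_algebra_def\<close>)
  interpret B: comm_algebra R' S' by (rule comm_algebra.intro) (rule alg')
  interpret L: tensor_bilinear R S S B.TP.TR "\<lambda>p. B.TP.pt (h (fst p)) (h (snd p))"
    by unfold_locales
      (use h in \<open>auto simp: ring_hom_closed ring_hom_add ring_hom_mult B.TP.pt_add_left
         B.TP.pt_add_right B.TP.pt_mult B.TP.pt_smult semilin k\<close>)
  obtain e where e: "separability_element R S e"
    using A.separable_imp_separability_element [OF sep] by blast
  then have ecl: "e \<in> carrier A.TP.TR" and e1: "tensor_mult S e = \<one>\<^bsub>S\<^esub>"
    and bal: "\<And>s. s \<in> carrier S \<Longrightarrow>
      A.TP.pt s \<one>\<^bsub>S\<^esub> \<otimes>\<^bsub>A.TP.TR\<^esub> e = A.TP.pt \<one>\<^bsub>S\<^esub> s \<otimes>\<^bsub>A.TP.TR\<^esub> e"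
    by (auto simp: separability_element_def)
  interpret h: ring_hom_cring S S' h by unfold_locales (rule h)
  have mult: "tensor_mult S' (L.L c) = h (tensor_mult S c)" if "c \<in> carrier A.TP.TR" for c
    using that
  proof (induction rule: A.TP.tensor_induct)
    interpret ma: ring_hom_cring A.TP.TR S "tensor_mult S"
      by unfold_locales (rule A.tensor_mult_hom)
    interpret mb: ring_hom_cring B.TP.TR S' "tensor_mult S'"
      by unfold_locales (rule B.tensor_mult_hom)
    {
      case zero
      show ?case by (simp add: L.L_zero)
    next
      case (pure s t)
      then show ?case by (simp add: L.L_pt B.tensor_mult_pt A.tensor_mult_pt)
    next
      case (diff a b)
      then have "tensor_mult S' (L.L (a \<ominus>\<^bsub>A.TP.TR\<^esub> b)) = h (tensor_mult S a) \<ominus>\<^bsub>S'\<^esub> h (tensor_mult S b)"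
        by (simp add: L.L_diff B.tensor_mult_diff)
      also have "\<dots> = h (tensor_mult S (a \<ominus>\<^bsub>A.TP.TR\<^esub> b))"
        using diff by (simp add: A.tensor_mult_diff)
      finally show ?case .
    }
  qed
  have "separability_element R' S' (L.L e)"
    unfolding separability_element_def
  proof (intro conjI ballI)
    show "L.L e \<in> carrier B.TP.TR" using ecl by simp
    show "tensor_mult S' (L.L e) = \<one>\<^bsub>S'\<^esub>" using mult [OF ecl] e1 by simp
    fix s' assume "s' \<in> carrier S'"
    then obtain s where s: "s \<in> carrier S" "s' = h s" using surj by auto
    have "B.TP.pt s' \<one>\<^bsub>S'\<^esub> \<otimes>\<^bsub>B.TP.TR\<^esub> L.L e = L.L (A.TP.pt s \<one>\<^bsub>S\<^esub> \<otimes>\<^bsub>A.TP.TR\<^esub> e)"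
      using s ecl by (simp add: L.L_mult L.L_pt)
    also have "\<dots> = B.TP.pt \<one>\<^bsub>S'\<^esub> s' \<otimes>\<^bsub>B.TP.TR\<^esub> L.L e"
      using s ecl by (simp add: bal L.L_mult L.L_pt)
    finally show "B.TP.pt s' \<one>\<^bsub>S'\<^esub> \<otimes>\<^bsub>B.TP.TR\<^esub> L.L e = B.TP.pt \<one>\<^bsub>S'\<^esub> s' \<otimes>\<^bsub>B.TP.TR\<^esub> L.L e" .
  qed
  then show ?thesis by (rule B.separability_element_imp_separable)
qed

section \<open>Galois extensions\<close>

lemma (in abelian_monoid) finsum_swap:
  assumes "finite A" "finite B" "\<And>a b. a \<in> A \<Longrightarrow> b \<in> B \<Longrightarrow> f a b \<in> carrier G"
  shows "(\<Oplus>a\<in>A. \<Oplus>b\<in>B. f a b) = (\<Oplus>b\<in>B. \<Oplus>a\<in>A. f a b)"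
  using assms
proof (induction A rule: finite_induct)
  case empty
  then show ?case by simp
next
  case (insert a A)
  have "(\<Oplus>b\<in>B. \<Oplus>a\<in>insert a A. f a b) = (\<Oplus>b\<in>B. f a b \<oplus> (\<Oplus>a\<in>A. f a b))"
    using insert by (intro finsum_cong') (auto intro!: finsum_insert finsum_closed a_closed)
  also have "\<dots> = (\<Oplus>b\<in>B. f a b) \<oplus> (\<Oplus>b\<in>B. \<Oplus>a\<in>A. f a b)"
    using insert by (intro finsum_addf) (auto intro!: finsum_closed)
  finally show ?case
    using insert by (simp add: finsum_insert Pi_def)
qed

locale algebra_action = comm_algebra R S + G: group G
  for R :: "('r, 'z) ring_scheme" and S :: "('r, 's, 'x) module_scheme"
    and G :: "('g, 'w) monoid_scheme" +
  fixes \<rho> :: "'g \<Rightarrow> 's \<Rightarrow> 's"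
  assumes acts: "acts_by_algebra_automorphisms G R S \<rho>"
begin

lemma act_hom: "g \<in> carrier G \<Longrightarrow> \<rho> g \<in> ring_hom S S"
  using acts by (simp add: acts_by_algebra_automorphisms_def)

lemma act_closed [simp]: "g \<in> carrier G \<Longrightarrow> s \<in> carrier S \<Longrightarrow> \<rho> g s \<in> carrier S"
  using ring_hom_closed [OF act_hom] .

lemma act_smult: "g \<in> carrier G \<Longrightarrow> r \<in> carrier R \<Longrightarrow> s \<in> carrier S \<Longrightarrow> \<rho> g (r \<odot>\<^bsub>S\<^esub> s) = r \<odot>\<^bsub>S\<^esub> \<rho> g s"
  using acts by (simp add: acts_by_algebra_automorphisms_def)

lemmas act_add = ring_hom_add [OF act_hom]
  and act_mult = ring_hom_mult [OF act_hom]
  and act_one = ring_hom_one [OF act_hom]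

lemma group_action: "group_action G (carrier S) \<rho>"
  using acts by (simp add: acts_by_algebra_automorphisms_def)

lemma act_comp: "g \<in> carrier G \<Longrightarrow> h \<in> carrier G \<Longrightarrow> s \<in> carrier S \<Longrightarrow> \<rho> (g \<otimes>\<^bsub>G\<^esub> h) s = \<rho> g (\<rho> h s)"
  by (rule group_action.composition_rule [OF group_action])

lemma act_id [simp]: "s \<in> carrier S \<Longrightarrow> \<rho> \<one>\<^bsub>G\<^esub> s = s"
  by (metis group_action group_action.id_eq_one restrict_apply')

lemma act_ring_hom_cring: "g \<in> carrier G \<Longrightarrow> ring_hom_cring S S (\<rho> g)"
  by unfold_locales (rule act_hom)

lemma act_finsum: "g \<in> carrier G \<Longrightarrow> f \<in> A \<rightarrow> carrier S
    \<Longrightarrow> \<rho> g (\<Oplus>\<^bsub>S\<^esub>i\<in>A. f i) = (\<Oplus>\<^bsub>S\<^esub>i\<in>A. \<rho> g (f i))"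
  using ring_hom_cring.hom_finsum [OF act_ring_hom_cring] by (simp add: comp_def)

lemma structure_hom: "ring_hom_cring R S (\<lambda>r. r \<odot>\<^bsub>S\<^esub> \<one>\<^bsub>S\<^esub>)"
proof -
  have "(r \<otimes>\<^bsub>R\<^esub> r') \<odot>\<^bsub>S\<^esub> \<one>\<^bsub>S\<^esub> = (r \<odot>\<^bsub>S\<^esub> \<one>\<^bsub>S\<^esub>) \<otimes>\<^bsub>S\<^esub> (r' \<odot>\<^bsub>S\<^esub> \<one>\<^bsub>S\<^esub>)"
    if "r \<in> carrier R" "r' \<in> carrier R" for r r'
    using that by (simp add: smult_mult_left Mod.smult_assoc1)
  then have "(\<lambda>r. r \<odot>\<^bsub>S\<^esub> \<one>\<^bsub>S\<^esub>) \<in> ring_hom R S"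
    by (intro ring_hom_memI) (auto simp: Mod.smult_l_distr)
  then show ?thesis by unfold_locales
qed

lemma smult_finsum_left:
  assumes "f \<in> A \<rightarrow> carrier R" "s \<in> carrier S"
  shows "(\<Oplus>\<^bsub>R\<^esub>i\<in>A. f i) \<odot>\<^bsub>S\<^esub> s = (\<Oplus>\<^bsub>S\<^esub>i\<in>A. f i \<odot>\<^bsub>S\<^esub> s)"
proof (cases "finite A")
  case True
  have *: "r \<odot>\<^bsub>S\<^esub> s = (r \<odot>\<^bsub>S\<^esub> \<one>\<^bsub>S\<^esub>) \<otimes>\<^bsub>S\<^esub> s" if "r \<in> carrier R" for r
    using that assms by (simp add: smult_mult_left)
  have "(\<Oplus>\<^bsub>R\<^esub>i\<in>A. f i) \<odot>\<^bsub>S\<^esub> s = (\<Oplus>\<^bsub>S\<^esub>i\<in>A. f i \<odot>\<^bsub>S\<^esub> \<one>\<^bsub>S\<^esub>) \<otimes>\<^bsub>S\<^esub> s"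
    using ring_hom_cring.hom_finsum [OF structure_hom assms(1)] assms
    by (subst *) (simp_all add: comp_def)
  also have "\<dots> = (\<Oplus>\<^bsub>S\<^esub>i\<in>A. (f i \<odot>\<^bsub>S\<^esub> \<one>\<^bsub>S\<^esub>) \<otimes>\<^bsub>S\<^esub> s)"
    using assms by (intro S.finsum_ldistr True) auto
  also have "\<dots> = (\<Oplus>\<^bsub>S\<^esub>i\<in>A. f i \<odot>\<^bsub>S\<^esub> s)"
    using assms by (intro S.finsum_cong') (auto simp: smult_mult_left Pi_iff)
  finally show ?thesis .
qed (use assms in simp)

definition fixed_ring where "fixed_ring = {s \<in> carrier S. \<forall>g\<in>carrier G. \<rho> g s = s}"

text \<open>
  If \<open>e = \<Sum> x\<^sub>i \<otimes> y\<^sub>i\<close> is the separability idempotent, then \<open>e\<^sub>g = \<Sum> x\<^sub>i g(y\<^sub>i)\<close> is an idempotent with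
  \<open>s e\<^sub>g = g(s) e\<^sub>g\<close>, so strong distinctness forces \<open>e\<^sub>g = 0\<close> for \<open>g \<noteq> 1\<close>.
\<close>

lemma galois_coordinates:
  assumes gal: "galois_extension G R S \<rho>"
  obtains P :: "('s \<times> 's) set" and x y where "finite P" "x \<in> P \<rightarrow> carrier S" "y \<in> P \<rightarrow> carrier S"
    "\<forall>g\<in>carrier G. (\<Oplus>\<^bsub>S\<^esub>p\<in>P. x p \<otimes>\<^bsub>S\<^esub> \<rho> g (y p)) = (if g = \<one>\<^bsub>G\<^esub> then \<one>\<^bsub>S\<^esub> else \<zero>\<^bsub>S\<^esub>)"
proof -
  have sep: "separable_algebra R S" and dist: "\<And>g h. \<lbrakk>g \<in> carrier G; h \<in> carrier G; g \<noteq> h\<rbrakk>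
      \<Longrightarrow> strongly_distinct S (\<rho> g) (\<rho> h)"
    using gal by (auto simp: galois_extension_def)
  obtain e where e: "separability_element R S e"
    using separable_imp_separability_element [OF sep] by blast
  then have ecl: "e \<in> carrier TP.TR" and e1: "tensor_mult S e = \<one>\<^bsub>S\<^esub>"
    and bal: "\<And>s. s \<in> carrier S \<Longrightarrow> TP.pt s \<one>\<^bsub>S\<^esub> \<otimes>\<^bsub>TP.TR\<^esub> e = TP.pt \<one>\<^bsub>S\<^esub> s \<otimes>\<^bsub>TP.TR\<^esub> e"
    by (auto simp: separability_element_def)
  obtain f where f: "f \<in> carrier (pair_ring S S)" "e = TP.proj f" using TP.proj_surj ecl by blast
  let ?P = "Poly_Mapping.keys f"
  \<comment> \<open>The integer coefficient of a pair in the representative \<open>f\<close> is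
    absorbed into its first entry, leaving a plain sum of products.\<close>
  let ?x = "\<lambda>p. [Poly_Mapping.lookup f p] \<cdot>\<^bsub>S\<^esub> fst p"
  have P: "fst p \<in> carrier S" "snd p \<in> carrier S" if "p \<in> ?P" for p
    using f(1) that by (auto simp: pair_ring_carrier_iff)
  show thesis
  proof (rule that [of ?P ?x snd])
    show "?x \<in> ?P \<rightarrow> carrier S" "snd \<in> ?P \<rightarrow> carrier S" using P by auto
    show "\<forall>g\<in>carrier G. (\<Oplus>\<^bsub>S\<^esub>p\<in>?P. ?x p \<otimes>\<^bsub>S\<^esub> \<rho> g (snd p)) = (if g = \<one>\<^bsub>G\<^esub> then \<one>\<^bsub>S\<^esub> else \<zero>\<^bsub>S\<^esub>)"
    proof
      fix g assume g: "g \<in> carrier G"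
      interpret L: tensor_bilinear R S S S "\<lambda>p. fst p \<otimes>\<^bsub>S\<^esub> \<rho> g (snd p)"
        by unfold_locales (use g in \<open>auto simp: act_add act_mult act_smult S.l_distr S.r_distr
            smult_mult_left smult_mult_right S.m_ac\<close>)
      have Le: "L.L e = (\<Oplus>\<^bsub>S\<^esub>p\<in>?P. ?x p \<otimes>\<^bsub>S\<^esub> \<rho> g (snd p))"
        unfolding f(2) L.L_proj [OF f(1)] frag_lift_def
        using P g by (intro S.finsum_cong') (auto simp: S.add_pow_ldistr_int)
      have "L.L e = (if g = \<one>\<^bsub>G\<^esub> then \<one>\<^bsub>S\<^esub> else \<zero>\<^bsub>S\<^esub>)"
      proof (cases "g = \<one>\<^bsub>G\<^esub>")
        case True
        have "L.L e = tensor_mult S e"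
          unfolding tensor_mult_eq_lift f(2) L.L_proj [OF f(1)] Mu.L_proj [OF f(1)] frag_lift_def
          using P by (intro S.finsum_cong') (auto simp: True)
        then show ?thesis using True e1 by simp
      next
        case False
        have idem: "L.L e \<otimes>\<^bsub>S\<^esub> L.L e = L.L e"
        proof -
          have "L.L e \<otimes>\<^bsub>S\<^esub> L.L e = L.L (e \<otimes>\<^bsub>TP.TR\<^esub> e)" using ecl by (simp add: L.L_mult)
          also have "\<dots> = L.L (TP.pt \<one>\<^bsub>S\<^esub> \<one>\<^bsub>S\<^esub> \<otimes>\<^bsub>TP.TR\<^esub> e)"
            using separability_element_mult [OF e ecl] e1 by simp
          finally show ?thesis using ecl by (simp add: TP.pt_one)
        qed
        have "\<rho> \<one>\<^bsub>G\<^esub> s \<otimes>\<^bsub>S\<^esub> L.L e = \<rho> g s \<otimes>\<^bsub>S\<^esub> L.L e" if s: "s \<in> carrier S" for s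
        proof -
          have "L.L (TP.pt s \<one>\<^bsub>S\<^esub> \<otimes>\<^bsub>TP.TR\<^esub> e) = L.L (TP.pt \<one>\<^bsub>S\<^esub> s \<otimes>\<^bsub>TP.TR\<^esub> e)"
            using bal [OF s] by simp
          then show ?thesis using s g ecl by (simp add: L.L_mult L.L_pt act_one)
        qed
        moreover have "strongly_distinct S (\<rho> \<one>\<^bsub>G\<^esub>) (\<rho> g)"
          using dist [of "\<one>\<^bsub>G\<^esub>" g] False g by simp
        ultimately have "L.L e = \<zero>\<^bsub>S\<^esub>"
          unfolding strongly_distinct_def using idem L.L_closed [OF ecl] by blast
        then show ?thesis using False by simp
      qed
      then show "(\<Oplus>\<^bsub>S\<^esub>p\<in>?P. ?x p \<otimes>\<^bsub>S\<^esub> \<rho> g (snd p)) = (if g = \<one>\<^bsub>G\<^esub> then \<one>\<^bsub>S\<^esub> else \<zero>\<^bsub>S\<^esub>)"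
        by (simp add: Le)
    qed
  qed simp
qed

section \<open>Characters, eigenspaces and twisted traces\<close>

definition eigenspace :: "('g \<Rightarrow> 'r) \<Rightarrow> 's set" where
  "eigenspace c = {s \<in> carrier S. \<forall>g\<in>carrier G. \<rho> g s = c g \<odot>\<^bsub>S\<^esub> s}"

text \<open>Membership in \<open>hom\<close> makes the value at the identity of \<open>G\<close>
  merely an idempotent of \<open>R\<close>, so unitality is asked for separately.\<close>

definition character :: "('g \<Rightarrow> 'r) \<Rightarrow> bool" where
  "character c \<longleftrightarrow> c \<in> hom G R \<and> c \<one>\<^bsub>G\<^esub> = \<one>\<^bsub>R\<^esub>"

text \<open>For a character \<open>c\<close> and invertible group order, dividing by that order
  gives the projector of \<open>S\<close> onto the \<open>c\<close>-eigenspace.\<close>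

definition twisted_trace :: "('g \<Rightarrow> 'r) \<Rightarrow> 's \<Rightarrow> 's" where
  "twisted_trace c s = (\<Oplus>\<^bsub>S\<^esub>g\<in>carrier G. c (inv\<^bsub>G\<^esub> g) \<odot>\<^bsub>S\<^esub> \<rho> g s)"

lemma characterD:
  assumes "character c"
  shows "g \<in> carrier G \<Longrightarrow> c g \<in> carrier R"
    "g \<in> carrier G \<Longrightarrow> h \<in> carrier G \<Longrightarrow> c (g \<otimes>\<^bsub>G\<^esub> h) = c g \<otimes>\<^bsub>R\<^esub> c h"
    "c \<one>\<^bsub>G\<^esub> = \<one>\<^bsub>R\<^esub>"
    "g \<in> carrier G \<Longrightarrow> c g \<otimes>\<^bsub>R\<^esub> c (inv\<^bsub>G\<^esub> g) = \<one>\<^bsub>R\<^esub>"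
proof -
  show *: "g \<in> carrier G \<Longrightarrow> h \<in> carrier G \<Longrightarrow> c (g \<otimes>\<^bsub>G\<^esub> h) = c g \<otimes>\<^bsub>R\<^esub> c h" for g h
    using assms by (auto simp: character_def hom_def)
  show **: "c \<one>\<^bsub>G\<^esub> = \<one>\<^bsub>R\<^esub>" using assms by (simp add: character_def)
  show "g \<in> carrier G \<Longrightarrow> c g \<in> carrier R" using assms by (auto simp: character_def hom_def)
  show "g \<in> carrier G \<Longrightarrow> c g \<otimes>\<^bsub>R\<^esub> c (inv\<^bsub>G\<^esub> g) = \<one>\<^bsub>R\<^esub>"
    using * [of g "inv\<^bsub>G\<^esub> g"] ** by simp
qed

lemma character_inverse:
  assumes c: "character c" and comm: "\<And>g h. g \<in> carrier G \<Longrightarrow> h \<in> carrier G \<Longrightarrow> g \<otimes>\<^bsub>G\<^esub> h = h \<otimes>\<^bsub>G\<^esub> g"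
  shows "character (\<lambda>g. c (inv\<^bsub>G\<^esub> g))"
  using characterD [OF c] by (auto simp: character_def hom_def G.inv_mult_group comm)

lemma character_one: "character (\<lambda>g. \<one>\<^bsub>R\<^esub>)"
  by (auto simp: character_def hom_def)

lemma eigenspace_one: "eigenspace (\<lambda>g. \<one>\<^bsub>R\<^esub>) = fixed_ring"
  by (auto simp: eigenspace_def fixed_ring_def)

lemma eigenspace_closed: "s \<in> eigenspace c \<Longrightarrow> s \<in> carrier S"
  by (simp add: eigenspace_def)

lemma eigenspace_mult:
  assumes "character c" "character d" "s \<in> eigenspace c" "t \<in> eigenspace d"
  shows "s \<otimes>\<^bsub>S\<^esub> t \<in> eigenspace (\<lambda>g. c g \<otimes>\<^bsub>R\<^esub> d g)"
  using assms characterD [OF assms(1)] characterD [OF assms(2)]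
  by (auto simp: eigenspace_def act_mult smult_mult_left smult_mult_right Mod.smult_assoc1 [symmetric] R.m_comm)

lemma eigenspace_mult_inverse:
  assumes c: "character c" and st: "s \<in> eigenspace c" "t \<in> eigenspace (\<lambda>g. c (inv\<^bsub>G\<^esub> g))"
  shows "s \<otimes>\<^bsub>S\<^esub> t \<in> fixed_ring"
proof -
  have "\<rho> g (s \<otimes>\<^bsub>S\<^esub> t) = (c g \<otimes>\<^bsub>R\<^esub> c (inv\<^bsub>G\<^esub> g)) \<odot>\<^bsub>S\<^esub> (s \<otimes>\<^bsub>S\<^esub> t)" if "g \<in> carrier G" for g
    using st that characterD(1) [OF c]
    by (auto simp: eigenspace_def act_mult smult_mult_left smult_mult_right Mod.smult_assoc1 [symmetric] R.m_comm)
  then show ?thesis using st characterD(4) [OF c] by (auto simp: fixed_ring_def eigenspace_def)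
qed

lemma eigenspace_smult: "character c \<Longrightarrow> r \<in> carrier R \<Longrightarrow> s \<in> eigenspace c \<Longrightarrow> r \<odot>\<^bsub>S\<^esub> s \<in> eigenspace c"
  using characterD(1) [of c]
  by (auto simp: eigenspace_def act_smult Mod.smult_assoc1 [symmetric] R.m_comm)

lemma eigenspace_submodule:
  assumes "character c" shows "submodule (eigenspace c) R S"
proof (rule Mod.submoduleI)
  show "\<zero>\<^bsub>S\<^esub> \<in> eigenspace c"
    using characterD(1) [OF assms] ring_hom_cring.hom_zero [OF act_ring_hom_cring]
    by (auto simp: eigenspace_def)
  show "\<ominus>\<^bsub>S\<^esub> a \<in> eigenspace c" if "a \<in> eigenspace c" for a
    using that characterD(1) [OF assms] ring_hom_cring.hom_a_inv [OF act_ring_hom_cring]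
    by (auto simp: eigenspace_def Mod.smult_r_minus)
  show "a \<oplus>\<^bsub>S\<^esub> b \<in> eigenspace c" if "a \<in> eigenspace c" "b \<in> eigenspace c" for a b
    using that characterD(1) [OF assms] by (auto simp: eigenspace_def act_add Mod.smult_r_distr)
qed (auto simp: eigenspace_smult assms eigenspace_closed)

lemma twisted_trace_summand:
  "character c \<Longrightarrow> s \<in> carrier S \<Longrightarrow> (\<lambda>g. c (inv\<^bsub>G\<^esub> g) \<odot>\<^bsub>S\<^esub> \<rho> g s) \<in> carrier G \<rightarrow> carrier S"
  using characterD(1) by auto

lemma twisted_trace_closed [simp]:
  "character c \<Longrightarrow> s \<in> carrier S \<Longrightarrow> twisted_trace c s \<in> carrier S"
  unfolding twisted_trace_def by (intro S.finsum_closed twisted_trace_summand)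

text \<open>Applying \<open>k\<close> turns the term of \<open>g\<close> into \<open>c(g^-1)\<close>
  times the action of \<open>kg\<close>. Since \<open>c(g^-1) = c(k) c((kg)^-1)\<close>, reindexing
  by \<open>kg\<close> leaves the factor \<open>c(k)\<close>.\<close>

lemma twisted_trace_eigen:
  assumes fin: "finite (carrier G)" and c: "character c" and s: "s \<in> carrier S"
  shows "twisted_trace c s \<in> eigenspace c"
proof -
  note c' = characterD [OF c]
  have "\<rho> k (twisted_trace c s) = c k \<odot>\<^bsub>S\<^esub> twisted_trace c s" if k: "k \<in> carrier G" for k
  proof -
    have "\<rho> k (twisted_trace c s) = (\<Oplus>\<^bsub>S\<^esub>g\<in>carrier G. c (inv\<^bsub>G\<^esub> g) \<odot>\<^bsub>S\<^esub> \<rho> (k \<otimes>\<^bsub>G\<^esub> g) s)"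
      unfolding twisted_trace_def act_finsum [OF k twisted_trace_summand [OF c s]]
      using k s c' by (intro S.finsum_cong') (auto simp: act_smult act_comp)
    also have "\<dots> = (\<Oplus>\<^bsub>S\<^esub>g\<in>carrier G. (\<lambda>g. c k \<odot>\<^bsub>S\<^esub> (c (inv\<^bsub>G\<^esub> g) \<odot>\<^bsub>S\<^esub> \<rho> g s)) (k \<otimes>\<^bsub>G\<^esub> g))"
    proof (rule S.finsum_cong')
      fix g assume g: "g \<in> carrier G"
      have "inv\<^bsub>G\<^esub> g = inv\<^bsub>G\<^esub> (k \<otimes>\<^bsub>G\<^esub> g) \<otimes>\<^bsub>G\<^esub> k"
        using g k by (simp add: G.inv_mult_group G.m_assoc)
      then have "c (inv\<^bsub>G\<^esub> g) = c k \<otimes>\<^bsub>R\<^esub> c (inv\<^bsub>G\<^esub> (k \<otimes>\<^bsub>G\<^esub> g))"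
        using g k c'(1,2) by (metis G.inv_closed G.m_closed R.m_comm)
      then show "c (inv\<^bsub>G\<^esub> g) \<odot>\<^bsub>S\<^esub> \<rho> (k \<otimes>\<^bsub>G\<^esub> g) s
          = c k \<odot>\<^bsub>S\<^esub> (c (inv\<^bsub>G\<^esub> (k \<otimes>\<^bsub>G\<^esub> g)) \<odot>\<^bsub>S\<^esub> \<rho> (k \<otimes>\<^bsub>G\<^esub> g) s)"
        using g k s c'(1) by (simp add: Mod.smult_assoc1)
    qed (use k s c' in auto)
    also have "\<dots> = (\<Oplus>\<^bsub>S\<^esub>g\<in>(\<lambda>g. k \<otimes>\<^bsub>G\<^esub> g) ` carrier G. c k \<odot>\<^bsub>S\<^esub> (c (inv\<^bsub>G\<^esub> g) \<odot>\<^bsub>S\<^esub> \<rho> g s))"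
      using k s c' by (intro S.finsum_reindex [symmetric]) (auto intro!: inj_onI)
    also have "(\<lambda>g. k \<otimes>\<^bsub>G\<^esub> g) ` carrier G = carrier G"
      by (rule G.surj_const_mult [OF k])
    also have "(\<Oplus>\<^bsub>S\<^esub>g\<in>carrier G. c k \<odot>\<^bsub>S\<^esub> (c (inv\<^bsub>G\<^esub> g) \<odot>\<^bsub>S\<^esub> \<rho> g s)) = c k \<odot>\<^bsub>S\<^esub> twisted_trace c s"
      unfolding twisted_trace_def
      using fin k c' twisted_trace_summand [OF c s] by (intro Mod.finsum_smult_ldistr [symmetric]) auto
    finally show ?thesis .
  qed
  then show ?thesis using c s by (simp add: eigenspace_def)
qed

text \<open>Let \<open>w_p\<close> be the trace of \<open>y_p\<close> for the inverse character. In
  the Galois coordinates \<open>\<Sum> x_p w_p = \<Sum>_h c(h) \<Sum>_p x_p h(y_p) = 1\<close>, as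
  only the identity contributes. Summing the images of this relation under all \<open>g\<close>
  gives the group order, which \<open>n\<close> inverts.\<close>

lemma eigen_coordinates:
  assumes gal: "galois_extension G R S \<rho>" and c: "character c"
    and comm: "\<And>g h. g \<in> carrier G \<Longrightarrow> h \<in> carrier G \<Longrightarrow> g \<otimes>\<^bsub>G\<^esub> h = h \<otimes>\<^bsub>G\<^esub> g"
    and n: "n \<in> carrier R" "n \<otimes>\<^bsub>R\<^esub> (\<Oplus>\<^bsub>R\<^esub>g\<in>carrier G. \<one>\<^bsub>R\<^esub>) = \<one>\<^bsub>R\<^esub>"
  obtains P :: "('s \<times> 's) set" and u v where "finite P" "u \<in> P \<rightarrow> eigenspace c"
    "v \<in> P \<rightarrow> eigenspace (\<lambda>g. c (inv\<^bsub>G\<^esub> g))" "(\<Oplus>\<^bsub>S\<^esub>p\<in>P. u p \<otimes>\<^bsub>S\<^esub> v p) = \<one>\<^bsub>S\<^esub>"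
proof -
  have fin: "finite (carrier G)" using gal by (simp add: galois_extension_def)
  obtain P :: "('s \<times> 's) set" and x y where P: "finite P" "x \<in> P \<rightarrow> carrier S" "y \<in> P \<rightarrow> carrier S"
    and xy: "\<forall>g\<in>carrier G. (\<Oplus>\<^bsub>S\<^esub>p\<in>P. x p \<otimes>\<^bsub>S\<^esub> \<rho> g (y p)) = (if g = \<one>\<^bsub>G\<^esub> then \<one>\<^bsub>S\<^esub> else \<zero>\<^bsub>S\<^esub>)"
    by (rule galois_coordinates [OF gal])
  define d where "d = (\<lambda>g. c (inv\<^bsub>G\<^esub> g))"
  have d: "character d" unfolding d_def by (rule character_inverse [OF c comm])
  note c' = characterD [OF c] and d' = characterD [OF d]
  define w where "w p = twisted_trace d (y p)" for p
  have w: "w p \<in> carrier S" "w p \<in> eigenspace d" if "p \<in> P" for p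
    using that P(3) d fin by (auto simp: w_def intro!: twisted_trace_eigen twisted_trace_closed)
  have x: "x p \<in> carrier S" and y: "y p \<in> carrier S" if "p \<in> P" for p
    using that P by auto
  \<comment> \<open>As \<open>w p\<close> has the inverse weight,
    \<open>c(g^-1) w p = g(w p)\<close>: the twist moves into the second factor and an untwisted
    trace of the product remains.\<close>
  have tr: "twisted_trace c (x p) \<otimes>\<^bsub>S\<^esub> w p = (\<Oplus>\<^bsub>S\<^esub>g\<in>carrier G. \<rho> g (x p \<otimes>\<^bsub>S\<^esub> w p))" if p: "p \<in> P" for p
  proof -
    have "twisted_trace c (x p) \<otimes>\<^bsub>S\<^esub> w p = (\<Oplus>\<^bsub>S\<^esub>g\<in>carrier G. (c (inv\<^bsub>G\<^esub> g) \<odot>\<^bsub>S\<^esub> \<rho> g (x p)) \<otimes>\<^bsub>S\<^esub> w p)"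
      unfolding twisted_trace_def
      by (rule S.finsum_ldistr [OF fin w(1) [OF p] twisted_trace_summand [OF c x [OF p]]])
    also have "\<dots> = (\<Oplus>\<^bsub>S\<^esub>g\<in>carrier G. \<rho> g (x p \<otimes>\<^bsub>S\<^esub> w p))"
      using w [OF p] x [OF p] c'
      by (intro S.finsum_cong') (auto simp: act_mult smult_mult_left smult_mult_right eigenspace_def d_def)
    finally show ?thesis .
  qed
  have xw: "(\<Oplus>\<^bsub>S\<^esub>p\<in>P. x p \<otimes>\<^bsub>S\<^esub> w p) = \<one>\<^bsub>S\<^esub>"
  proof -
    have "(\<Oplus>\<^bsub>S\<^esub>p\<in>P. x p \<otimes>\<^bsub>S\<^esub> w p) = (\<Oplus>\<^bsub>S\<^esub>p\<in>P. \<Oplus>\<^bsub>S\<^esub>h\<in>carrier G. c h \<odot>\<^bsub>S\<^esub> (x p \<otimes>\<^bsub>S\<^esub> \<rho> h (y p)))"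
    proof (rule S.finsum_cong')
      fix p assume p: "p \<in> P"
      have "x p \<otimes>\<^bsub>S\<^esub> w p = (\<Oplus>\<^bsub>S\<^esub>h\<in>carrier G. x p \<otimes>\<^bsub>S\<^esub> (d (inv\<^bsub>G\<^esub> h) \<odot>\<^bsub>S\<^esub> \<rho> h (y p)))"
        unfolding w_def twisted_trace_def
        by (rule S.finsum_rdistr [OF fin x [OF p] twisted_trace_summand [OF d y [OF p]]])
      also have "\<dots> = (\<Oplus>\<^bsub>S\<^esub>h\<in>carrier G. c h \<odot>\<^bsub>S\<^esub> (x p \<otimes>\<^bsub>S\<^esub> \<rho> h (y p)))"
        using x [OF p] y [OF p] c' by (intro S.finsum_cong') (auto simp: d_def smult_mult_right)
      finally show "x p \<otimes>\<^bsub>S\<^esub> w p = (\<Oplus>\<^bsub>S\<^esub>h\<in>carrier G. c h \<odot>\<^bsub>S\<^esub> (x p \<otimes>\<^bsub>S\<^esub> \<rho> h (y p)))" .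
    qed (use x y c' in \<open>auto intro!: S.finsum_closed\<close>)
    also have "\<dots> = (\<Oplus>\<^bsub>S\<^esub>h\<in>carrier G. \<Oplus>\<^bsub>S\<^esub>p\<in>P. c h \<odot>\<^bsub>S\<^esub> (x p \<otimes>\<^bsub>S\<^esub> \<rho> h (y p)))"
      using x y c' by (intro S.finsum_swap P(1) fin) auto
    also have "\<dots> = (\<Oplus>\<^bsub>S\<^esub>h\<in>carrier G. if \<one>\<^bsub>G\<^esub> = h then \<one>\<^bsub>S\<^esub> else \<zero>\<^bsub>S\<^esub>)"
    proof (rule S.finsum_cong')
      fix h assume h: "h \<in> carrier G"
      have "(\<Oplus>\<^bsub>S\<^esub>p\<in>P. c h \<odot>\<^bsub>S\<^esub> (x p \<otimes>\<^bsub>S\<^esub> \<rho> h (y p))) = c h \<odot>\<^bsub>S\<^esub> (\<Oplus>\<^bsub>S\<^esub>p\<in>P. x p \<otimes>\<^bsub>S\<^esub> \<rho> h (y p))"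
        using x y h c' by (intro Mod.finsum_smult_ldistr [symmetric] P(1)) auto
      then show "(\<Oplus>\<^bsub>S\<^esub>p\<in>P. c h \<odot>\<^bsub>S\<^esub> (x p \<otimes>\<^bsub>S\<^esub> \<rho> h (y p))) = (if \<one>\<^bsub>G\<^esub> = h then \<one>\<^bsub>S\<^esub> else \<zero>\<^bsub>S\<^esub>)"
        using bspec [OF xy h] h c' by auto
    qed auto
    also have "\<dots> = \<one>\<^bsub>S\<^esub>"
      by (rule S.finsum_singleton [OF _ fin]) auto
    finally show ?thesis .
  qed
  have "(\<Oplus>\<^bsub>S\<^esub>p\<in>P. twisted_trace c (x p) \<otimes>\<^bsub>S\<^esub> w p) = (\<Oplus>\<^bsub>S\<^esub>p\<in>P. \<Oplus>\<^bsub>S\<^esub>g\<in>carrier G. \<rho> g (x p \<otimes>\<^bsub>S\<^esub> w p))"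
    using x w tr by (intro S.finsum_cong') (auto intro!: S.finsum_closed)
  also have "\<dots> = (\<Oplus>\<^bsub>S\<^esub>g\<in>carrier G. \<Oplus>\<^bsub>S\<^esub>p\<in>P. \<rho> g (x p \<otimes>\<^bsub>S\<^esub> w p))"
    using x w by (intro S.finsum_swap P(1) fin) auto
  also have "\<dots> = (\<Oplus>\<^bsub>S\<^esub>g\<in>carrier G. \<one>\<^bsub>R\<^esub> \<odot>\<^bsub>S\<^esub> \<one>\<^bsub>S\<^esub>)"
  proof (rule S.finsum_cong')
    fix g assume g: "g \<in> carrier G"
    have "(\<Oplus>\<^bsub>S\<^esub>p\<in>P. \<rho> g (x p \<otimes>\<^bsub>S\<^esub> w p)) = \<rho> g (\<Oplus>\<^bsub>S\<^esub>p\<in>P. x p \<otimes>\<^bsub>S\<^esub> w p)"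
      using x w by (intro act_finsum [OF g, symmetric]) auto
    then show "(\<Oplus>\<^bsub>S\<^esub>p\<in>P. \<rho> g (x p \<otimes>\<^bsub>S\<^esub> w p)) = \<one>\<^bsub>R\<^esub> \<odot>\<^bsub>S\<^esub> \<one>\<^bsub>S\<^esub>"
      using xw g by (simp add: act_one)
  qed auto
  also have "\<dots> = (\<Oplus>\<^bsub>R\<^esub>g\<in>carrier G. \<one>\<^bsub>R\<^esub>) \<odot>\<^bsub>S\<^esub> \<one>\<^bsub>S\<^esub>"
    by (rule smult_finsum_left [symmetric]) auto
  finally have sum: "(\<Oplus>\<^bsub>S\<^esub>p\<in>P. twisted_trace c (x p) \<otimes>\<^bsub>S\<^esub> w p) = (\<Oplus>\<^bsub>R\<^esub>g\<in>carrier G. \<one>\<^bsub>R\<^esub>) \<odot>\<^bsub>S\<^esub> \<one>\<^bsub>S\<^esub>" .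
  show thesis
  proof (rule that [of P "\<lambda>p. twisted_trace c (x p)" "\<lambda>p. n \<odot>\<^bsub>S\<^esub> w p"])
    show "(\<lambda>p. twisted_trace c (x p)) \<in> P \<rightarrow> eigenspace c"
      using x c fin by (auto intro: twisted_trace_eigen)
    show "(\<lambda>p. n \<odot>\<^bsub>S\<^esub> w p) \<in> P \<rightarrow> eigenspace (\<lambda>g. c (inv\<^bsub>G\<^esub> g))"
      using w(2) eigenspace_smult [OF d n(1)] by (auto simp: d_def)
    have "(\<Oplus>\<^bsub>S\<^esub>p\<in>P. twisted_trace c (x p) \<otimes>\<^bsub>S\<^esub> (n \<odot>\<^bsub>S\<^esub> w p))
        = (\<Oplus>\<^bsub>S\<^esub>p\<in>P. n \<odot>\<^bsub>S\<^esub> (twisted_trace c (x p) \<otimes>\<^bsub>S\<^esub> w p))"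
      using x w c n by (intro S.finsum_cong') (auto simp: smult_mult_right)
    also have "\<dots> = n \<odot>\<^bsub>S\<^esub> (\<Oplus>\<^bsub>S\<^esub>p\<in>P. twisted_trace c (x p) \<otimes>\<^bsub>S\<^esub> w p)"
      using x w c n by (intro Mod.finsum_smult_ldistr [symmetric] P(1)) auto
    also have "\<dots> = \<one>\<^bsub>S\<^esub>"
      unfolding sum using n by (simp add: Mod.smult_assoc1 [symmetric])
    finally show "(\<Oplus>\<^bsub>S\<^esub>p\<in>P. twisted_trace c (x p) \<otimes>\<^bsub>S\<^esub> (n \<odot>\<^bsub>S\<^esub> w p)) = \<one>\<^bsub>S\<^esub>" .
  qed (rule P(1))
qed

lemma fixed_ring_eq_base:
  assumes proj: "projective_module R S" and fin: "finite (carrier G)"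
    and n: "n \<in> carrier R" "n \<otimes>\<^bsub>R\<^esub> (\<Oplus>\<^bsub>R\<^esub>g\<in>carrier G. \<one>\<^bsub>R\<^esub>) = \<one>\<^bsub>R\<^esub>"
    and lin: "\<And>t f. \<lbrakk>t \<in> fixed_ring; f \<in> linear_functionals R S\<rbrakk>
      \<Longrightarrow> f t \<odot>\<^bsub>S\<^esub> \<one>\<^bsub>S\<^esub> = f \<one>\<^bsub>S\<^esub> \<odot>\<^bsub>S\<^esub> t"
    and t: "t \<in> fixed_ring"
  shows "t \<in> (\<lambda>r. r \<odot>\<^bsub>S\<^esub> \<one>\<^bsub>S\<^esub>) ` carrier R"
proof -
  obtain J :: "'s set" and \<phi> a where J: "finite J" "\<phi> \<in> J \<rightarrow> linear_functionals R S" "a \<in> J \<rightarrow> carrier S"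
    and one: "\<one>\<^bsub>S\<^esub> = (\<Oplus>\<^bsub>S\<^esub>j\<in>J. \<phi> j \<one>\<^bsub>S\<^esub> \<odot>\<^bsub>S\<^esub> a j)"
    by (rule projective_module_dual_basis [OF proj S.one_closed])
  note \<phi> = linear_functionalsD [OF funcset_mem [OF J(2)]]
  note a = funcset_mem [OF J(3)]
  let ?c = "\<lambda>g. \<one>\<^bsub>R\<^esub>"
  \<comment> \<open>Averaging over \<open>G\<close> makes the vectors fixed. The coefficients in the
    expansion of \<open>1\<close> are scalars and pass through the average, so the expansion stays
    valid with \<open>b\<close> in place of \<open>a\<close>.\<close>
  define b where "b j = n \<odot>\<^bsub>S\<^esub> twisted_trace ?c (a j)" for j
  have tcl: "t \<in> carrier S" using t by (simp add: fixed_ring_def)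
  have b: "b j \<in> fixed_ring" "b j \<in> carrier S" if "j \<in> J" for j
    using eigenspace_smult [OF character_one n(1) twisted_trace_eigen [OF fin character_one a [OF that]]]
    unfolding b_def eigenspace_one by (auto simp: fixed_ring_def)
  \<comment> \<open>It is to these products, rather than to \<open>t\<close> alone, that
    \<open>lin\<close> is applied at the end.\<close>
  have bt: "b j \<otimes>\<^bsub>S\<^esub> t \<in> fixed_ring" if "j \<in> J" for j
    using b [OF that] t by (auto simp: fixed_ring_def act_mult)
  have "\<one>\<^bsub>S\<^esub> = n \<odot>\<^bsub>S\<^esub> (\<Oplus>\<^bsub>S\<^esub>g\<in>carrier G. \<one>\<^bsub>R\<^esub> \<odot>\<^bsub>S\<^esub> \<one>\<^bsub>S\<^esub>)"
    using n by (subst smult_finsum_left [symmetric]) (auto simp: Mod.smult_assoc1 [symmetric])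
  also have "\<dots> = n \<odot>\<^bsub>S\<^esub> twisted_trace ?c \<one>\<^bsub>S\<^esub>"
    unfolding twisted_trace_def by (rule arg_cong [where f = "\<lambda>x. n \<odot>\<^bsub>S\<^esub> x"], rule S.finsum_cong') (auto simp: act_one)
  also have "twisted_trace ?c \<one>\<^bsub>S\<^esub> = (\<Oplus>\<^bsub>S\<^esub>j\<in>J. \<phi> j \<one>\<^bsub>S\<^esub> \<odot>\<^bsub>S\<^esub> twisted_trace ?c (a j))"
  proof -
    have "twisted_trace ?c \<one>\<^bsub>S\<^esub> = (\<Oplus>\<^bsub>S\<^esub>g\<in>carrier G. \<Oplus>\<^bsub>S\<^esub>j\<in>J. \<phi> j \<one>\<^bsub>S\<^esub> \<odot>\<^bsub>S\<^esub> \<rho> g (a j))"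
      unfolding twisted_trace_def
    proof (rule S.finsum_cong')
      fix g assume g: "g \<in> carrier G"
      have "\<rho> g (\<Oplus>\<^bsub>S\<^esub>j\<in>J. \<phi> j \<one>\<^bsub>S\<^esub> \<odot>\<^bsub>S\<^esub> a j) = (\<Oplus>\<^bsub>S\<^esub>j\<in>J. \<rho> g (\<phi> j \<one>\<^bsub>S\<^esub> \<odot>\<^bsub>S\<^esub> a j))"
        using \<phi>(1) a by (intro act_finsum g) auto
      also have "\<dots> = (\<Oplus>\<^bsub>S\<^esub>j\<in>J. \<phi> j \<one>\<^bsub>S\<^esub> \<odot>\<^bsub>S\<^esub> \<rho> g (a j))"
        using \<phi>(1) a g by (intro S.finsum_cong') (auto simp: act_smult)
      finally have "\<rho> g \<one>\<^bsub>S\<^esub> = (\<Oplus>\<^bsub>S\<^esub>j\<in>J. \<phi> j \<one>\<^bsub>S\<^esub> \<odot>\<^bsub>S\<^esub> \<rho> g (a j))" using one by simp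
      then show "\<one>\<^bsub>R\<^esub> \<odot>\<^bsub>S\<^esub> \<rho> g \<one>\<^bsub>S\<^esub> = (\<Oplus>\<^bsub>S\<^esub>j\<in>J. \<phi> j \<one>\<^bsub>S\<^esub> \<odot>\<^bsub>S\<^esub> \<rho> g (a j))"
        using g Mod.smult_one [OF act_closed [OF g S.one_closed]] by simp
    qed (use \<phi>(1) a in \<open>auto intro!: S.finsum_closed\<close>)
    also have "\<dots> = (\<Oplus>\<^bsub>S\<^esub>j\<in>J. \<Oplus>\<^bsub>S\<^esub>g\<in>carrier G. \<phi> j \<one>\<^bsub>S\<^esub> \<odot>\<^bsub>S\<^esub> \<rho> g (a j))"
      using \<phi>(1) a by (intro S.finsum_swap J(1) fin) auto
    also have "\<dots> = (\<Oplus>\<^bsub>S\<^esub>j\<in>J. \<phi> j \<one>\<^bsub>S\<^esub> \<odot>\<^bsub>S\<^esub> twisted_trace ?c (a j))"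
    proof (rule S.finsum_cong')
      fix j assume j: "j \<in> J"
      have "(\<Oplus>\<^bsub>S\<^esub>g\<in>carrier G. \<phi> j \<one>\<^bsub>S\<^esub> \<odot>\<^bsub>S\<^esub> \<rho> g (a j)) = (\<Oplus>\<^bsub>S\<^esub>g\<in>carrier G. \<phi> j \<one>\<^bsub>S\<^esub> \<odot>\<^bsub>S\<^esub> (\<one>\<^bsub>R\<^esub> \<odot>\<^bsub>S\<^esub> \<rho> g (a j)))"
        using \<phi>(1) a j by (intro S.finsum_cong') auto
      also have "\<dots> = \<phi> j \<one>\<^bsub>S\<^esub> \<odot>\<^bsub>S\<^esub> twisted_trace ?c (a j)"
        unfolding twisted_trace_def
        using \<phi>(1) a j by (intro Mod.finsum_smult_ldistr [symmetric] fin) auto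
      finally show "(\<Oplus>\<^bsub>S\<^esub>g\<in>carrier G. \<phi> j \<one>\<^bsub>S\<^esub> \<odot>\<^bsub>S\<^esub> \<rho> g (a j)) = \<phi> j \<one>\<^bsub>S\<^esub> \<odot>\<^bsub>S\<^esub> twisted_trace ?c (a j)" .
    qed (use \<phi>(1) a character_one in auto)
    finally show ?thesis .
  qed
  also have "n \<odot>\<^bsub>S\<^esub> \<dots> = (\<Oplus>\<^bsub>S\<^esub>j\<in>J. n \<odot>\<^bsub>S\<^esub> (\<phi> j \<one>\<^bsub>S\<^esub> \<odot>\<^bsub>S\<^esub> twisted_trace ?c (a j)))"
    using \<phi>(1) a n character_one by (intro Mod.finsum_smult_ldistr J(1)) auto
  also have "\<dots> = (\<Oplus>\<^bsub>S\<^esub>j\<in>J. \<phi> j \<one>\<^bsub>S\<^esub> \<odot>\<^bsub>S\<^esub> b j)"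
    using \<phi>(1) a n character_one
    by (intro S.finsum_cong') (auto simp: b_def Mod.smult_assoc1 [symmetric] R.m_comm)
  finally have one': "\<one>\<^bsub>S\<^esub> = (\<Oplus>\<^bsub>S\<^esub>j\<in>J. \<phi> j \<one>\<^bsub>S\<^esub> \<odot>\<^bsub>S\<^esub> b j)" .
  have "t = (\<Oplus>\<^bsub>S\<^esub>j\<in>J. \<phi> j \<one>\<^bsub>S\<^esub> \<odot>\<^bsub>S\<^esub> b j) \<otimes>\<^bsub>S\<^esub> t"
    using tcl one' by simp
  also have "\<dots> = (\<Oplus>\<^bsub>S\<^esub>j\<in>J. (\<phi> j \<one>\<^bsub>S\<^esub> \<odot>\<^bsub>S\<^esub> b j) \<otimes>\<^bsub>S\<^esub> t)"
    using \<phi>(1) b tcl by (intro S.finsum_ldistr J(1)) auto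
  also have "\<dots> = (\<Oplus>\<^bsub>S\<^esub>j\<in>J. \<phi> j (b j \<otimes>\<^bsub>S\<^esub> t) \<odot>\<^bsub>S\<^esub> \<one>\<^bsub>S\<^esub>)"
    using \<phi>(1) b tcl lin [OF bt] J(2) by (intro S.finsum_cong') (auto simp: smult_mult_left Pi_iff)
  also have "\<dots> = (\<Oplus>\<^bsub>R\<^esub>j\<in>J. \<phi> j (b j \<otimes>\<^bsub>S\<^esub> t)) \<odot>\<^bsub>S\<^esub> \<one>\<^bsub>S\<^esub>"
    using \<phi>(1) b tcl by (intro smult_finsum_left [symmetric]) auto
  finally show ?thesis using \<phi>(1) b tcl by (intro image_eqI) (auto intro!: R.finsum_closed)
qed

end

section \<open>Base change along a direct factor\<close>

text \<open>The section \<open>\<iota>\<close> preserves sums and products but need not preserve the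
  unit: \<open>\<iota> 1\<close> is the idempotent that cuts \<open>K\<close> out of
  \<open>R\<close>, and the last axiom makes \<open>\<iota> \<circ> \<pi>\<close> multiplication by
  it.\<close>

locale direct_factor = R: cring R + K: cring K
  for R :: "('r, 'z) ring_scheme" and K :: "('t, 'y) ring_scheme" +
  fixes \<pi> :: "'r \<Rightarrow> 't" and \<iota> :: "'t \<Rightarrow> 'r"
  assumes \<pi>_hom: "\<pi> \<in> ring_hom R K"
    and \<iota>_closed [simp]: "k \<in> carrier K \<Longrightarrow> \<iota> k \<in> carrier R"
    and \<iota>_add: "k \<in> carrier K \<Longrightarrow> l \<in> carrier K \<Longrightarrow> \<iota> (k \<oplus>\<^bsub>K\<^esub> l) = \<iota> k \<oplus>\<^bsub>R\<^esub> \<iota> l"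
    and \<iota>_mult: "k \<in> carrier K \<Longrightarrow> l \<in> carrier K \<Longrightarrow> \<iota> (k \<otimes>\<^bsub>K\<^esub> l) = \<iota> k \<otimes>\<^bsub>R\<^esub> \<iota> l"
    and \<pi>_\<iota> [simp]: "k \<in> carrier K \<Longrightarrow> \<pi> (\<iota> k) = k"
    and \<iota>_\<pi>: "r \<in> carrier R \<Longrightarrow> \<iota> (\<pi> r) = \<iota> \<one>\<^bsub>K\<^esub> \<otimes>\<^bsub>R\<^esub> r"
begin

sublocale \<pi>: ring_hom_cring R K \<pi> by unfold_locales (rule \<pi>_hom)

abbreviation \<epsilon> where "\<epsilon> \<equiv> \<iota> \<one>\<^bsub>K\<^esub>"

lemma \<epsilon>_idem: "\<epsilon> \<otimes>\<^bsub>R\<^esub> \<epsilon> = \<epsilon>"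
  using \<iota>_mult [of "\<one>\<^bsub>K\<^esub>" "\<one>\<^bsub>K\<^esub>"] by simp

lemma \<epsilon>_\<iota>: "k \<in> carrier K \<Longrightarrow> \<epsilon> \<otimes>\<^bsub>R\<^esub> \<iota> k = \<iota> k"
  using \<iota>_mult [of "\<one>\<^bsub>K\<^esub>" k] by simp

end

locale factor_algebra = direct_factor R K \<pi> \<iota> + comm_algebra R S
  for R :: "('r, 'z) ring_scheme" and S :: "('r, 's, 'x) module_scheme"
    and K :: "('t, 'y) ring_scheme" and \<pi> \<iota>
begin

abbreviation KA where "KA \<equiv> algebra_via K \<pi>"

sublocale BC: tensor_product R S KA
  by (rule tensor_product.intro [OF alg algebra_via_algebra [OF R.cring_axioms K.cring_axioms \<pi>_hom]])

abbreviation B where "B \<equiv> base_change R S KA"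

definition \<phi> where "\<phi> s = BC.pt s \<one>\<^bsub>K\<^esub>"

lemma right_hom: "(\<lambda>k. BC.pt \<one>\<^bsub>S\<^esub> k) \<in> ring_hom K BC.TR"
proof (rule ring_hom_memI)
  show "BC.pt \<one>\<^bsub>S\<^esub> (x \<oplus>\<^bsub>K\<^esub> y) = BC.pt \<one>\<^bsub>S\<^esub> x \<oplus>\<^bsub>BC.TR\<^esub> BC.pt \<one>\<^bsub>S\<^esub> y"
    if "x \<in> carrier K" "y \<in> carrier K" for x y
    using BC.pt_add_right [of "\<one>\<^bsub>S\<^esub>" x y] that by simp
  show "BC.pt \<one>\<^bsub>S\<^esub> (x \<otimes>\<^bsub>K\<^esub> y) = BC.pt \<one>\<^bsub>S\<^esub> x \<otimes>\<^bsub>BC.TR\<^esub> BC.pt \<one>\<^bsub>S\<^esub> y"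
    if "x \<in> carrier K" "y \<in> carrier K" for x y
    using BC.pt_mult [of "\<one>\<^bsub>S\<^esub>" x "\<one>\<^bsub>S\<^esub>" y] that by simp
  show "BC.pt \<one>\<^bsub>S\<^esub> \<one>\<^bsub>K\<^esub> = \<one>\<^bsub>BC.TR\<^esub>" using BC.pt_one by simp
qed simp

lemma base_change_algebra: "algebra K B"
  unfolding base_change_def
  by (rule algebra_via_algebra [OF K.cring_axioms BC.TR.cring_axioms right_hom])

sublocale B: comm_algebra K B by (rule comm_algebra.intro [OF base_change_algebra])

lemma B_simps [simp]:
  "carrier B = carrier BC.TR" "monoid.mult B = monoid.mult BC.TR"
  "\<one>\<^bsub>B\<^esub> = \<one>\<^bsub>BC.TR\<^esub>" "\<zero>\<^bsub>B\<^esub> = \<zero>\<^bsub>BC.TR\<^esub>" "ring.add B = ring.add BC.TR"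
  "k \<odot>\<^bsub>B\<^esub> s = BC.pt \<one>\<^bsub>S\<^esub> k \<otimes>\<^bsub>BC.TR\<^esub> s"
  by (simp_all add: base_change_def)

lemma \<phi>_hom: "\<phi> \<in> ring_hom S B"
proof (rule ring_hom_memI)
  show "\<phi> (x \<oplus>\<^bsub>S\<^esub> y) = \<phi> x \<oplus>\<^bsub>B\<^esub> \<phi> y" if "x \<in> carrier S" "y \<in> carrier S" for x y
    using BC.pt_add_left [of x y "\<one>\<^bsub>K\<^esub>"] that by (simp add: \<phi>_def)
  show "\<phi> (x \<otimes>\<^bsub>S\<^esub> y) = \<phi> x \<otimes>\<^bsub>B\<^esub> \<phi> y" if "x \<in> carrier S" "y \<in> carrier S" for x y
    using BC.pt_mult [of x "\<one>\<^bsub>K\<^esub>" y "\<one>\<^bsub>K\<^esub>"] that by (simp add: \<phi>_def)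
  show "\<phi> \<one>\<^bsub>S\<^esub> = \<one>\<^bsub>B\<^esub>" using BC.pt_one by (simp add: \<phi>_def)
qed (simp add: \<phi>_def)

sublocale \<phi>: ring_hom_cring S B \<phi>
  by unfold_locales (rule \<phi>_hom)

text \<open>Since \<open>k = \<pi> (\<iota> k)\<close>, the second entry moves across the tensor
  sign. This is what makes \<open>\<phi>\<close> surjective.\<close>

lemma pt_eq_\<phi>: "s \<in> carrier S \<Longrightarrow> k \<in> carrier K \<Longrightarrow> BC.pt s k = \<phi> (\<iota> k \<odot>\<^bsub>S\<^esub> s)"
  using BC.pt_smult [of "\<iota> k" s "\<one>\<^bsub>K\<^esub>"] by (simp add: \<phi>_def)

lemma \<phi>_smult: "r \<in> carrier R \<Longrightarrow> s \<in> carrier S \<Longrightarrow> \<phi> (r \<odot>\<^bsub>S\<^esub> s) = \<pi> r \<odot>\<^bsub>B\<^esub> \<phi> s"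
  using BC.pt_smult [of r s "\<one>\<^bsub>K\<^esub>"] BC.pt_mult [of "\<one>\<^bsub>S\<^esub>" "\<pi> r" s "\<one>\<^bsub>K\<^esub>"] by (simp add: \<phi>_def)

lemma \<phi>_surj: "\<phi> ` carrier S = carrier B"
proof
  show "carrier B \<subseteq> \<phi> ` carrier S"
  proof
    fix c assume "c \<in> carrier B"
    then have "c \<in> carrier BC.TR" by simp
    then show "c \<in> \<phi> ` carrier S"
    proof (induction rule: BC.tensor_induct)
      case zero
      show ?case using \<phi>.hom_zero by (metis B_simps(4) S.zero_closed image_eqI)
    next
      case (pure s k)
      then show ?case by (simp add: pt_eq_\<phi>)
    next
      case (diff a b)
      then obtain s t where st: "s \<in> carrier S" "t \<in> carrier S" "a = \<phi> s" "b = \<phi> t" by auto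
      \<comment> \<open>Additive inverses are unique for a given addition and zero, and the two
        records share both.\<close>
      have "a \<ominus>\<^bsub>BC.TR\<^esub> b = a \<ominus>\<^bsub>B\<^esub> b"
        using diff B.S.minus_equality [of "\<ominus>\<^bsub>BC.TR\<^esub> b" b] by (simp add: a_minus_def BC.TR.l_neg)
      also have "\<dots> = \<phi> (s \<ominus>\<^bsub>S\<^esub> t)"
        using st \<phi>.hom_a_inv [of t] \<phi>.hom_add [of s "\<ominus>\<^bsub>S\<^esub> t"] by (simp add: a_minus_def)
      finally show ?case using st(1,2) S.minus_closed by blast
    qed
  qed
qed (use \<phi>.hom_closed in blast)

lemma \<phi>_\<epsilon>: "s \<in> carrier S \<Longrightarrow> \<phi> (\<epsilon> \<odot>\<^bsub>S\<^esub> s) = \<phi> s"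
  using pt_eq_\<phi> [of s "\<one>\<^bsub>K\<^esub>"] by (simp add: \<phi>_def)

text \<open>The retraction \<open>s \<otimes> k \<mapsto> \<iota>(k) s\<close> identifies the base change with \<open>\<epsilon> S\<close>.\<close>

lemma \<phi>_eq_iff:
  assumes "s \<in> carrier S" "t \<in> carrier S"
  shows "\<phi> s = \<phi> t \<longleftrightarrow> \<epsilon> \<odot>\<^bsub>S\<^esub> s = \<epsilon> \<odot>\<^bsub>S\<^esub> t"
proof
  interpret L: tensor_bilinear R S KA S "\<lambda>p. \<iota> (snd p) \<odot>\<^bsub>S\<^esub> fst p"
  proof unfold_locales
    fix r s k assume rsk: "r \<in> carrier R" "s \<in> carrier S" "k \<in> carrier KA"
    have "\<iota> (\<pi> r \<otimes>\<^bsub>K\<^esub> k) = \<iota> k \<otimes>\<^bsub>R\<^esub> r"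
    proof -
      have "\<iota> (\<pi> r \<otimes>\<^bsub>K\<^esub> k) = (r \<otimes>\<^bsub>R\<^esub> \<epsilon>) \<otimes>\<^bsub>R\<^esub> \<iota> k"
        using rsk \<iota>_mult [of "\<pi> r" k] \<iota>_\<pi> [of r] by (simp add: R.m_comm [of r])
      also have "\<dots> = r \<otimes>\<^bsub>R\<^esub> (\<epsilon> \<otimes>\<^bsub>R\<^esub> \<iota> k)"
        using rsk by (intro R.m_assoc) auto
      finally show ?thesis using rsk by (simp add: \<epsilon>_\<iota> R.m_comm [of r "\<iota> k"])
    qed
    then show "\<iota> (snd (r \<odot>\<^bsub>S\<^esub> s, k)) \<odot>\<^bsub>S\<^esub> fst (r \<odot>\<^bsub>S\<^esub> s, k) = \<iota> (snd (s, r \<odot>\<^bsub>KA\<^esub> k)) \<odot>\<^bsub>S\<^esub> fst (s, r \<odot>\<^bsub>KA\<^esub> k)"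
      using rsk by (simp add: Mod.smult_assoc1 [symmetric])
  next
    fix s s' k k' assume *: "s \<in> carrier S" "s' \<in> carrier S" "k \<in> carrier KA" "k' \<in> carrier KA"
    then show "\<iota> (snd (s \<otimes>\<^bsub>S\<^esub> s', k \<otimes>\<^bsub>KA\<^esub> k')) \<odot>\<^bsub>S\<^esub> fst (s \<otimes>\<^bsub>S\<^esub> s', k \<otimes>\<^bsub>KA\<^esub> k')
        = \<iota> (snd (s, k)) \<odot>\<^bsub>S\<^esub> fst (s, k) \<otimes>\<^bsub>S\<^esub> (\<iota> (snd (s', k')) \<odot>\<^bsub>S\<^esub> fst (s', k'))"
      by (simp add: \<iota>_mult smult_mult_left smult_mult_right Mod.smult_assoc1 [symmetric] R.m_comm)
  qed (auto simp: \<iota>_add Mod.smult_l_distr Mod.smult_r_distr)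
  have L: "L.L (\<phi> s) = \<epsilon> \<odot>\<^bsub>S\<^esub> s" if "s \<in> carrier S" for s
    using that by (simp add: \<phi>_def L.L_pt)
  show "\<phi> s = \<phi> t \<Longrightarrow> \<epsilon> \<odot>\<^bsub>S\<^esub> s = \<epsilon> \<odot>\<^bsub>S\<^esub> t" using L [OF assms(1)] L [OF assms(2)] by simp
  show "\<epsilon> \<odot>\<^bsub>S\<^esub> s = \<epsilon> \<odot>\<^bsub>S\<^esub> t \<Longrightarrow> \<phi> s = \<phi> t" using \<phi>_\<epsilon> [OF assms(1)] \<phi>_\<epsilon> [OF assms(2)] by simp
qed

lemma separable_base_change: "separable_algebra R S \<Longrightarrow> separable_algebra K B"
  by (rule separable_algebra_surj [OF _ base_change_algebra \<phi>_hom \<phi>_surj, of _ \<pi>])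
    (use \<pi>.hom_closed \<phi>_smult in blast)+

end

section \<open>The group action on a base change\<close>

locale factor_action = factor_algebra R S K \<pi> \<iota> + algebra_action R S G \<rho>
  for R :: "('r, 'z) ring_scheme" and S :: "('r, 's, 'x) module_scheme"
    and K :: "('t, 'y) ring_scheme" and \<pi> \<iota> and G :: "('g, 'w) monoid_scheme" and \<rho>
begin

abbreviation \<sigma> where "\<sigma> \<equiv> \<lambda>g. tensor_map_left R S KA (\<rho> g)"

lemma \<sigma>_\<phi>:
  assumes g: "g \<in> carrier G" and s: "s \<in> carrier S"
  shows "\<sigma> g (\<phi> s) = \<phi> (\<rho> g s)"
proof -
  interpret L: tensor_bilinear R S KA BC.TR "\<lambda>p. BC.pt (\<rho> g (fst p)) (snd p)"
    by (rule BC.tensor_map_left_bilinear [OF act_hom [OF g] act_smult [OF g]])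
  have "\<sigma> g (\<phi> s) = L.L (\<phi> s)"
    by (rule BC.tensor_map_left_eq [OF act_hom [OF g] act_smult [OF g]]) (use s in \<open>simp_all add: \<phi>_def\<close>)
  also have "\<dots> = \<phi> (\<rho> g s)" using s g by (simp add: \<phi>_def L.L_pt)
  finally show ?thesis .
qed

lemma \<phi>_cases: "c \<in> carrier B \<Longrightarrow> \<exists>s\<in>carrier S. c = \<phi> s"
  using \<phi>_surj by blast

lemma \<sigma>_closed: "g \<in> carrier G \<Longrightarrow> c \<in> carrier B \<Longrightarrow> \<sigma> g c \<in> carrier B"
  using \<phi>_cases [of c] \<sigma>_\<phi> \<phi>.hom_closed act_closed by metis

lemma \<sigma>_comp: "g \<in> carrier G \<Longrightarrow> h \<in> carrier G \<Longrightarrow> c \<in> carrier B \<Longrightarrow> \<sigma> (g \<otimes>\<^bsub>G\<^esub> h) c = \<sigma> g (\<sigma> h c)"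
  using \<phi>_cases [of c] \<sigma>_\<phi> act_comp act_closed G.m_closed by metis

lemma \<sigma>_id: "c \<in> carrier B \<Longrightarrow> \<sigma> \<one>\<^bsub>G\<^esub> c = c"
  using \<phi>_cases [of c] \<sigma>_\<phi> act_id G.one_closed by metis

text \<open>\<open>Bij\<close> asks for functions that are \<open>undefined\<close> off the carrier,
  which the restriction built into \<open>tensor_map_left\<close> supplies. The inverse is the
  action of the inverse group element.\<close>

lemma \<sigma>_Bij: assumes g: "g \<in> carrier G" shows "\<sigma> g \<in> Bij (carrier B)"
proof -
  have "\<sigma> g \<in> extensional (carrier B)" by (simp add: tensor_map_left_def)
  moreover have "bij_betw (\<sigma> g) (carrier B) (carrier B)"
  proof (rule bij_betw_byWitness [where f' = "\<sigma> (inv\<^bsub>G\<^esub> g)"])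
    show "\<forall>a\<in>carrier B. \<sigma> (inv\<^bsub>G\<^esub> g) (\<sigma> g a) = a" "\<forall>a\<in>carrier B. \<sigma> g (\<sigma> (inv\<^bsub>G\<^esub> g) a) = a"
      using g \<sigma>_comp [of "inv\<^bsub>G\<^esub> g" g] \<sigma>_comp [of g "inv\<^bsub>G\<^esub> g"] \<sigma>_id by (simp_all del: B_simps)
  qed (use g \<sigma>_closed in auto)
  ultimately show ?thesis by (simp add: Bij_def)
qed

lemma base_change_acts: "acts_by_algebra_automorphisms G K B \<sigma>"
  unfolding acts_by_algebra_automorphisms_def
proof (intro conjI ballI)
  show "group_action G (carrier B) \<sigma>"
  proof (intro group_action.intro group_hom.intro group_hom_axioms.intro homI)
    show "\<sigma> (g \<otimes>\<^bsub>G\<^esub> h) = \<sigma> g \<otimes>\<^bsub>BijGroup (carrier B)\<^esub> \<sigma> h" if gh: "g \<in> carrier G" "h \<in> carrier G" for g h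
    proof -
      have "\<sigma> (g \<otimes>\<^bsub>G\<^esub> h) = compose (carrier B) (\<sigma> g) (\<sigma> h)"
      proof
        fix c
        show "\<sigma> (g \<otimes>\<^bsub>G\<^esub> h) c = compose (carrier B) (\<sigma> g) (\<sigma> h) c"
          using \<sigma>_comp [OF gh, of c] by (simp add: compose_def tensor_map_left_def)
      qed
      then show ?thesis using \<sigma>_Bij gh by (simp add: BijGroup_def del: B_simps)
    qed
  qed (use \<sigma>_Bij in \<open>auto simp: BijGroup_def group_BijGroup G.group_axioms simp del: B_simps intro: group_BijGroup [unfolded BijGroup_def]\<close>)
  fix g assume g: "g \<in> carrier G"
  show "\<sigma> g \<in> ring_hom B B"
  proof (rule ring_hom_memI)
    fix c d assume "c \<in> carrier B" "d \<in> carrier B"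
    then obtain s t where st: "s \<in> carrier S" "t \<in> carrier S" "c = \<phi> s" "d = \<phi> t"
      using \<phi>_cases by metis
    show "\<sigma> g (c \<otimes>\<^bsub>B\<^esub> d) = \<sigma> g c \<otimes>\<^bsub>B\<^esub> \<sigma> g d"
      using st g by (simp add: \<sigma>_\<phi> act_mult \<phi>.hom_mult [symmetric] del: \<phi>.hom_mult B_simps)
    show "\<sigma> g (c \<oplus>\<^bsub>B\<^esub> d) = \<sigma> g c \<oplus>\<^bsub>B\<^esub> \<sigma> g d"
      using st g by (simp add: \<sigma>_\<phi> act_add \<phi>.hom_add [symmetric] del: \<phi>.hom_add B_simps)
  next
    show "\<sigma> g \<one>\<^bsub>B\<^esub> = \<one>\<^bsub>B\<^esub>"
      using \<sigma>_\<phi> [OF g S.one_closed] act_one [OF g] \<phi>.hom_one by simp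
  qed (use g \<sigma>_closed in blast)
  fix k c assume k: "k \<in> carrier K" and "c \<in> carrier B"
  then obtain s where s: "s \<in> carrier S" "c = \<phi> s" using \<phi>_cases by metis
  have *: "k \<odot>\<^bsub>B\<^esub> \<phi> t = \<phi> (\<iota> k \<odot>\<^bsub>S\<^esub> t)" if "t \<in> carrier S" for t
    using \<phi>_smult [of "\<iota> k" t] that k by (simp del: B_simps)
  show "\<sigma> g (k \<odot>\<^bsub>B\<^esub> c) = k \<odot>\<^bsub>B\<^esub> \<sigma> g c"
    using s g k by (simp add: * \<sigma>_\<phi> act_smult del: B_simps)
qed

sublocale BA: algebra_action K B G \<sigma>
  by unfold_locales (rule base_change_acts)

lemma fixed_iff:
  assumes "s \<in> carrier S" "g \<in> carrier G"
  shows "\<sigma> g (\<phi> s) = \<phi> s \<longleftrightarrow> \<rho> g (\<epsilon> \<odot>\<^bsub>S\<^esub> s) = \<epsilon> \<odot>\<^bsub>S\<^esub> s"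
  using assms by (simp add: \<sigma>_\<phi> \<phi>_eq_iff act_smult)

lemma smult_one_\<phi>: "k \<in> carrier K \<Longrightarrow> k \<odot>\<^bsub>B\<^esub> \<one>\<^bsub>B\<^esub> = \<phi> (\<iota> k \<odot>\<^bsub>S\<^esub> \<one>\<^bsub>S\<^esub>)"
  using \<phi>_smult [of "\<iota> k" "\<one>\<^bsub>S\<^esub>"] by (simp del: B_simps)

text \<open>The map \<open>\<phi>\<close> is injective on \<open>\<epsilon> S\<close> and maps it
  onto the base change, so each condition is tested on representatives there: idempotents lift to
  idempotents of \<open>S\<close> and fixed elements to fixed elements.\<close>

lemma galois_base_change:
  assumes gal: "galois_extension G R S \<rho>" and nontrivial: "\<one>\<^bsub>K\<^esub> \<noteq> \<zero>\<^bsub>K\<^esub>"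
  shows "galois_extension G K B \<sigma>"
proof -
  have inj: "inj_on (\<lambda>r. r \<odot>\<^bsub>S\<^esub> \<one>\<^bsub>S\<^esub>) (carrier R)" and fin: "finite (carrier G)"
    and fixed: "{s \<in> carrier S. \<forall>g\<in>carrier G. \<rho> g s = s} = (\<lambda>r. r \<odot>\<^bsub>S\<^esub> \<one>\<^bsub>S\<^esub>) ` carrier R"
    and sep: "separable_algebra R S"
    and dist: "\<And>g h. \<lbrakk>g \<in> carrier G; h \<in> carrier G; g \<noteq> h\<rbrakk> \<Longrightarrow> strongly_distinct S (\<rho> g) (\<rho> h)"
    using gal by (auto simp: galois_extension_def)
  have inj_K: "inj_on (\<lambda>k. k \<odot>\<^bsub>B\<^esub> \<one>\<^bsub>B\<^esub>) (carrier K)"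
  proof (rule inj_onI)
    fix k l assume kl: "k \<in> carrier K" "l \<in> carrier K" "k \<odot>\<^bsub>B\<^esub> \<one>\<^bsub>B\<^esub> = l \<odot>\<^bsub>B\<^esub> \<one>\<^bsub>B\<^esub>"
    then have "\<phi> (\<iota> k \<odot>\<^bsub>S\<^esub> \<one>\<^bsub>S\<^esub>) = \<phi> (\<iota> l \<odot>\<^bsub>S\<^esub> \<one>\<^bsub>S\<^esub>)" by (simp add: smult_one_\<phi> del: B_simps)
    then have "\<iota> k \<odot>\<^bsub>S\<^esub> \<one>\<^bsub>S\<^esub> = \<iota> l \<odot>\<^bsub>S\<^esub> \<one>\<^bsub>S\<^esub>"
      using kl by (simp add: \<phi>_eq_iff Mod.smult_assoc1 [symmetric] \<epsilon>_\<iota>)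
    then have "\<iota> k = \<iota> l" using inj kl by (auto dest: inj_onD)
    then show "k = l" using kl \<pi>_\<iota> by metis
  qed
  have sd: "strongly_distinct B (\<sigma> g) (\<sigma> h)"
    if gh: "g \<in> carrier G" "h \<in> carrier G" "g \<noteq> h" for g h
    unfolding strongly_distinct_def
  proof (intro ballI impI, elim conjE)
    fix e assume e: "e \<in> carrier B" "e \<otimes>\<^bsub>B\<^esub> e = e" "e \<noteq> \<zero>\<^bsub>B\<^esub>"
    then obtain e0 where e0: "e0 \<in> carrier S" "e = \<phi> e0" using \<phi>_cases by metis
    \<comment> \<open>Multiplying an arbitrary lift by \<open>\<epsilon>\<close> moves it to where
      \<open>\<phi>\<close> is injective, so that \<open>e1\<close> inherits idempotence from
      \<open>e\<close>.\<close>
    define e1 where "e1 = \<epsilon> \<odot>\<^bsub>S\<^esub> e0"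
    have e1: "e1 \<in> carrier S" "\<phi> e1 = e" using e0 by (simp_all add: e1_def \<phi>_\<epsilon>)
    have \<epsilon>e1: "\<epsilon> \<odot>\<^bsub>S\<^esub> e1 = e1" using e0 by (simp add: e1_def Mod.smult_assoc1 [symmetric] \<epsilon>_idem)
    have \<epsilon>m: "\<epsilon> \<odot>\<^bsub>S\<^esub> (s \<otimes>\<^bsub>S\<^esub> e1) = s \<otimes>\<^bsub>S\<^esub> e1" if "s \<in> carrier S" for s
      using that e1 \<epsilon>e1 by (simp add: smult_mult_right [symmetric])
    have "\<phi> (e1 \<otimes>\<^bsub>S\<^esub> e1) = \<phi> e1" using e1 e(2) by (simp del: B_simps)
    then have "e1 \<otimes>\<^bsub>S\<^esub> e1 = e1" using e1(1) \<epsilon>e1 \<epsilon>m by (simp add: \<phi>_eq_iff del: B_simps \<phi>.hom_mult)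
    moreover have "e1 \<noteq> \<zero>\<^bsub>S\<^esub>" using e1 e \<phi>.hom_zero by metis
    ultimately obtain s where s: "s \<in> carrier S" "\<rho> g s \<otimes>\<^bsub>S\<^esub> e1 \<noteq> \<rho> h s \<otimes>\<^bsub>S\<^esub> e1"
      using dist [OF gh] e1 unfolding strongly_distinct_def by blast
    have "\<sigma> g (\<phi> s) \<otimes>\<^bsub>B\<^esub> e \<noteq> \<sigma> h (\<phi> s) \<otimes>\<^bsub>B\<^esub> e"
    proof
      assume "\<sigma> g (\<phi> s) \<otimes>\<^bsub>B\<^esub> e = \<sigma> h (\<phi> s) \<otimes>\<^bsub>B\<^esub> e"
      then have "\<phi> (\<rho> g s \<otimes>\<^bsub>S\<^esub> e1) = \<phi> (\<rho> h s \<otimes>\<^bsub>S\<^esub> e1)"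
        using s(1) e1 gh \<sigma>_\<phi> \<phi>.hom_mult act_closed by metis
      then show False using s e1 gh by (simp add: \<phi>_eq_iff \<epsilon>m del: \<phi>.hom_mult B_simps)
    qed
    then show "\<exists>s\<in>carrier B. \<sigma> g s \<otimes>\<^bsub>B\<^esub> e \<noteq> \<sigma> h s \<otimes>\<^bsub>B\<^esub> e"
      using s(1) \<phi>.hom_closed by blast
  qed
  \<comment> \<open>Faithfulness comes from strong distinctness tested at the idempotent
    \<open>1\<close>, which has to be nonzero for that.\<close>
  have "\<one>\<^bsub>B\<^esub> \<noteq> \<zero>\<^bsub>B\<^esub>"
  proof
    assume "\<one>\<^bsub>B\<^esub> = \<zero>\<^bsub>B\<^esub>"
    then have "\<one>\<^bsub>K\<^esub> \<odot>\<^bsub>B\<^esub> \<one>\<^bsub>B\<^esub> = \<zero>\<^bsub>K\<^esub> \<odot>\<^bsub>B\<^esub> \<one>\<^bsub>B\<^esub>"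
      using B.Mod.smult_one [OF B.S.one_closed] B.Mod.smult_l_null [OF B.S.one_closed] by metis
    then show False using inj_onD [OF inj_K] nontrivial by blast
  qed
  then have "inj_on \<sigma> (carrier G)"
    using sd B.S.one_closed B.S.l_one unfolding inj_on_def strongly_distinct_def by metis
  then have faithful: "faithful_action G (carrier B) \<sigma>"
    by (intro faithful_action.intro faithful_action_axioms.intro BA.group_action)
  have "{s \<in> carrier B. \<forall>g\<in>carrier G. \<sigma> g s = s} = (\<lambda>r. r \<odot>\<^bsub>B\<^esub> \<one>\<^bsub>B\<^esub>) ` carrier K"
  proof (intro equalityI subsetI)
    fix c assume c: "c \<in> {s \<in> carrier B. \<forall>g\<in>carrier G. \<sigma> g s = s}"
    then obtain s where s: "s \<in> carrier S" "c = \<phi> s" using \<phi>_cases by blast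
    then have "\<epsilon> \<odot>\<^bsub>S\<^esub> s \<in> {s \<in> carrier S. \<forall>g\<in>carrier G. \<rho> g s = s}"
      using c fixed_iff [OF s(1)] by auto
    then obtain r where r: "r \<in> carrier R" "\<epsilon> \<odot>\<^bsub>S\<^esub> s = r \<odot>\<^bsub>S\<^esub> \<one>\<^bsub>S\<^esub>" using fixed by auto
    have "c = \<pi> r \<odot>\<^bsub>B\<^esub> \<one>\<^bsub>B\<^esub>"
      using s r \<phi>_\<epsilon> [of s] \<phi>_smult [of r "\<one>\<^bsub>S\<^esub>"] by (simp del: B_simps)
    then show "c \<in> (\<lambda>r. r \<odot>\<^bsub>B\<^esub> \<one>\<^bsub>B\<^esub>) ` carrier K" using r \<pi>.hom_closed by blast
  next
    fix c assume "c \<in> (\<lambda>r. r \<odot>\<^bsub>B\<^esub> \<one>\<^bsub>B\<^esub>) ` carrier K"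
    then obtain k where k: "k \<in> carrier K" "c = k \<odot>\<^bsub>B\<^esub> \<one>\<^bsub>B\<^esub>" by blast
    then show "c \<in> {s \<in> carrier B. \<forall>g\<in>carrier G. \<sigma> g s = s}"
      using BA.act_smult BA.act_one B.Mod.smult_closed B.S.one_closed by (simp del: B_simps)
  qed
  moreover have "\<forall>g\<in>carrier G. \<forall>h\<in>carrier G. g \<noteq> h \<longrightarrow> strongly_distinct B (\<sigma> g) (\<sigma> h)"
    using sd by blast
  ultimately show ?thesis
    unfolding galois_extension_def
    by (intro conjI base_change_algebra inj_K fin base_change_acts faithful separable_base_change [OF sep])
qed

end

section \<open>Galois extensions and direct factors\<close>

lemma linear_functional_zero:
  assumes "module R M" "f \<in> linear_functionals R M"
  shows "f \<zero>\<^bsub>M\<^esub> = \<zero>\<^bsub>R\<^esub>"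
proof -
  interpret module R M by (rule assms)
  show ?thesis
    using linear_functionalsD [OF assms(2)] smult_l_null [OF M.zero_closed]
    by (metis M.zero_closed R.l_null R.zero_closed)
qed

context factor_action
begin

lemma \<epsilon>_fixed:
  assumes gal: "galois_extension G K B \<sigma>" and t: "t \<in> fixed_ring"
  obtains k where "k \<in> carrier K" "\<epsilon> \<odot>\<^bsub>S\<^esub> t = \<iota> k \<odot>\<^bsub>S\<^esub> \<one>\<^bsub>S\<^esub>"
proof -
  have ts: "t \<in> carrier S" and tg: "\<And>g. g \<in> carrier G \<Longrightarrow> \<rho> g t = t"
    using t by (auto simp: fixed_ring_def)
  have "\<phi> t \<in> {s \<in> carrier B. \<forall>g\<in>carrier G. \<sigma> g s = s}"
    using ts tg \<phi>.hom_closed [OF ts] \<sigma>_\<phi> [OF _ ts] by (simp del: B_simps)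
  also have "\<dots> = (\<lambda>r. r \<odot>\<^bsub>B\<^esub> \<one>\<^bsub>B\<^esub>) ` carrier K"
    using gal by (simp add: galois_extension_def del: B_simps)
  finally obtain k where k: "k \<in> carrier K" "\<phi> t = k \<odot>\<^bsub>B\<^esub> \<one>\<^bsub>B\<^esub>" by blast
  then have "\<phi> t = \<phi> (\<iota> k \<odot>\<^bsub>S\<^esub> \<one>\<^bsub>S\<^esub>)" using smult_one_\<phi> by metis
  then have "\<epsilon> \<odot>\<^bsub>S\<^esub> t = \<iota> k \<odot>\<^bsub>S\<^esub> \<one>\<^bsub>S\<^esub>"
    using k(1) ts by (simp add: \<phi>_eq_iff Mod.smult_assoc1 [symmetric] \<epsilon>_\<iota>)
  then show thesis using k(1) that by blast
qed

lemma \<pi>_eqI_of_structure: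
  assumes gal: "galois_extension G K B \<sigma>"
    and r: "r \<in> carrier R" "r' \<in> carrier R" "r \<odot>\<^bsub>S\<^esub> \<one>\<^bsub>S\<^esub> = r' \<odot>\<^bsub>S\<^esub> \<one>\<^bsub>S\<^esub>"
  shows "\<pi> r = \<pi> r'"
proof -
  have "\<pi> r \<odot>\<^bsub>B\<^esub> \<one>\<^bsub>B\<^esub> = \<pi> r' \<odot>\<^bsub>B\<^esub> \<one>\<^bsub>B\<^esub>"
    using r \<phi>_smult [OF _ S.one_closed] \<phi>.hom_one by metis
  moreover have "inj_on (\<lambda>k. k \<odot>\<^bsub>B\<^esub> \<one>\<^bsub>B\<^esub>) (carrier K)"
    using gal by (simp add: galois_extension_def del: B_simps)
  ultimately show ?thesis using r \<pi>.hom_closed by (auto dest: inj_onD simp del: B_simps)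
qed

lemma strongly_distinct_component:
  assumes gal: "galois_extension G K B \<sigma>" and gh: "g \<in> carrier G" "h \<in> carrier G" "g \<noteq> h"
    and e: "e \<in> carrier S" "e \<otimes>\<^bsub>S\<^esub> e = e" "\<epsilon> \<odot>\<^bsub>S\<^esub> e \<noteq> \<zero>\<^bsub>S\<^esub>"
  shows "\<exists>s\<in>carrier S. \<rho> g s \<otimes>\<^bsub>S\<^esub> e \<noteq> \<rho> h s \<otimes>\<^bsub>S\<^esub> e"
proof -
  have "\<phi> e \<otimes>\<^bsub>B\<^esub> \<phi> e = \<phi> e" using e \<phi>.hom_mult by metis
  moreover have "\<phi> e \<noteq> \<zero>\<^bsub>B\<^esub>"
    using e \<phi>_eq_iff [OF e(1) S.zero_closed] \<phi>.hom_zero Mod.smult_r_null [of \<epsilon>] by auto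
  moreover have "strongly_distinct B (\<sigma> g) (\<sigma> h)"
    using gal gh by (simp add: galois_extension_def)
  ultimately obtain c where c: "c \<in> carrier B" "\<sigma> g c \<otimes>\<^bsub>B\<^esub> \<phi> e \<noteq> \<sigma> h c \<otimes>\<^bsub>B\<^esub> \<phi> e"
    using \<phi>.hom_closed [OF e(1)] unfolding strongly_distinct_def by blast
  then obtain s where s: "s \<in> carrier S" "c = \<phi> s" using \<phi>_cases by blast
  have "\<sigma> k c \<otimes>\<^bsub>B\<^esub> \<phi> e = \<phi> (\<rho> k s \<otimes>\<^bsub>S\<^esub> e)" if "k \<in> carrier G" for k
    using that s e(1) \<sigma>_\<phi> \<phi>.hom_mult act_closed by metis
  then show ?thesis using c s gh by metis
qed

end

context algebra_action
begin

lemma galois_local_global: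
  fixes K :: "'i \<Rightarrow> 't ring" and \<pi> :: "'i \<Rightarrow> 'r \<Rightarrow> 't" and \<iota> :: "'i \<Rightarrow> 't \<Rightarrow> 'r"
  assumes factors: "\<And>i. i \<in> Y \<Longrightarrow> direct_factor R (K i) (\<pi> i) (\<iota> i)" and Y: "Y \<noteq> {}"
    and joint: "\<And>r. \<lbrakk>r \<in> carrier R; \<And>i. i \<in> Y \<Longrightarrow> \<pi> i r = \<zero>\<^bsub>K i\<^esub>\<rbrakk> \<Longrightarrow> r = \<zero>\<^bsub>R\<^esub>"
    and proj: "projective_module R S" and sep: "separable_algebra R S"
    and fin: "finite (carrier G)"
    and n: "n \<in> carrier R" "n \<otimes>\<^bsub>R\<^esub> (\<Oplus>\<^bsub>R\<^esub>g\<in>carrier G. \<one>\<^bsub>R\<^esub>) = \<one>\<^bsub>R\<^esub>"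
    and gal: "\<And>i. i \<in> Y \<Longrightarrow> galois_extension G (K i) (base_change R S (algebra_via (K i) (\<pi> i)))
      (\<lambda>g. tensor_map_left R S (algebra_via (K i) (\<pi> i)) (\<rho> g))"
  shows "galois_extension G R S \<rho>"
proof -
  have FA: "factor_action R S (K i) (\<pi> i) (\<iota> i) G \<rho>" if "i \<in> Y" for i
    by (intro factor_action.intro factor_algebra.intro factors that comm_algebra_axioms algebra_action_axioms)
  have \<epsilon>_closed: "\<iota> i \<one>\<^bsub>K i\<^esub> \<in> carrier R" and \<pi>_\<epsilon>: "\<And>r. r \<in> carrier R \<Longrightarrow> \<pi> i (\<iota> i \<one>\<^bsub>K i\<^esub> \<otimes>\<^bsub>R\<^esub> r) = \<pi> i r"
    and \<pi>_zero: "\<pi> i \<zero>\<^bsub>R\<^esub> = \<zero>\<^bsub>K i\<^esub>" if "i \<in> Y" for i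
  proof -
    interpret direct_factor R "K i" "\<pi> i" "\<iota> i" by (rule factors [OF that])
    show "\<iota> i \<one>\<^bsub>K i\<^esub> \<in> carrier R" "\<pi> i \<zero>\<^bsub>R\<^esub> = \<zero>\<^bsub>K i\<^esub>" by simp_all
    show "\<pi> i (\<iota> i \<one>\<^bsub>K i\<^esub> \<otimes>\<^bsub>R\<^esub> r) = \<pi> i r" if "r \<in> carrier R" for r using that by simp
  qed
  \<comment> \<open>If all components of \<open>s\<close> vanish, so do all components of
    \<open>f(s)\<close> for each linear \<open>f\<close>. Then \<open>joint\<close> gives
    \<open>f(s) = 0\<close>, and a dual basis rebuilds \<open>s\<close> from such values.\<close>
  have zero: "s = \<zero>\<^bsub>S\<^esub>" if s: "s \<in> carrier S" and comp: "\<And>i. i \<in> Y \<Longrightarrow> \<iota> i \<one>\<^bsub>K i\<^esub> \<odot>\<^bsub>S\<^esub> s = \<zero>\<^bsub>S\<^esub>" for s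
  proof -
    obtain J :: "'s set" and f a where J: "finite J" "f \<in> J \<rightarrow> linear_functionals R S" "a \<in> J \<rightarrow> carrier S"
      "s = (\<Oplus>\<^bsub>S\<^esub>j\<in>J. f j s \<odot>\<^bsub>S\<^esub> a j)"
      by (rule projective_module_dual_basis [OF proj s])
    have f0: "f j s = \<zero>\<^bsub>R\<^esub>" if j: "j \<in> J" for j
    proof (rule joint)
      note f = linear_functionalsD [OF funcset_mem [OF J(2) j]]
      show "f j s \<in> carrier R" using f s by simp
      fix i assume i: "i \<in> Y"
      have "\<iota> i \<one>\<^bsub>K i\<^esub> \<otimes>\<^bsub>R\<^esub> f j s = f j \<zero>\<^bsub>S\<^esub>"
        using f(3) [OF \<epsilon>_closed [OF i] s] comp [OF i] by simp
      also have "\<dots> = \<zero>\<^bsub>R\<^esub>"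
        by (rule linear_functional_zero [OF Mod.module_axioms funcset_mem [OF J(2) j]])
      finally show "\<pi> i (f j s) = \<zero>\<^bsub>K i\<^esub>" using \<pi>_\<epsilon> [OF i f(1) [OF s]] \<pi>_zero [OF i] by simp
    qed
    have "(\<Oplus>\<^bsub>S\<^esub>j\<in>J. f j s \<odot>\<^bsub>S\<^esub> a j) = (\<Oplus>\<^bsub>S\<^esub>j\<in>J. \<zero>\<^bsub>S\<^esub>)"
      using J(3) f0 by (intro S.finsum_cong') (auto simp: Pi_iff)
    then show ?thesis using J(4) by simp
  qed
  have eq: "s = t" if st: "s \<in> carrier S" "t \<in> carrier S"
    and comp: "\<And>i. i \<in> Y \<Longrightarrow> \<iota> i \<one>\<^bsub>K i\<^esub> \<odot>\<^bsub>S\<^esub> s = \<iota> i \<one>\<^bsub>K i\<^esub> \<odot>\<^bsub>S\<^esub> t" for s t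
  proof -
    have "s \<ominus>\<^bsub>S\<^esub> t = \<zero>\<^bsub>S\<^esub>"
    proof (rule zero)
      show "\<iota> i \<one>\<^bsub>K i\<^esub> \<odot>\<^bsub>S\<^esub> (s \<ominus>\<^bsub>S\<^esub> t) = \<zero>\<^bsub>S\<^esub>" if "i \<in> Y" for i
        using st \<epsilon>_closed [OF that] comp [OF that]
        by (simp add: a_minus_def Mod.smult_r_distr Mod.smult_r_minus S.r_neg)
    qed (use st in simp)
    then show ?thesis using st by simp
  qed
  have inj: "inj_on (\<lambda>r. r \<odot>\<^bsub>S\<^esub> \<one>\<^bsub>S\<^esub>) (carrier R)"
  proof (rule inj_onI)
    fix r r' assume r: "r \<in> carrier R" "r' \<in> carrier R" "r \<odot>\<^bsub>S\<^esub> \<one>\<^bsub>S\<^esub> = r' \<odot>\<^bsub>S\<^esub> \<one>\<^bsub>S\<^esub>"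
    have "r \<ominus>\<^bsub>R\<^esub> r' = \<zero>\<^bsub>R\<^esub>"
    proof (rule joint)
      fix i assume i: "i \<in> Y"
      interpret factor_action R S "K i" "\<pi> i" "\<iota> i" G \<rho> by (rule FA [OF i])
      have "\<pi> i r = \<pi> i r'" by (rule \<pi>_eqI_of_structure [OF gal [OF i] r])
      then show "\<pi> i (r \<ominus>\<^bsub>R\<^esub> r') = \<zero>\<^bsub>K i\<^esub>"
        using r by (simp add: a_minus_def K.r_neg)
    qed (use r in simp)
    then show "r = r'" using r by simp
  qed
  have faithful: "faithful_action G (carrier S) \<rho>"
  proof (intro faithful_action.intro faithful_action_axioms.intro group_action)
    \<comment> \<open>One factor is enough: group elements acting equally on \<open>S\<close> act
      equally on each base change.\<close>
    obtain i where i: "i \<in> Y" using Y by blast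
    have "inj_on (\<lambda>g. tensor_map_left R S (algebra_via (K i) (\<pi> i)) (\<rho> g)) (carrier G)"
      using gal [OF i] by (auto simp: galois_extension_def faithful_action_def faithful_action_axioms_def)
    then show "inj_on \<rho> (carrier G)" by (auto simp: inj_on_def)
  qed
  have fixed: "{s \<in> carrier S. \<forall>g\<in>carrier G. \<rho> g s = s} = (\<lambda>r. r \<odot>\<^bsub>S\<^esub> \<one>\<^bsub>S\<^esub>) ` carrier R"
  proof (intro equalityI subsetI)
    fix t assume "t \<in> {s \<in> carrier S. \<forall>g\<in>carrier G. \<rho> g s = s}"
    then have "t \<in> fixed_ring" by (simp add: fixed_ring_def)
    then show "t \<in> (\<lambda>r. r \<odot>\<^bsub>S\<^esub> \<one>\<^bsub>S\<^esub>) ` carrier R"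
    proof (rule fixed_ring_eq_base [OF proj fin n, rotated])
      fix t f assume t: "t \<in> fixed_ring" and f: "f \<in> linear_functionals R S"
      note f' = linear_functionalsD [OF f]
      have ts: "t \<in> carrier S" using t by (simp add: fixed_ring_def)
      show "f t \<odot>\<^bsub>S\<^esub> \<one>\<^bsub>S\<^esub> = f \<one>\<^bsub>S\<^esub> \<odot>\<^bsub>S\<^esub> t"
      proof (rule eq)
        fix i assume i: "i \<in> Y"
        interpret factor_action R S "K i" "\<pi> i" "\<iota> i" G \<rho> by (rule FA [OF i])
        \<comment> \<open>At this factor \<open>t\<close> is the scalar \<open>k\<close>, and by
          linearity of \<open>f\<close> both sides become \<open>\<iota> k\<close> times
          \<open>f(1)\<close> times the unit.\<close>
        obtain k where k: "k \<in> carrier (K i)" "\<epsilon> \<odot>\<^bsub>S\<^esub> t = \<iota> i k \<odot>\<^bsub>S\<^esub> \<one>\<^bsub>S\<^esub>"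
          using \<epsilon>_fixed [OF gal [OF i] t] by blast
        have "\<epsilon> \<odot>\<^bsub>S\<^esub> (f t \<odot>\<^bsub>S\<^esub> \<one>\<^bsub>S\<^esub>) = f (\<epsilon> \<odot>\<^bsub>S\<^esub> t) \<odot>\<^bsub>S\<^esub> \<one>\<^bsub>S\<^esub>"
          using ts f' by (simp add: Mod.smult_assoc1)
        also have "\<dots> = f \<one>\<^bsub>S\<^esub> \<odot>\<^bsub>S\<^esub> (\<epsilon> \<odot>\<^bsub>S\<^esub> t)"
          using k f' by (simp add: Mod.smult_assoc1 [symmetric] R.m_comm)
        also have "\<dots> = \<epsilon> \<odot>\<^bsub>S\<^esub> (f \<one>\<^bsub>S\<^esub> \<odot>\<^bsub>S\<^esub> t)"
          using ts f' by (simp add: Mod.smult_assoc1 [symmetric] R.m_comm)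
        finally show "\<epsilon> \<odot>\<^bsub>S\<^esub> (f t \<odot>\<^bsub>S\<^esub> \<one>\<^bsub>S\<^esub>) = \<epsilon> \<odot>\<^bsub>S\<^esub> (f \<one>\<^bsub>S\<^esub> \<odot>\<^bsub>S\<^esub> t)" .
      qed (use ts f' in auto)
    qed
  qed (auto simp: act_smult act_one)
  have "strongly_distinct S (\<rho> g) (\<rho> h)" if gh: "g \<in> carrier G" "h \<in> carrier G" "g \<noteq> h" for g h
    unfolding strongly_distinct_def
  proof (intro ballI impI, elim conjE)
    fix e assume e: "e \<in> carrier S" "e \<otimes>\<^bsub>S\<^esub> e = e" "e \<noteq> \<zero>\<^bsub>S\<^esub>"
    then obtain i where i: "i \<in> Y" "\<iota> i \<one>\<^bsub>K i\<^esub> \<odot>\<^bsub>S\<^esub> e \<noteq> \<zero>\<^bsub>S\<^esub>" using zero by blast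
    interpret factor_action R S "K i" "\<pi> i" "\<iota> i" G \<rho> by (rule FA [OF i(1)])
    show "\<exists>s\<in>carrier S. \<rho> g s \<otimes>\<^bsub>S\<^esub> e \<noteq> \<rho> h s \<otimes>\<^bsub>S\<^esub> e"
      by (rule strongly_distinct_component [OF gal [OF i(1)] gh e(1,2) i(2)])
  qed
  then have "\<forall>g\<in>carrier G. \<forall>h\<in>carrier G. g \<noteq> h \<longrightarrow> strongly_distinct S (\<rho> g) (\<rho> h)" by blast
  then show ?thesis
    unfolding galois_extension_def by (intro conjI alg inj fin acts faithful fixed sep)
qed

end

section \<open>Free modules\<close>

lemma free_of_rankI:
  assumes M: "module R M" and u: "u \<in> {..<n} \<rightarrow> carrier M"
    and span: "\<And>m. m \<in> carrier M \<Longrightarrow> \<exists>a\<in>{..<n} \<rightarrow> carrier R. m = (\<Oplus>\<^bsub>M\<^esub>j\<in>{..<n}. a j \<odot>\<^bsub>M\<^esub> u j)"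
    and indep: "\<And>a b. \<lbrakk>a \<in> {..<n} \<rightarrow> carrier R; b \<in> {..<n} \<rightarrow> carrier R;
      (\<Oplus>\<^bsub>M\<^esub>j\<in>{..<n}. a j \<odot>\<^bsub>M\<^esub> u j) = (\<Oplus>\<^bsub>M\<^esub>j\<in>{..<n}. b j \<odot>\<^bsub>M\<^esub> u j)\<rbrakk> \<Longrightarrow> \<forall>j<n. a j = b j"
  shows "free_of_rank R M n"
proof -
  interpret module R M by (rule M)
  define f where "f a = (\<Oplus>\<^bsub>M\<^esub>j\<in>{..<n}. a j \<odot>\<^bsub>M\<^esub> u j)" for a :: "nat \<Rightarrow> 'a"
  have free: "carrier (free_module R {..<n}) = {..<n} \<rightarrow>\<^sub>E carrier R"
    by (auto simp: free_module_def)
  have summand: "(\<lambda>j. a j \<odot>\<^bsub>M\<^esub> u j) \<in> {..<n} \<rightarrow> carrier M" if "a \<in> {..<n} \<rightarrow>\<^sub>E carrier R" for a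
    using that u by (auto simp: PiE_iff Pi_iff)
  have cl: "f a \<in> carrier M" if "a \<in> {..<n} \<rightarrow>\<^sub>E carrier R" for a
    unfolding f_def by (rule M.finsum_closed [OF summand [OF that]])
  have "f \<in> module_homs R (free_module R {..<n}) M"
    unfolding module_homs_def free
  proof (intro CollectI conjI ballI)
    fix a b assume ab: "a \<in> {..<n} \<rightarrow>\<^sub>E carrier R" "b \<in> {..<n} \<rightarrow>\<^sub>E carrier R"
    have "f (a \<oplus>\<^bsub>free_module R {..<n}\<^esub> b) = (\<Oplus>\<^bsub>M\<^esub>j\<in>{..<n}. a j \<odot>\<^bsub>M\<^esub> u j \<oplus>\<^bsub>M\<^esub> b j \<odot>\<^bsub>M\<^esub> u j)"
      unfolding f_def using ab u summand [OF ab(1)] summand [OF ab(2)]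
      by (intro M.finsum_cong') (auto simp: free_module_def smult_l_distr PiE_iff Pi_iff)
    also have "\<dots> = f a \<oplus>\<^bsub>M\<^esub> f b"
      unfolding f_def by (rule M.finsum_addf [OF summand [OF ab(1)] summand [OF ab(2)]])
    finally show "f (a \<oplus>\<^bsub>free_module R {..<n}\<^esub> b) = f a \<oplus>\<^bsub>M\<^esub> f b" .
  next
    fix r a assume ra: "r \<in> carrier R" "a \<in> {..<n} \<rightarrow>\<^sub>E carrier R"
    have "r \<odot>\<^bsub>M\<^esub> f a = (\<Oplus>\<^bsub>M\<^esub>j\<in>{..<n}. r \<odot>\<^bsub>M\<^esub> (a j \<odot>\<^bsub>M\<^esub> u j))"
      unfolding f_def using ra summand [OF ra(2)] by (intro finsum_smult_ldistr) auto
    also have "\<dots> = f (r \<odot>\<^bsub>free_module R {..<n}\<^esub> a)"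
      unfolding f_def using ra u
      by (intro M.finsum_cong') (auto simp: free_module_def smult_assoc1 PiE_iff Pi_iff)
    finally show "f (r \<odot>\<^bsub>free_module R {..<n}\<^esub> a) = r \<odot>\<^bsub>M\<^esub> f a" by simp
  qed (use cl in blast)
  moreover have "bij_betw f (carrier (free_module R {..<n})) (carrier M)"
    unfolding bij_betw_def free
  proof (intro conjI inj_onI equalityI subsetI)
    fix a b assume ab: "a \<in> {..<n} \<rightarrow>\<^sub>E carrier R" "b \<in> {..<n} \<rightarrow>\<^sub>E carrier R" "f a = f b"
    then have "\<forall>j<n. a j = b j" by (intro indep) (auto simp: f_def PiE_iff)
    then show "a = b" using ab by (intro PiE_ext [OF ab(1,2)]) auto
  next
    fix m assume "m \<in> carrier M"
    then obtain a where a: "a \<in> {..<n} \<rightarrow> carrier R" "m = (\<Oplus>\<^bsub>M\<^esub>j\<in>{..<n}. a j \<odot>\<^bsub>M\<^esub> u j)" using span by blast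
    have "restrict a {..<n} \<in> {..<n} \<rightarrow>\<^sub>E carrier R" using a by auto
    moreover have "f (restrict a {..<n}) = m"
      unfolding f_def a(2) using a(1) u by (intro M.finsum_cong') (auto simp: Pi_iff)
    ultimately show "m \<in> f ` ({..<n} \<rightarrow>\<^sub>E carrier R)" by blast
  qed (use cl in blast)
  ultimately show ?thesis using M by (auto simp: free_of_rank_def)
qed

context algebra_action
begin

text \<open>Multiplication by \<open>v\<close> maps the eigenspace into the fixed ring, which is a
  copy of \<open>R\<close>, and multiplication by \<open>u\<close> undoes it.\<close>

lemma eigenspace_free:
  assumes gal: "galois_extension G R S \<rho>" and c: "character c"
    and u: "u \<in> eigenspace c" and v: "v \<in> eigenspace (\<lambda>g. c (inv\<^bsub>G\<^esub> g))" and uv: "u \<otimes>\<^bsub>S\<^esub> v = \<one>\<^bsub>S\<^esub>"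
  shows "\<And>s. s \<in> eigenspace c \<Longrightarrow> \<exists>a\<in>carrier R. s = a \<odot>\<^bsub>S\<^esub> u"
    "\<And>a b. \<lbrakk>a \<in> carrier R; b \<in> carrier R; a \<odot>\<^bsub>S\<^esub> u = b \<odot>\<^bsub>S\<^esub> u\<rbrakk> \<Longrightarrow> a = b"
proof -
  have inj: "inj_on (\<lambda>r. r \<odot>\<^bsub>S\<^esub> \<one>\<^bsub>S\<^esub>) (carrier R)"
    and fixed: "fixed_ring = (\<lambda>r. r \<odot>\<^bsub>S\<^esub> \<one>\<^bsub>S\<^esub>) ` carrier R"
    using gal by (auto simp: galois_extension_def fixed_ring_def)
  have us: "u \<in> carrier S" and vs: "v \<in> carrier S" using u v by (auto simp: eigenspace_def)
  show "\<exists>a\<in>carrier R. s = a \<odot>\<^bsub>S\<^esub> u" if s: "s \<in> eigenspace c" for s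
  proof -
    have ss: "s \<in> carrier S" using s by (simp add: eigenspace_def)
    obtain a where a: "a \<in> carrier R" "s \<otimes>\<^bsub>S\<^esub> v = a \<odot>\<^bsub>S\<^esub> \<one>\<^bsub>S\<^esub>"
      using eigenspace_mult_inverse [OF c s v] fixed by blast
    have "s = s \<otimes>\<^bsub>S\<^esub> (v \<otimes>\<^bsub>S\<^esub> u)" using uv us vs ss by (simp add: S.m_comm)
    also have "\<dots> = (s \<otimes>\<^bsub>S\<^esub> v) \<otimes>\<^bsub>S\<^esub> u" using us vs ss by (simp add: S.m_assoc)
    also have "\<dots> = a \<odot>\<^bsub>S\<^esub> u" using a us by (simp add: smult_mult_left)
    finally show ?thesis using a by blast
  qed
  show "a = b" if ab: "a \<in> carrier R" "b \<in> carrier R" "a \<odot>\<^bsub>S\<^esub> u = b \<odot>\<^bsub>S\<^esub> u" for a b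
  proof -
    have "(a \<odot>\<^bsub>S\<^esub> u) \<otimes>\<^bsub>S\<^esub> v = (b \<odot>\<^bsub>S\<^esub> u) \<otimes>\<^bsub>S\<^esub> v" using ab by simp
    then have "a \<odot>\<^bsub>S\<^esub> \<one>\<^bsub>S\<^esub> = b \<odot>\<^bsub>S\<^esub> \<one>\<^bsub>S\<^esub>" using ab(1,2) us vs uv by (simp add: smult_mult_left)
    then show ?thesis using inj ab by (auto dest: inj_onD)
  qed
qed

lemma eigenspace_free_of_rank_one:
  assumes gal: "galois_extension G R S \<rho>" and c: "character c"
    and u: "u \<in> eigenspace c" and v: "v \<in> eigenspace (\<lambda>g. c (inv\<^bsub>G\<^esub> g))" and uv: "u \<otimes>\<^bsub>S\<^esub> v = \<one>\<^bsub>S\<^esub>"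
  shows "free_of_rank R (S\<lparr>carrier := eigenspace c\<rparr>) 1"
proof -
  let ?M = "S\<lparr>carrier := eigenspace c\<rparr>"
  have M: "module R ?M"
    by (rule submodule.submodule_is_module [OF eigenspace_submodule [OF c] Mod.module_axioms])
  interpret M: module R ?M by (rule M)
  have sum: "(\<Oplus>\<^bsub>?M\<^esub>j\<in>{..<1::nat}. a j \<odot>\<^bsub>?M\<^esub> u) = a 0 \<odot>\<^bsub>S\<^esub> u" if "a \<in> {..<1} \<rightarrow> carrier R" for a :: "nat \<Rightarrow> 'r"
  proof -
    have "a 0 \<odot>\<^bsub>?M\<^esub> u \<in> carrier ?M" using that u by (intro M.smult_closed) auto
    moreover have "{..<1::nat} = {0}" by auto
    ultimately show ?thesis using M.M.finsum_insert [of "{}" 0 "\<lambda>j. a j \<odot>\<^bsub>?M\<^esub> u"] M.M.r_zero by (simp add: Pi_iff)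
  qed
  show ?thesis
  proof (rule free_of_rankI [OF M, of "\<lambda>_. u"])
    fix m assume "m \<in> carrier ?M"
    then obtain a where a: "a \<in> carrier R" "m = a \<odot>\<^bsub>S\<^esub> u" using eigenspace_free(1) [OF assms] by auto
    then show "\<exists>a\<in>{..<1} \<rightarrow> carrier R. m = (\<Oplus>\<^bsub>?M\<^esub>j\<in>{..<1::nat}. a j \<odot>\<^bsub>?M\<^esub> u)"
      using sum [of "\<lambda>_. a"] by (intro bexI [of _ "\<lambda>_. a"]) auto
  next
    fix a b :: "nat \<Rightarrow> 'r" assume ab: "a \<in> {..<1} \<rightarrow> carrier R" "b \<in> {..<1} \<rightarrow> carrier R"
      "(\<Oplus>\<^bsub>?M\<^esub>j\<in>{..<1}. a j \<odot>\<^bsub>?M\<^esub> u) = (\<Oplus>\<^bsub>?M\<^esub>j\<in>{..<1}. b j \<odot>\<^bsub>?M\<^esub> u)"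
    then have "a 0 = b 0" using eigenspace_free(2) [OF assms, of "a 0" "b 0"] sum by auto
    then show "\<forall>j<1. a j = b j" by simp
  qed (use u in simp)
qed

section \<open>Decomposition of the algebra into eigenspaces\<close>

lemma character_pow:
  assumes "character c"
  shows "character (\<lambda>g. c g [^]\<^bsub>R\<^esub> (m::nat))"
  unfolding character_def
proof (intro conjI homI)
  note c = characterD [OF assms]
  show "c g [^]\<^bsub>R\<^esub> m \<in> carrier R" if "g \<in> carrier G" for g using c(1) [OF that] by simp
  show "c (g \<otimes>\<^bsub>G\<^esub> h) [^]\<^bsub>R\<^esub> m = c g [^]\<^bsub>R\<^esub> m \<otimes>\<^bsub>R\<^esub> c h [^]\<^bsub>R\<^esub> m"
    if "g \<in> carrier G" "h \<in> carrier G" for g h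
    unfolding c(2) [OF that] using c(1) that by (intro R.nat_pow_distrib) auto
  show "c \<one>\<^bsub>G\<^esub> [^]\<^bsub>R\<^esub> m = \<one>\<^bsub>R\<^esub>" using c(3) by simp
qed

lemma eigenspace_pow:
  assumes c: "character c" and u: "u \<in> eigenspace c"
  shows "u [^]\<^bsub>S\<^esub> (m::nat) \<in> eigenspace (\<lambda>g. c g [^]\<^bsub>R\<^esub> m)"
proof (induction m)
  case 0
  show ?case by (auto simp: eigenspace_def act_one)
next
  case (Suc m)
  show ?case using eigenspace_mult [OF character_pow [OF c] c Suc u] by simp
qed

lemma twisted_trace_linear:
  assumes fin: "finite (carrier G)" and c: "character c" and J: "finite J"
    and a: "a \<in> J \<rightarrow> carrier R" "s \<in> J \<rightarrow> carrier S"
  shows "twisted_trace c (\<Oplus>\<^bsub>S\<^esub>j\<in>J. a j \<odot>\<^bsub>S\<^esub> s j) = (\<Oplus>\<^bsub>S\<^esub>j\<in>J. a j \<odot>\<^bsub>S\<^esub> twisted_trace c (s j))"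
proof -
  note c' = characterD(1) [OF c]
  have a': "a j \<in> carrier R" "s j \<in> carrier S" if "j \<in> J" for j using that a by auto
  have "twisted_trace c (\<Oplus>\<^bsub>S\<^esub>j\<in>J. a j \<odot>\<^bsub>S\<^esub> s j)
      = (\<Oplus>\<^bsub>S\<^esub>g\<in>carrier G. \<Oplus>\<^bsub>S\<^esub>j\<in>J. c (inv\<^bsub>G\<^esub> g) \<odot>\<^bsub>S\<^esub> (a j \<odot>\<^bsub>S\<^esub> \<rho> g (s j)))"
    unfolding twisted_trace_def
  proof (rule S.finsum_cong')
    fix g assume g: "g \<in> carrier G"
    have "\<rho> g (\<Oplus>\<^bsub>S\<^esub>j\<in>J. a j \<odot>\<^bsub>S\<^esub> s j) = (\<Oplus>\<^bsub>S\<^esub>j\<in>J. \<rho> g (a j \<odot>\<^bsub>S\<^esub> s j))"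
      using a' by (intro act_finsum g) auto
    also have "\<dots> = (\<Oplus>\<^bsub>S\<^esub>j\<in>J. a j \<odot>\<^bsub>S\<^esub> \<rho> g (s j))"
      using a' g by (intro S.finsum_cong') (auto simp: act_smult)
    finally show "c (inv\<^bsub>G\<^esub> g) \<odot>\<^bsub>S\<^esub> \<rho> g (\<Oplus>\<^bsub>S\<^esub>j\<in>J. a j \<odot>\<^bsub>S\<^esub> s j)
        = (\<Oplus>\<^bsub>S\<^esub>j\<in>J. c (inv\<^bsub>G\<^esub> g) \<odot>\<^bsub>S\<^esub> (a j \<odot>\<^bsub>S\<^esub> \<rho> g (s j)))"
      using a' g c' by (simp add: Mod.finsum_smult_ldistr [OF J] Pi_iff)
  qed (use a' c' in \<open>auto intro!: S.finsum_closed\<close>)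
  also have "\<dots> = (\<Oplus>\<^bsub>S\<^esub>j\<in>J. \<Oplus>\<^bsub>S\<^esub>g\<in>carrier G. c (inv\<^bsub>G\<^esub> g) \<odot>\<^bsub>S\<^esub> (a j \<odot>\<^bsub>S\<^esub> \<rho> g (s j)))"
    using a' c' by (intro S.finsum_swap fin J) auto
  also have "\<dots> = (\<Oplus>\<^bsub>S\<^esub>j\<in>J. a j \<odot>\<^bsub>S\<^esub> twisted_trace c (s j))"
  proof (rule S.finsum_cong')
    fix j assume j: "j \<in> J"
    have "a j \<odot>\<^bsub>S\<^esub> twisted_trace c (s j) = (\<Oplus>\<^bsub>S\<^esub>g\<in>carrier G. a j \<odot>\<^bsub>S\<^esub> (c (inv\<^bsub>G\<^esub> g) \<odot>\<^bsub>S\<^esub> \<rho> g (s j)))"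
      unfolding twisted_trace_def using a' [OF j] c' by (intro Mod.finsum_smult_ldistr fin) auto
    also have "\<dots> = (\<Oplus>\<^bsub>S\<^esub>g\<in>carrier G. c (inv\<^bsub>G\<^esub> g) \<odot>\<^bsub>S\<^esub> (a j \<odot>\<^bsub>S\<^esub> \<rho> g (s j)))"
      using a' [OF j] c' by (intro S.finsum_cong') (auto simp: Mod.smult_assoc1 [symmetric] R.m_comm)
    finally show "(\<Oplus>\<^bsub>S\<^esub>g\<in>carrier G. c (inv\<^bsub>G\<^esub> g) \<odot>\<^bsub>S\<^esub> (a j \<odot>\<^bsub>S\<^esub> \<rho> g (s j))) = a j \<odot>\<^bsub>S\<^esub> twisted_trace c (s j)"
      by simp
  qed (use a' c in auto)
  finally show ?thesis .
qed

text \<open>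
  \<open>S\<close> is the direct sum of the eigenspaces of the powers of one character, which is where the
  two orthogonality relations enter; the unit \<open>u\<close> then gives the basis of powers.
\<close>

lemma free_of_rank_eigen:
  assumes gal: "galois_extension G R S \<rho>" and c: "character c"
    and u: "u \<in> eigenspace c" and v: "v \<in> eigenspace (\<lambda>g. c (inv\<^bsub>G\<^esub> g))" and uv: "u \<otimes>\<^bsub>S\<^esub> v = \<one>\<^bsub>S\<^esub>"
    and comm: "\<And>g h. g \<in> carrier G \<Longrightarrow> h \<in> carrier G \<Longrightarrow> g \<otimes>\<^bsub>G\<^esub> h = h \<otimes>\<^bsub>G\<^esub> g"
    and n: "n \<in> carrier R"
    and orth1: "\<And>g. g \<in> carrier G \<Longrightarrow>
      n \<otimes>\<^bsub>R\<^esub> (\<Oplus>\<^bsub>R\<^esub>m\<in>{..<p::nat}. c (inv\<^bsub>G\<^esub> g) [^]\<^bsub>R\<^esub> m) = (if g = \<one>\<^bsub>G\<^esub> then \<one>\<^bsub>R\<^esub> else \<zero>\<^bsub>R\<^esub>)"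
    and orth2: "\<And>k m. k < p \<Longrightarrow> m < p \<Longrightarrow>
      n \<otimes>\<^bsub>R\<^esub> (\<Oplus>\<^bsub>R\<^esub>g\<in>carrier G. c (inv\<^bsub>G\<^esub> g) [^]\<^bsub>R\<^esub> k \<otimes>\<^bsub>R\<^esub> c g [^]\<^bsub>R\<^esub> m) = (if k = m then \<one>\<^bsub>R\<^esub> else \<zero>\<^bsub>R\<^esub>)"
  shows "free_of_rank R S p"
proof -
  have fin: "finite (carrier G)" using gal by (simp add: galois_extension_def)
  note c' = characterD(1) [OF c]
  let ?c = "\<lambda>m g. c g [^]\<^bsub>R\<^esub> (m::nat)"
  note cm = character_pow [OF c]
  have us: "u \<in> carrier S" and vs: "v \<in> carrier S" using u v by (auto simp: eigenspace_def)
  have um: "u [^]\<^bsub>S\<^esub> m \<in> eigenspace (?c m)" for m :: nat by (rule eigenspace_pow [OF c u])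
  have vm: "v [^]\<^bsub>S\<^esub> m \<in> eigenspace (\<lambda>g. ?c m (inv\<^bsub>G\<^esub> g))" for m :: nat
    by (rule eigenspace_pow [OF character_inverse [OF c comm] v])
  have uvm: "u [^]\<^bsub>S\<^esub> m \<otimes>\<^bsub>S\<^esub> v [^]\<^bsub>S\<^esub> m = \<one>\<^bsub>S\<^esub>" for m :: nat
    using uv us vs by (metis S.nat_pow_distrib S.nat_pow_one)
  note free = eigenspace_free [OF gal cm um vm uvm]
  \<comment> \<open>On a power of \<open>u\<close> the trace only sees its weight, so it multiplies
    that power by a character sum, which \<open>orth2\<close> evaluates.\<close>
  have trace_pow: "n \<odot>\<^bsub>S\<^esub> twisted_trace (?c k) (u [^]\<^bsub>S\<^esub> m) = (if k = m then u [^]\<^bsub>S\<^esub> m else \<zero>\<^bsub>S\<^esub>)"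
    if km: "k < p" "m < p" for k m
  proof -
    have "twisted_trace (?c k) (u [^]\<^bsub>S\<^esub> m)
        = (\<Oplus>\<^bsub>S\<^esub>g\<in>carrier G. (?c k (inv\<^bsub>G\<^esub> g) \<otimes>\<^bsub>R\<^esub> ?c m g) \<odot>\<^bsub>S\<^esub> (u [^]\<^bsub>S\<^esub> m))"
      unfolding twisted_trace_def using um [of m] us c'
      by (intro S.finsum_cong') (auto simp: eigenspace_def Mod.smult_assoc1)
    also have "\<dots> = (\<Oplus>\<^bsub>R\<^esub>g\<in>carrier G. ?c k (inv\<^bsub>G\<^esub> g) \<otimes>\<^bsub>R\<^esub> ?c m g) \<odot>\<^bsub>S\<^esub> (u [^]\<^bsub>S\<^esub> m)"
      using us c' by (intro smult_finsum_left [symmetric]) auto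
    finally have "n \<odot>\<^bsub>S\<^esub> twisted_trace (?c k) (u [^]\<^bsub>S\<^esub> m)
        = (n \<otimes>\<^bsub>R\<^esub> (\<Oplus>\<^bsub>R\<^esub>g\<in>carrier G. ?c k (inv\<^bsub>G\<^esub> g) \<otimes>\<^bsub>R\<^esub> ?c m g)) \<odot>\<^bsub>S\<^esub> (u [^]\<^bsub>S\<^esub> m)"
      using us n c' by (simp add: Mod.smult_assoc1 R.finsum_closed Pi_iff)
    then show ?thesis using orth2 [OF km] us by simp
  qed
  show ?thesis
  proof (rule free_of_rankI [OF Mod.module_axioms, of "\<lambda>m. u [^]\<^bsub>S\<^esub> m"])
    show "(\<lambda>m. u [^]\<^bsub>S\<^esub> m) \<in> {..<p} \<rightarrow> carrier S" using us by simp
    fix s assume s: "s \<in> carrier S"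
    define e where "e m = n \<odot>\<^bsub>S\<^esub> twisted_trace (?c m) s" for m
    have e: "e m \<in> eigenspace (?c m)" for m
      unfolding e_def by (intro eigenspace_smult cm n twisted_trace_eigen fin s)
    then have "\<forall>m. \<exists>a. a \<in> carrier R \<and> e m = a \<odot>\<^bsub>S\<^esub> u [^]\<^bsub>S\<^esub> m" using free(1) by blast
    then obtain a where a: "\<And>m. a m \<in> carrier R" "\<And>m. e m = a m \<odot>\<^bsub>S\<^esub> u [^]\<^bsub>S\<^esub> m" by metis
    \<comment> \<open>The \<open>e m\<close> are the components of \<open>s\<close>. After the sums
      are exchanged, \<open>g(s)\<close> carries the weight \<open>n \<Sum>_m c(g^-1)^m\<close>,
      which by \<open>orth1\<close> is \<open>1\<close> at the identity and \<open>0\<close>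
      elsewhere; so the components add up to \<open>s\<close>.\<close>
    have "(\<Oplus>\<^bsub>S\<^esub>m\<in>{..<p}. e m)
        = n \<odot>\<^bsub>S\<^esub> (\<Oplus>\<^bsub>S\<^esub>m\<in>{..<p}. \<Oplus>\<^bsub>S\<^esub>g\<in>carrier G. ?c m (inv\<^bsub>G\<^esub> g) \<odot>\<^bsub>S\<^esub> \<rho> g s)"
      unfolding e_def twisted_trace_def using n s c'
      by (intro Mod.finsum_smult_ldistr [symmetric]) (auto intro!: S.finsum_closed)
    also have "(\<Oplus>\<^bsub>S\<^esub>m\<in>{..<p}. \<Oplus>\<^bsub>S\<^esub>g\<in>carrier G. ?c m (inv\<^bsub>G\<^esub> g) \<odot>\<^bsub>S\<^esub> \<rho> g s)
        = (\<Oplus>\<^bsub>S\<^esub>g\<in>carrier G. \<Oplus>\<^bsub>S\<^esub>m\<in>{..<p}. ?c m (inv\<^bsub>G\<^esub> g) \<odot>\<^bsub>S\<^esub> \<rho> g s)"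
      using s c' fin by (intro S.finsum_swap) auto
    also have "\<dots> = (\<Oplus>\<^bsub>S\<^esub>g\<in>carrier G. (\<Oplus>\<^bsub>R\<^esub>m\<in>{..<p}. ?c m (inv\<^bsub>G\<^esub> g)) \<odot>\<^bsub>S\<^esub> \<rho> g s)"
      using s c' by (intro S.finsum_cong' smult_finsum_left [symmetric]) (auto intro!: R.finsum_closed)
    also have "n \<odot>\<^bsub>S\<^esub> \<dots> = (\<Oplus>\<^bsub>S\<^esub>g\<in>carrier G. n \<odot>\<^bsub>S\<^esub> ((\<Oplus>\<^bsub>R\<^esub>m\<in>{..<p}. ?c m (inv\<^bsub>G\<^esub> g)) \<odot>\<^bsub>S\<^esub> \<rho> g s))"
      using s c' n fin by (intro Mod.finsum_smult_ldistr) (auto intro!: R.finsum_closed)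
    also have "\<dots> = (\<Oplus>\<^bsub>S\<^esub>g\<in>carrier G. if \<one>\<^bsub>G\<^esub> = g then \<rho> g s else \<zero>\<^bsub>S\<^esub>)"
    proof (rule S.finsum_cong')
      fix g assume g: "g \<in> carrier G"
      have "(\<Oplus>\<^bsub>R\<^esub>m\<in>{..<p}. ?c m (inv\<^bsub>G\<^esub> g)) \<in> carrier R"
        using g c' by (intro R.finsum_closed) auto
      then have "n \<odot>\<^bsub>S\<^esub> ((\<Oplus>\<^bsub>R\<^esub>m\<in>{..<p}. ?c m (inv\<^bsub>G\<^esub> g)) \<odot>\<^bsub>S\<^esub> \<rho> g s)
          = (n \<otimes>\<^bsub>R\<^esub> (\<Oplus>\<^bsub>R\<^esub>m\<in>{..<p}. ?c m (inv\<^bsub>G\<^esub> g))) \<odot>\<^bsub>S\<^esub> \<rho> g s"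
        using g s n by (simp add: Mod.smult_assoc1)
      also have "\<dots> = (if \<one>\<^bsub>G\<^esub> = g then \<rho> g s else \<zero>\<^bsub>S\<^esub>)"
        unfolding orth1 [OF g] using g s by auto
      finally show "n \<odot>\<^bsub>S\<^esub> ((\<Oplus>\<^bsub>R\<^esub>m\<in>{..<p}. ?c m (inv\<^bsub>G\<^esub> g)) \<odot>\<^bsub>S\<^esub> \<rho> g s)
          = (if \<one>\<^bsub>G\<^esub> = g then \<rho> g s else \<zero>\<^bsub>S\<^esub>)" .
    qed (use s in auto)
    also have "\<dots> = s"
      using S.finsum_singleton [OF G.one_closed fin, of "\<lambda>g. \<rho> g s"] s by simp
    finally have "s = (\<Oplus>\<^bsub>S\<^esub>m\<in>{..<p}. a m \<odot>\<^bsub>S\<^esub> u [^]\<^bsub>S\<^esub> m)" by (simp add: a(2))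
    then show "\<exists>a\<in>{..<p} \<rightarrow> carrier R. s = (\<Oplus>\<^bsub>S\<^esub>m\<in>{..<p}. a m \<odot>\<^bsub>S\<^esub> u [^]\<^bsub>S\<^esub> m)"
      using a(1) by blast
  next
    fix a b assume a: "a \<in> {..<p} \<rightarrow> carrier R" and b: "b \<in> {..<p} \<rightarrow> carrier R"
      and ab: "(\<Oplus>\<^bsub>S\<^esub>m\<in>{..<p}. a m \<odot>\<^bsub>S\<^esub> u [^]\<^bsub>S\<^esub> m) = (\<Oplus>\<^bsub>S\<^esub>m\<in>{..<p}. b m \<odot>\<^bsub>S\<^esub> u [^]\<^bsub>S\<^esub> m)"
    \<comment> \<open>The projector for the \<open>k\<close>-th power of \<open>c\<close> isolates
      the \<open>k\<close>-th term. The unit \<open>u^k\<close> is then cancelled to compare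
      coefficients.\<close>
    have coeff: "n \<odot>\<^bsub>S\<^esub> twisted_trace (?c k) (\<Oplus>\<^bsub>S\<^esub>m\<in>{..<p}. a m \<odot>\<^bsub>S\<^esub> u [^]\<^bsub>S\<^esub> m) = a k \<odot>\<^bsub>S\<^esub> u [^]\<^bsub>S\<^esub> k"
      if a: "a \<in> {..<p} \<rightarrow> carrier R" and k: "k < p" for a k
    proof -
      have a': "a m \<in> carrier R" if "m < p" for m using a that by auto
      have tcl: "twisted_trace (?c k) (u [^]\<^bsub>S\<^esub> m) \<in> carrier S" for m :: nat
        using us cm by simp
      have "n \<odot>\<^bsub>S\<^esub> twisted_trace (?c k) (\<Oplus>\<^bsub>S\<^esub>m\<in>{..<p}. a m \<odot>\<^bsub>S\<^esub> u [^]\<^bsub>S\<^esub> m)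
          = n \<odot>\<^bsub>S\<^esub> (\<Oplus>\<^bsub>S\<^esub>m\<in>{..<p}. a m \<odot>\<^bsub>S\<^esub> twisted_trace (?c k) (u [^]\<^bsub>S\<^esub> m))"
        using twisted_trace_linear [OF fin cm _ a, of "\<lambda>m. u [^]\<^bsub>S\<^esub> m" k] us by simp
      also have "\<dots> = (\<Oplus>\<^bsub>S\<^esub>m\<in>{..<p}. n \<odot>\<^bsub>S\<^esub> (a m \<odot>\<^bsub>S\<^esub> twisted_trace (?c k) (u [^]\<^bsub>S\<^esub> m)))"
        using n a' tcl by (intro Mod.finsum_smult_ldistr) auto
      also have "\<dots> = (\<Oplus>\<^bsub>S\<^esub>m\<in>{..<p}. if k = m then a m \<odot>\<^bsub>S\<^esub> u [^]\<^bsub>S\<^esub> m else \<zero>\<^bsub>S\<^esub>)"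
      proof (rule S.finsum_cong')
        fix m assume "m \<in> {..<p}"
        then have m: "m < p" by simp
        have "n \<odot>\<^bsub>S\<^esub> (a m \<odot>\<^bsub>S\<^esub> twisted_trace (?c k) (u [^]\<^bsub>S\<^esub> m))
            = a m \<odot>\<^bsub>S\<^esub> (n \<odot>\<^bsub>S\<^esub> twisted_trace (?c k) (u [^]\<^bsub>S\<^esub> m))"
          using n a' [OF m] tcl by (simp add: Mod.smult_assoc1 [symmetric] R.m_comm)
        then show "n \<odot>\<^bsub>S\<^esub> (a m \<odot>\<^bsub>S\<^esub> twisted_trace (?c k) (u [^]\<^bsub>S\<^esub> m))
            = (if k = m then a m \<odot>\<^bsub>S\<^esub> u [^]\<^bsub>S\<^esub> m else \<zero>\<^bsub>S\<^esub>)"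
          unfolding trace_pow [OF k m] using a' [OF m] by simp
      qed (use a' us in auto)
      also have "\<dots> = a k \<odot>\<^bsub>S\<^esub> u [^]\<^bsub>S\<^esub> k"
        using a' us k by (intro S.finsum_singleton) auto
      finally show ?thesis .
    qed
    show "\<forall>j<p. a j = b j"
    proof (intro allI impI)
      fix k assume k: "k < p"
      have "a k \<odot>\<^bsub>S\<^esub> u [^]\<^bsub>S\<^esub> k = b k \<odot>\<^bsub>S\<^esub> u [^]\<^bsub>S\<^esub> k"
        using coeff [OF a k] coeff [OF b k] ab by simp
      then show "a k = b k" using a b k by (intro free(2) [of _ _ k]) auto
    qed
  qed
qed

end

section \<open>Local rings of points\<close>

definition monomial_eval :: "('v::finite \<Rightarrow> 'k::field) \<Rightarrow> ('v \<Rightarrow>\<^sub>0 nat) \<Rightarrow> 'k" where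
  "monomial_eval v m = (\<Prod>i\<in>UNIV. v i ^ Poly_Mapping.lookup m i)"

lemma monomial_eval_add: "monomial_eval v (a + b) = monomial_eval v a * monomial_eval v b"
  by (simp add: monomial_eval_def lookup_add power_add prod.distrib)

lemma mpol_eval_superset:
  assumes "finite K" "Poly_Mapping.keys f \<subseteq> K"
  shows "mpol_eval f v = (\<Sum>m\<in>K. Poly_Mapping.lookup f m * monomial_eval v m)"
  unfolding mpol_eval_def monomial_eval_def [symmetric]
  using assms by (intro sum.mono_neutral_left) (auto simp: in_keys_iff)

lemma mpol_eval_0 [simp]: "mpol_eval 0 v = 0"
  by (simp add: mpol_eval_def)

lemma mpol_eval_add: "mpol_eval (f + g) v = mpol_eval f v + mpol_eval g v"
proof -
  let ?K = "Poly_Mapping.keys f \<union> Poly_Mapping.keys g"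
  have "mpol_eval (f + g) v = (\<Sum>m\<in>?K. Poly_Mapping.lookup (f + g) m * monomial_eval v m)"
    using Poly_Mapping.keys_add [of f g] by (intro mpol_eval_superset) auto
  also have "\<dots> = mpol_eval f v + mpol_eval g v"
    by (simp add: mpol_eval_superset [of ?K] lookup_add distrib_right sum.distrib)
  finally show ?thesis .
qed

lemma mpol_eval_single: "mpol_eval (Poly_Mapping.single m c) v = c * monomial_eval v m"
  by (simp add: mpol_eval_superset [of "{m}"])

lemma mpol_induct [case_names zero single]:
  assumes "P 0" "\<And>m c f. P f \<Longrightarrow> P (Poly_Mapping.single m c + f)"
  shows "P f"
proof (induction f rule: update_induct)
  case const
  show ?case by (rule assms)
next
  case (update f a b)
  have "Poly_Mapping.update a b f = Poly_Mapping.single a b + f"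
    using update by (intro poly_mapping_eqI) (auto simp: lookup_add lookup_update lookup_single in_keys_iff when_def)
  then show ?case using assms(2) update by simp
qed

lemma mpol_eval_mult: "mpol_eval (f * g) v = mpol_eval f v * mpol_eval g v"
proof (induction f rule: mpol_induct)
  case (single m c f)
  have "mpol_eval (Poly_Mapping.single m c * g) v = c * monomial_eval v m * mpol_eval g v"
    by (induction g rule: mpol_induct)
      (simp_all add: distrib_left mult_single mpol_eval_add mpol_eval_single monomial_eval_add algebra_simps)
  then show ?case using single by (simp add: distrib_right mpol_eval_add mpol_eval_single)
qed simp

lemma mpol_eval_one [simp]: "mpol_eval 1 v = 1"
proof -
  have "mpol_eval (Poly_Mapping.single 0 1) v = 1"
    unfolding mpol_eval_single by (simp add: monomial_eval_def)
  then show ?thesis by simp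
qed

lemma mpol_eval_const: "mpol_eval (Poly_Mapping.single 0 c) v = c"
  unfolding mpol_eval_single by (simp add: monomial_eval_def)

lemma homogeneous_0 [simp]: "homogeneous d 0"
  by (simp add: homogeneous_def)

lemma homogeneous_const: "homogeneous 0 (Poly_Mapping.single 0 c)"
  by (simp add: homogeneous_def)

lemma homogeneous_one: "homogeneous 0 1"
  using homogeneous_const [of 1] by simp

lemma homogeneous_mult:
  assumes "homogeneous d f" "homogeneous e g"
  shows "homogeneous (d + e) (f * g)"
  unfolding homogeneous_def
proof
  fix m assume "m \<in> Poly_Mapping.keys (f * g)"
  then obtain a b where ab: "m = a + b" "a \<in> Poly_Mapping.keys f" "b \<in> Poly_Mapping.keys g"
    using keys_mult [of f g] by blast
  then show "(\<Sum>i\<in>UNIV. Poly_Mapping.lookup m i) = d + e"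
    using assms by (simp add: homogeneous_def lookup_add sum.distrib)
qed

lemma homogeneous_add:
  assumes "homogeneous d f" "homogeneous d g"
  shows "homogeneous d (f + g)"
  using assms Poly_Mapping.keys_add [of f g] by (auto simp: homogeneous_def)

lemma mpol_eval_scale:
  assumes "homogeneous d f"
  shows "mpol_eval f (\<lambda>i. c * v i) = c ^ d * mpol_eval f v"
proof -
  have "mpol_eval f (\<lambda>i. c * v i) = (\<Sum>m\<in>Poly_Mapping.keys f. Poly_Mapping.lookup f m * (c ^ d * monomial_eval v m))"
    unfolding mpol_eval_def
  proof (rule sum.cong)
    fix m assume "m \<in> Poly_Mapping.keys f"
    then have "(\<Sum>i\<in>UNIV. Poly_Mapping.lookup m i) = d" using assms by (simp add: homogeneous_def)
    then show "Poly_Mapping.lookup f m * (\<Prod>i\<in>UNIV. (c * v i) ^ Poly_Mapping.lookup m i)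
        = Poly_Mapping.lookup f m * (c ^ d * monomial_eval v m)"
      by (simp add: monomial_eval_def power_mult_distrib prod.distrib power_sum [symmetric])
  qed simp
  then show ?thesis
    by (simp add: mpol_eval_def monomial_eval_def sum_distrib_left mult_ac)
qed

section \<open>Points and closed sets of projective space\<close>

lemma proj_space_nonempty: "Q \<in> proj_space \<Longrightarrow> Q \<noteq> {}"
  by (force simp: proj_space_def)

lemma proj_space_scale:
  assumes "Q \<in> proj_space" "v \<in> Q" "w \<in> Q"
  shows "\<exists>c. c \<noteq> 0 \<and> w = (\<lambda>i. c * v i)"
proof -
  obtain u a b where ab: "v = (\<lambda>i. a * u i)" "w = (\<lambda>i. b * u i)" "a \<noteq> 0" "b \<noteq> 0"
    using assms by (auto simp: proj_space_def)
  then show ?thesis by (intro exI [of _ "b / a"]) auto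
qed

text \<open>Two coordinate vectors of one point differ by a nonzero scalar, and a homogeneous form
  scales by a power of it.\<close>

lemma mpol_eval_eq_0_iff:
  assumes "Q \<in> proj_space" "v \<in> Q" "w \<in> Q" "homogeneous d f"
  shows "mpol_eval f v = 0 \<longleftrightarrow> mpol_eval f w = 0"
  using proj_space_scale [OF assms(1-3)] mpol_eval_scale [OF assms(4)] by auto

lemma zariski_closed_subset: "zariski_closed Z \<Longrightarrow> Z \<subseteq> proj_space"
  by (auto simp: zariski_closed_def)

lemma zariski_closed_empty: "zariski_closed {}"
  unfolding zariski_closed_def
  by (rule exI [of _ "{1}"]) (use homogeneous_one proj_space_nonempty in fastforce)

lemma zariski_closed_Int:
  assumes "zariski_closed A" "zariski_closed B" shows "zariski_closed (A \<inter> B)"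
proof -
  obtain T U where "\<forall>f\<in>T. \<exists>d. homogeneous d f" "A = {P \<in> proj_space. \<forall>f\<in>T. \<forall>v\<in>P. mpol_eval f v = 0}"
    "\<forall>f\<in>U. \<exists>d. homogeneous d f" "B = {P \<in> proj_space. \<forall>f\<in>U. \<forall>v\<in>P. mpol_eval f v = 0}"
    using assms unfolding zariski_closed_def by auto
  then show ?thesis unfolding zariski_closed_def by (intro exI [of _ "T \<union> U"]) auto
qed

text \<open>The union is cut out by the products of equations. At a point outside both sets the
  witnesses may be nonzero at different coordinate vectors; homogeneity moves them to a common one,
  where the product is nonzero.\<close>

lemma zariski_closed_Un:
  assumes "zariski_closed A" "zariski_closed B" shows "zariski_closed (A \<union> B)"
proof -
  obtain T U where T: "\<forall>f\<in>T. \<exists>d. homogeneous d f" and A: "A = {P \<in> proj_space. \<forall>f\<in>T. \<forall>v\<in>P. mpol_eval f v = 0}"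
    and U: "\<forall>f\<in>U. \<exists>d. homogeneous d f" and B: "B = {P \<in> proj_space. \<forall>f\<in>U. \<forall>v\<in>P. mpol_eval f v = 0}"
    using assms unfolding zariski_closed_def by auto
  let ?V = "{f * g | f g. f \<in> T \<and> g \<in> U}"
  have "A \<union> B = {P \<in> proj_space. \<forall>f\<in>?V. \<forall>v\<in>P. mpol_eval f v = 0}"
  proof (intro equalityI subsetI)
    fix P assume P: "P \<in> {P \<in> proj_space. \<forall>f\<in>?V. \<forall>v\<in>P. mpol_eval f v = 0}"
    show "P \<in> A \<union> B"
    proof (rule ccontr)
      assume "P \<notin> A \<union> B"
      then obtain f v g w where fg: "f \<in> T" "v \<in> P" "mpol_eval f v \<noteq> 0" "g \<in> U" "w \<in> P" "mpol_eval g w \<noteq> 0"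
        using P A B by auto
      then have "mpol_eval g v \<noteq> 0" using U P mpol_eval_eq_0_iff [of P v w _ g] by auto
      then have "mpol_eval (f * g) v \<noteq> 0" using fg by (simp add: mpol_eval_mult)
      then show False using P fg by auto
    qed
  qed (auto simp: A B mpol_eval_mult)
  moreover have "\<forall>f\<in>?V. \<exists>d. homogeneous d f" using T U homogeneous_mult by fast
  ultimately show ?thesis unfolding zariski_closed_def by blast
qed

lemma zariski_closed_zeros: "homogeneous d h \<Longrightarrow> zariski_closed {Q \<in> proj_space. \<forall>v\<in>Q. mpol_eval h v = 0}"
  unfolding zariski_closed_def by (intro exI [of _ "{h}"]) auto

section \<open>Regular functions and the local ring at a point\<close>

locale closed_point =
  fixes C :: "('v::finite, 'k::field) point set" and P :: "('v, 'k) point"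
  assumes C_closed: "zariski_closed C" and P_in_C: "P \<in> C"
begin

lemma P_proj: "P \<in> proj_space"
  using zariski_closed_subset [OF C_closed] P_in_C by blast

lemma zariski_nhd_UNIV: "zariski_nhd C P C"
  using P_in_C zariski_closed_empty by (simp add: zariski_nhd_def)

lemma zariski_nhd_Int: "zariski_nhd C P U \<Longrightarrow> zariski_nhd C P V \<Longrightarrow> zariski_nhd C P (U \<inter> V)"
  using zariski_closed_Un [of "C - U" "C - V"] by (auto simp: zariski_nhd_def Diff_Int)

lemma zariski_nhd_nonzero:
  assumes U: "zariski_nhd C P U" and h: "homogeneous d h" and v: "v \<in> P" "mpol_eval h v \<noteq> 0"
  shows "zariski_nhd C P (U - {Q \<in> proj_space. \<forall>v\<in>Q. mpol_eval h v = 0})"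
proof -
  let ?Z = "{Q \<in> proj_space. \<forall>v\<in>Q. mpol_eval h v = 0}"
  have "C - (U - ?Z) = (C - U) \<union> (C \<inter> ?Z)" by blast
  moreover have "zariski_closed (C \<inter> ?Z)"
    by (rule zariski_closed_Int [OF C_closed zariski_closed_zeros [OF h]])
  ultimately show ?thesis
    using U v zariski_closed_Un [of "C - U" "C \<inter> ?Z"] by (auto simp: zariski_nhd_def)
qed

lemma regular_atE:
  assumes "regular_at C P f"
  obtains U d g h where "zariski_nhd C P U" "homogeneous d g" "homogeneous d h"
    "\<And>Q v. Q \<in> U \<Longrightarrow> v \<in> Q \<Longrightarrow> mpol_eval h v \<noteq> 0" "\<And>Q v. Q \<in> U \<Longrightarrow> v \<in> Q \<Longrightarrow> f Q = mpol_eval g v / mpol_eval h v"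
  using assms unfolding regular_at_def by blast

lemma regular_atI:
  assumes "zariski_nhd C P U" "homogeneous d g" "homogeneous d h"
    "\<And>Q v. Q \<in> U \<Longrightarrow> v \<in> Q \<Longrightarrow> mpol_eval h v \<noteq> 0 \<and> f Q = mpol_eval g v / mpol_eval h v"
  shows "regular_at C P f"
  using assms unfolding regular_at_def by blast

lemma regular_at_const: "regular_at C P (\<lambda>_. c)"
  by (rule regular_atI [OF zariski_nhd_UNIV homogeneous_const homogeneous_one]) (simp add: mpol_eval_const)

lemma regular_at_add:
  assumes "regular_at C P f" "regular_at C P f'"
  shows "regular_at C P (\<lambda>Q. f Q + f' Q)"
proof -
  obtain U d g h where 1: "zariski_nhd C P U" "homogeneous d g" "homogeneous d h"
    "\<And>Q v. Q \<in> U \<Longrightarrow> v \<in> Q \<Longrightarrow> mpol_eval h v \<noteq> 0" "\<And>Q v. Q \<in> U \<Longrightarrow> v \<in> Q \<Longrightarrow> f Q = mpol_eval g v / mpol_eval h v"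
    using assms(1) by (rule regular_atE) blast
  obtain U' d' g' h' where 2: "zariski_nhd C P U'" "homogeneous d' g'" "homogeneous d' h'"
    "\<And>Q v. Q \<in> U' \<Longrightarrow> v \<in> Q \<Longrightarrow> mpol_eval h' v \<noteq> 0" "\<And>Q v. Q \<in> U' \<Longrightarrow> v \<in> Q \<Longrightarrow> f' Q = mpol_eval g' v / mpol_eval h' v"
    using assms(2) by (rule regular_atE) blast
  have "homogeneous (d + d') (g * h' + h * g')"
    using 1 2 by (intro homogeneous_add homogeneous_mult)
  moreover have "homogeneous (d + d') (h * h')" using 1 2 by (intro homogeneous_mult)
  moreover have "mpol_eval (h * h') v \<noteq> 0 \<and> f Q + f' Q = mpol_eval (g * h' + h * g') v / mpol_eval (h * h') v"
    if Q: "Q \<in> U \<inter> U'" "v \<in> Q" for Q v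
    using Q 1(4,5) [of Q v] 2(4,5) [of Q v] by (simp add: mpol_eval_mult mpol_eval_add field_simps)
  ultimately show ?thesis by (rule regular_atI [OF zariski_nhd_Int [OF 1(1) 2(1)]])
qed

lemma regular_at_mult:
  assumes "regular_at C P f" "regular_at C P f'"
  shows "regular_at C P (\<lambda>Q. f Q * f' Q)"
proof -
  obtain U d g h where 1: "zariski_nhd C P U" "homogeneous d g" "homogeneous d h"
    "\<And>Q v. Q \<in> U \<Longrightarrow> v \<in> Q \<Longrightarrow> mpol_eval h v \<noteq> 0" "\<And>Q v. Q \<in> U \<Longrightarrow> v \<in> Q \<Longrightarrow> f Q = mpol_eval g v / mpol_eval h v"
    using assms(1) by (rule regular_atE) blast
  obtain U' d' g' h' where 2: "zariski_nhd C P U'" "homogeneous d' g'" "homogeneous d' h'"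
    "\<And>Q v. Q \<in> U' \<Longrightarrow> v \<in> Q \<Longrightarrow> mpol_eval h' v \<noteq> 0" "\<And>Q v. Q \<in> U' \<Longrightarrow> v \<in> Q \<Longrightarrow> f' Q = mpol_eval g' v / mpol_eval h' v"
    using assms(2) by (rule regular_atE) blast
  have "homogeneous (d + d') (g * g')" "homogeneous (d + d') (h * h')" using 1 2 by (intro homogeneous_mult; simp)+
  moreover have "mpol_eval (h * h') v \<noteq> 0 \<and> f Q * f' Q = mpol_eval (g * g') v / mpol_eval (h * h') v"
    if Q: "Q \<in> U \<inter> U'" "v \<in> Q" for Q v
    using Q 1(4,5) [of Q v] 2(4,5) [of Q v] by (simp add: mpol_eval_mult)
  ultimately show ?thesis by (rule regular_atI [OF zariski_nhd_Int [OF 1(1) 2(1)]])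
qed

text \<open>Numerator and denominator change places once the neighbourhood is shrunk by the zeros of
  the numerator. Being outside that set gives one coordinate vector with nonzero value, and
  homogeneity extends this to all of them.\<close>

lemma regular_at_inverse:
  assumes "regular_at C P f" "f P \<noteq> 0"
  obtains U where "zariski_nhd C P U" "\<And>Q. Q \<in> U \<Longrightarrow> f Q \<noteq> 0" "regular_at C P (\<lambda>Q. inverse (f Q))"
proof -
  obtain U d g h where 1: "zariski_nhd C P U" "homogeneous d g" "homogeneous d h"
    "\<And>Q v. Q \<in> U \<Longrightarrow> v \<in> Q \<Longrightarrow> mpol_eval h v \<noteq> 0" "\<And>Q v. Q \<in> U \<Longrightarrow> v \<in> Q \<Longrightarrow> f Q = mpol_eval g v / mpol_eval h v"
    using assms(1) by (rule regular_atE) blast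
  let ?U = "U - {Q \<in> proj_space. \<forall>v\<in>Q. mpol_eval g v = 0}"
  obtain v where v: "v \<in> P" using proj_space_nonempty [OF P_proj] by blast
  have "P \<in> U" using 1(1) by (simp add: zariski_nhd_def)
  then have "mpol_eval g v \<noteq> 0" using 1(5) [of P v] v assms(2) by auto
  then have nhd: "zariski_nhd C P ?U" by (rule zariski_nhd_nonzero [OF 1(1,2) v])
  have sub: "Q \<in> U" "Q \<in> proj_space" if "Q \<in> ?U" for Q
    using that 1(1) zariski_closed_subset [OF C_closed] by (auto simp: zariski_nhd_def)
  have g: "mpol_eval g w \<noteq> 0" if Q: "Q \<in> ?U" and w: "w \<in> Q" for Q w
  proof -
    obtain w' where w': "w' \<in> Q" "mpol_eval g w' \<noteq> 0" using Q sub [OF Q] by blast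
    show ?thesis using mpol_eval_eq_0_iff [OF sub(2) [OF Q] w w'(1) 1(2)] w'(2) by blast
  qed
  have "regular_at C P (\<lambda>Q. inverse (f Q))"
  proof (rule regular_atI [OF nhd 1(3) 1(2)])
    fix Q w assume Q: "Q \<in> ?U" and w: "w \<in> Q"
    show "mpol_eval g w \<noteq> 0 \<and> inverse (f Q) = mpol_eval h w / mpol_eval g w"
      using g [OF Q w] 1(4,5) [OF sub(1) [OF Q] w] by simp
  qed
  moreover have "f Q \<noteq> 0" if Q: "Q \<in> ?U" for Q
  proof -
    obtain w where "w \<in> Q" using proj_space_nonempty [OF sub(2) [OF Q]] by blast
    then show ?thesis using g [OF Q] 1(4,5) [OF sub(1) [OF Q]] by auto
  qed
  ultimately show thesis using that nhd by blast
qed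

abbreviation Reg where "Reg \<equiv> regular_ring C P"
abbreviation N where "N \<equiv> germ_null C P"
abbreviation Ox where "Ox \<equiv> local_ring_at C P"

lemma Reg_simps [simp]:
  "f \<in> carrier Reg \<longleftrightarrow> regular_at C P f" "f \<otimes>\<^bsub>Reg\<^esub> g = (\<lambda>Q. f Q * g Q)" "f \<oplus>\<^bsub>Reg\<^esub> g = (\<lambda>Q. f Q + g Q)"
  "\<one>\<^bsub>Reg\<^esub> = (\<lambda>_. 1)" "\<zero>\<^bsub>Reg\<^esub> = (\<lambda>_. 0)"
  by (simp_all add: regular_ring_def)

lemma Reg_cring: "cring Reg"
proof (rule cringI)
  show "abelian_group Reg"
  proof (rule abelian_groupI)
    show "\<exists>g\<in>carrier Reg. g \<oplus>\<^bsub>Reg\<^esub> f = \<zero>\<^bsub>Reg\<^esub>" if "f \<in> carrier Reg" for f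
      using that regular_at_mult [OF regular_at_const [of "-1"], of f]
      by (intro bexI [of _ "\<lambda>Q. (-1) * f Q"]) auto
  qed (auto simp: regular_at_add regular_at_const algebra_simps)
  show "comm_monoid Reg"
    by (rule comm_monoidI) (auto simp: regular_at_mult regular_at_const algebra_simps)
qed (auto simp: algebra_simps)

sublocale Reg: cring Reg by (rule Reg_cring)

lemma Reg_uminus: "f \<in> carrier Reg \<Longrightarrow> \<ominus>\<^bsub>Reg\<^esub> f = (\<lambda>Q. - f Q)"
  using regular_at_mult [OF regular_at_const [of "-1"], of f]
  by (intro Reg.minus_equality) auto

lemma Reg_minus: "f \<in> carrier Reg \<Longrightarrow> g \<in> carrier Reg \<Longrightarrow> f \<ominus>\<^bsub>Reg\<^esub> g = (\<lambda>Q. f Q - g Q)"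
  using Reg_uminus [of g] by (simp add: a_minus_def)

lemma germ_null_regular: "f \<in> N \<Longrightarrow> regular_at C P f"
  unfolding germ_null_def
  by (auto intro!: regular_atI [OF _ homogeneous_0 homogeneous_one])

lemma germ_null_at_P: "f \<in> N \<Longrightarrow> f P = 0"
  by (auto simp: germ_null_def zariski_nhd_def)

lemma Reg_idealI:
  assumes "J \<subseteq> carrier Reg" "(\<lambda>_. 0) \<in> J" "\<And>f g. f \<in> J \<Longrightarrow> g \<in> J \<Longrightarrow> (\<lambda>Q. f Q + g Q) \<in> J"
    and mult: "\<And>f g. f \<in> carrier Reg \<Longrightarrow> g \<in> J \<Longrightarrow> (\<lambda>Q. f Q * g Q) \<in> J"
  shows "ideal J Reg"
proof (rule idealI)
  show "ring Reg" by (rule Reg.ring_axioms)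
  show "subgroup J (add_monoid Reg)"
  proof (rule group.subgroupI)
    show "group (add_monoid Reg)" by (rule Reg.add.group_axioms)
    show "inv\<^bsub>add_monoid Reg\<^esub> f \<in> J" if "f \<in> J" for f
    proof -
      have "inv\<^bsub>add_monoid Reg\<^esub> f = \<ominus>\<^bsub>Reg\<^esub> f" by (simp only: a_inv_def)
      then have "inv\<^bsub>add_monoid Reg\<^esub> f = (\<lambda>Q. (-1) * f Q)"
        using that assms(1) Reg_uminus [of f] by auto
      then show ?thesis using mult [OF _ that, of "\<lambda>_. -1"] regular_at_const [of "-1"] by simp
    qed
  qed (use assms in auto)
  show "g \<otimes>\<^bsub>Reg\<^esub> f \<in> J" "f \<otimes>\<^bsub>Reg\<^esub> g \<in> J" if "f \<in> J" "g \<in> carrier Reg" for f g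
    using mult [OF that(2,1)] by (simp_all add: mult.commute)
qed

sublocale N: ideal N Reg
proof (rule Reg_idealI)
  show "(\<lambda>_. 0) \<in> N" using zariski_nhd_UNIV by (auto simp: germ_null_def)
  show "(\<lambda>Q. f Q + g Q) \<in> N" if "f \<in> N" "g \<in> N" for f g
    using that zariski_nhd_Int unfolding germ_null_def by fastforce
  show "(\<lambda>Q. f Q * g Q) \<in> N" if "f \<in> carrier Reg" "g \<in> N" for f g
    using that unfolding germ_null_def by auto
qed (auto simp: germ_null_regular)

lemma local_ring_cring: "cring Ox"
  unfolding local_ring_at_def by (rule N.quotient_is_cring [OF Reg_cring])

sublocale Ox: cring Ox by (rule local_ring_cring)

definition germ where "germ f = N +>\<^bsub>Reg\<^esub> f"

lemma germ_hom: "germ \<in> ring_hom Reg Ox"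
  unfolding local_ring_at_def germ_def [abs_def] by (rule N.rcos_ring_hom)

lemma germ_surj: "c \<in> carrier Ox \<Longrightarrow> \<exists>f\<in>carrier Reg. c = germ f"
  by (auto simp: local_ring_at_def germ_def FactRing_def A_RCOSETS_def')

lemma germ_eq_iff:
  "f \<in> carrier Reg \<Longrightarrow> g \<in> carrier Reg \<Longrightarrow> germ f = germ g \<longleftrightarrow> (\<lambda>Q. f Q - g Q) \<in> N"
  using Reg.quotient_eq_iff_same_a_r_cos [OF N.is_ideal, of f g] Reg_minus [of f g] by (simp add: germ_def)

text \<open>A germ has a well-defined value at \<open>P\<close> because \<open>P\<close> lies in
  each of its neighbourhoods; this gives one direction. For the other, the pointwise inverse
  satisfies its equation near \<open>P\<close>, which is all that germs see.\<close>

lemma germ_Units_iff: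
  assumes f: "f \<in> carrier Reg"
  shows "germ f \<in> Units Ox \<longleftrightarrow> f P \<noteq> 0"
proof
  assume "germ f \<in> Units Ox"
  then obtain c where c: "c \<in> carrier Ox" "c \<otimes>\<^bsub>Ox\<^esub> germ f = \<one>\<^bsub>Ox\<^esub>" by (auto simp: Units_def)
  then obtain g where g: "g \<in> carrier Reg" "c = germ g" using germ_surj by blast
  have "germ (\<lambda>Q. g Q * f Q) = germ (\<lambda>_. 1)"
    using c g f ring_hom_mult [OF germ_hom, of g f] ring_hom_one [OF germ_hom] by simp
  then have "(\<lambda>Q. g Q * f Q - 1) \<in> N"
    using germ_eq_iff [of "\<lambda>Q. g Q * f Q" "\<lambda>_. 1"] f g by (simp add: regular_at_mult regular_at_const)
  then have "g P * f P - 1 = 0" by (rule germ_null_at_P)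
  then show "f P \<noteq> 0" by auto
next
  assume "f P \<noteq> 0"
  then obtain U where U: "zariski_nhd C P U" "\<And>Q. Q \<in> U \<Longrightarrow> f Q \<noteq> 0" "regular_at C P (\<lambda>Q. inverse (f Q))"
    using f regular_at_inverse [of f] by auto
  let ?g = "\<lambda>Q. inverse (f Q)"
  have "(\<lambda>Q. ?g Q * f Q - 1) \<in> N" using U(1,2) by (auto simp: germ_null_def)
  then have "germ (\<lambda>Q. ?g Q * f Q) = germ (\<lambda>_. 1)"
    using f U(3) germ_eq_iff [of "\<lambda>Q. ?g Q * f Q" "\<lambda>_. 1"] by (simp add: regular_at_mult regular_at_const)
  then have "germ ?g \<otimes>\<^bsub>Ox\<^esub> germ f = \<one>\<^bsub>Ox\<^esub>"
    using f U(3) ring_hom_mult [OF germ_hom, of ?g f] ring_hom_one [OF germ_hom] by simp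
  moreover have "germ ?g \<in> carrier Ox" "germ f \<in> carrier Ox"
    using f U(3) ring_hom_closed [OF germ_hom] by auto
  ultimately show "germ f \<in> Units Ox"
    using Ox.m_comm [of "germ ?g" "germ f"] unfolding Units_def by auto
qed

text \<open>By the unit criterion the nonunits are the image of the regular functions vanishing at
  \<open>P\<close>, and the image of an ideal in a quotient is an ideal.\<close>

lemma nonunits_ideal: "ideal (nonunits Ox) Ox"
proof -
  let ?M = "{f \<in> carrier Reg. f P = 0}"
  have M: "ideal ?M Reg"
    by (rule Reg_idealI) (auto simp: regular_at_const regular_at_add regular_at_mult)
  have "nonunits Ox = germ ` ?M"
  proof (intro equalityI subsetI)
    fix c assume c: "c \<in> nonunits Ox"
    then have "c \<in> carrier Ox" by (simp add: nonunits_def)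
    then obtain f where f: "f \<in> carrier Reg" "c = germ f" using germ_surj by blast
    then show "c \<in> germ ` ?M" using c germ_Units_iff [OF f(1)] by (auto simp: nonunits_def)
  qed (use germ_Units_iff ring_hom_closed [OF germ_hom] in \<open>auto simp: nonunits_def\<close>)
  moreover have "ideal (germ ` ?M) Ox"
    unfolding local_ring_at_def germ_def [abs_def]
    by (rule Reg.ring_ideal_imp_quot_ideal [OF N.is_ideal M])
  ultimately show ?thesis by simp
qed

lemma local_ring_const_eq: "local_ring_const C P c = germ (\<lambda>_. c)"
  by (simp add: local_ring_const_def germ_def)

lemma local_ring_const_closed: "local_ring_const C P c \<in> carrier Ox"
  unfolding local_ring_const_eq using ring_hom_closed [OF germ_hom] regular_at_const by simp

lemma local_ring_const_add:
  "local_ring_const C P (c + d) = local_ring_const C P c \<oplus>\<^bsub>Ox\<^esub> local_ring_const C P d"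
  unfolding local_ring_const_eq
  using ring_hom_add [OF germ_hom, of "\<lambda>_. c" "\<lambda>_. d"] regular_at_const by simp

lemma local_ring_const_mult:
  "local_ring_const C P (c * d) = local_ring_const C P c \<otimes>\<^bsub>Ox\<^esub> local_ring_const C P d"
  unfolding local_ring_const_eq
  using ring_hom_mult [OF germ_hom, of "\<lambda>_. c" "\<lambda>_. d"] regular_at_const by simp

lemma local_ring_const_one: "local_ring_const C P 1 = \<one>\<^bsub>Ox\<^esub>"
  unfolding local_ring_const_eq using ring_hom_one [OF germ_hom] by simp

lemma one_not_nonunit: "\<one>\<^bsub>Ox\<^esub> \<notin> nonunits Ox"
  by (simp add: nonunits_def)

end

section \<open>Adic completions of local rings\<close>

locale completed_ring =
  fixes R :: "'a ring" and m :: "'a set"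
  assumes R_cring: "cring R" and m_ideal: "ideal m R"
begin

sublocale R: cring R by (rule R_cring)

abbreviation J where "J n \<equiv> ideal_pow R m n"
abbreviation Q where "Q n \<equiv> R Quot J n"
abbreviation A where "A \<equiv> adic_completion R m"

lemma J_0: "J 0 = carrier R"
  by (simp add: ideal_pow_def ideals_set_def)

lemma J_Suc: "J (Suc n) = ideal_prod R (J n) m"
  by (simp add: ideal_pow_def ideals_set_def nat_pow_def)

lemma J_ideal: "ideal (J n) R"
  by (induction n) (simp_all add: J_0 J_Suc R.oneideal R.ideal_prod_is_ideal m_ideal)

lemma J_Suc_subset: "J (Suc n) \<subseteq> J n"
  using R.ideal_prod_inter [OF J_ideal m_ideal] by (auto simp: J_Suc)

lemma J_1: "J (Suc 0) = m"
  using R.ideal_prod_one [OF m_ideal] R.ideal_prod_commute [OF m_ideal R.oneideal]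
  by (simp add: J_Suc J_0)

lemma J_subset: "n > 0 \<Longrightarrow> J n \<subseteq> m"
proof (induction n)
  case (Suc n)
  then show ?case using J_1 J_Suc_subset [of n] by (cases n) auto
qed simp

lemma Q_cring: "cring (Q n)"
  by (rule ideal.quotient_is_cring [OF J_ideal R_cring])

definition pr where "pr n r = J n +>\<^bsub>R\<^esub> r"

lemma pr_hom: "pr n \<in> ring_hom R (Q n)"
  unfolding pr_def [abs_def] by (rule ideal.rcos_ring_hom [OF J_ideal])

lemmas pr_closed = ring_hom_closed [OF pr_hom]
  and pr_mult = ring_hom_mult [OF pr_hom]
  and pr_add = ring_hom_add [OF pr_hom]
  and pr_one = ring_hom_one [OF pr_hom]

lemma pr_ring_hom_cring: "ring_hom_cring R (Q n) (pr n)"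
  using R_cring Q_cring pr_hom by (simp add: ring_hom_cring_def ring_hom_cring_axioms_def)

lemma pr_eq_iff: "r \<in> carrier R \<Longrightarrow> s \<in> carrier R \<Longrightarrow> pr n r = pr n s \<longleftrightarrow> r \<ominus>\<^bsub>R\<^esub> s \<in> J n"
  using R.quotient_eq_iff_same_a_r_cos [OF J_ideal] by (simp add: pr_def)

lemma Q_carrier: "carrier (Q n) = pr n ` carrier R"
  by (auto simp: pr_def FactRing_def A_RCOSETS_def')

text \<open>As the powers decrease, a coset of \<open>J (Suc n)\<close> lies in exactly one coset of
  \<open>J n\<close>. Containment therefore encodes compatibility of the projections.\<close>

lemma pr_subset_iff:
  assumes "r \<in> carrier R" "s \<in> carrier R"
  shows "pr (Suc n) r \<subseteq> pr n s \<longleftrightarrow> pr n r = pr n s"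
proof
  interpret J: ideal "J n" R by (rule J_ideal)
  interpret J': ideal "J (Suc n)" R by (rule J_ideal)
  have self: "r \<in> pr (Suc n) r" using assms J'.a_rcos_self by (simp add: pr_def)
  show "pr (Suc n) r \<subseteq> pr n s \<Longrightarrow> pr n r = pr n s"
    using self assms J.a_repr_independence' [of r s] by (auto simp: pr_def)
  assume "pr n r = pr n s"
  moreover have "pr (Suc n) r \<subseteq> pr n r"
    using J_Suc_subset [of n] by (auto simp: pr_def a_r_coset_def')
  ultimately show "pr (Suc n) r \<subseteq> pr n s" by simp
qed

text \<open>Compatible sequences of representatives; through them the operations of the inverse
  limit are computed in \<open>R\<close>.\<close>

definition coherent where
  "coherent r \<longleftrightarrow> (\<forall>n. r n \<in> carrier R \<and> pr n (r (Suc n)) = pr n (r n))"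

lemma A_carrier: "carrier A = {\<lambda>n. pr n (r n) | r. coherent r}"
proof (intro equalityI subsetI)
  fix a assume a: "a \<in> carrier A"
  then have "a n \<in> pr n ` carrier R" for n by (simp add: adic_completion_def Q_carrier)
  then have "\<forall>n. \<exists>r. r \<in> carrier R \<and> a n = pr n r" by blast
  then obtain r where r: "\<And>n. r n \<in> carrier R" "\<And>n. a n = pr n (r n)" by metis
  have "coherent r"
    using a r pr_subset_iff by (auto simp: coherent_def adic_completion_def)
  moreover have "a = (\<lambda>n. pr n (r n))" using r(2) by blast
  ultimately show "a \<in> {\<lambda>n. pr n (r n) | r. coherent r}" by blast
next
  fix a assume "a \<in> {\<lambda>n. pr n (r n) | r. coherent r}"
  then obtain r where r: "a = (\<lambda>n. pr n (r n))" "\<And>n. r n \<in> carrier R"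
    "\<And>n. pr n (r (Suc n)) = pr n (r n)" by (auto simp: coherent_def)
  then have "a (Suc n) \<subseteq> a n" for n using pr_subset_iff [of "r (Suc n)" "r n" n] by simp
  then show "a \<in> carrier A" using r by (simp add: adic_completion_def Q_carrier)
qed

lemma A_mult: "a \<otimes>\<^bsub>A\<^esub> b = (\<lambda>n. a n \<otimes>\<^bsub>Q n\<^esub> b n)"
  and A_add: "a \<oplus>\<^bsub>A\<^esub> b = (\<lambda>n. a n \<oplus>\<^bsub>Q n\<^esub> b n)"
  and A_one: "\<one>\<^bsub>A\<^esub> = (\<lambda>n. \<one>\<^bsub>Q n\<^esub>)"
  and A_zero: "\<zero>\<^bsub>A\<^esub> = (\<lambda>n. \<zero>\<^bsub>Q n\<^esub>)"
  by (simp_all add: adic_completion_def)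

lemma A_component: "a \<in> carrier A \<Longrightarrow> a n \<in> carrier (Q n)"
  by (simp add: adic_completion_def)

lemma coherent_add: "coherent r \<Longrightarrow> coherent s \<Longrightarrow> coherent (\<lambda>n. r n \<oplus>\<^bsub>R\<^esub> s n)"
  by (simp add: coherent_def pr_add)

lemma coherent_mult: "coherent r \<Longrightarrow> coherent s \<Longrightarrow> coherent (\<lambda>n. r n \<otimes>\<^bsub>R\<^esub> s n)"
  by (simp add: coherent_def pr_mult)

lemma coherent_const: "r \<in> carrier R \<Longrightarrow> coherent (\<lambda>_. r)"
  by (simp add: coherent_def)

lemma A_memI: "coherent r \<Longrightarrow> (\<lambda>n. pr n (r n)) \<in> carrier A"
  by (auto simp: A_carrier)

lemma A_add_rep: "coherent r \<Longrightarrow> coherent s \<Longrightarrow>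
    (\<lambda>n. pr n (r n)) \<oplus>\<^bsub>A\<^esub> (\<lambda>n. pr n (s n)) = (\<lambda>n. pr n (r n \<oplus>\<^bsub>R\<^esub> s n))"
  by (simp add: A_add coherent_def pr_add)

lemma A_mult_rep: "coherent r \<Longrightarrow> coherent s \<Longrightarrow>
    (\<lambda>n. pr n (r n)) \<otimes>\<^bsub>A\<^esub> (\<lambda>n. pr n (s n)) = (\<lambda>n. pr n (r n \<otimes>\<^bsub>R\<^esub> s n))"
  by (simp add: A_mult coherent_def pr_mult)

lemma A_one_rep: "\<one>\<^bsub>A\<^esub> = (\<lambda>n. pr n \<one>\<^bsub>R\<^esub>)"
  by (simp add: A_one pr_one)

lemma A_zero_rep: "\<zero>\<^bsub>A\<^esub> = (\<lambda>n. pr n \<zero>\<^bsub>R\<^esub>)"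
  by (simp add: A_zero ring_hom_cring.hom_zero [OF pr_ring_hom_cring])

lemma A_cring: "cring A"
proof (rule cringI)
  have add: "a \<oplus>\<^bsub>A\<^esub> b \<in> carrier A" and mult: "a \<otimes>\<^bsub>A\<^esub> b \<in> carrier A"
    if "a \<in> carrier A" "b \<in> carrier A" for a b
    using that coherent_add coherent_mult A_memI by (auto simp: A_carrier A_add_rep A_mult_rep)
  have zero: "\<zero>\<^bsub>A\<^esub> \<in> carrier A" and one: "\<one>\<^bsub>A\<^esub> \<in> carrier A"
    using A_memI coherent_const by (auto simp: A_zero_rep A_one_rep)
  show "abelian_group A"
  proof (rule abelian_groupI)
    show "\<exists>b\<in>carrier A. b \<oplus>\<^bsub>A\<^esub> a = \<zero>\<^bsub>A\<^esub>" if a: "a \<in> carrier A" for a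
    proof -
      obtain r where r: "a = (\<lambda>n. pr n (r n))" "coherent r" using a by (auto simp: A_carrier)
      have s: "coherent (\<lambda>n. \<ominus>\<^bsub>R\<^esub> r n)"
        using r(2) ring_hom_cring.hom_a_inv [OF pr_ring_hom_cring] by (simp add: coherent_def)
      have "(\<lambda>n. pr n (\<ominus>\<^bsub>R\<^esub> r n)) \<oplus>\<^bsub>A\<^esub> a = \<zero>\<^bsub>A\<^esub>"
        unfolding r(1) A_add_rep [OF s r(2)] A_zero_rep using r(2) by (simp add: coherent_def R.l_neg)
      then show ?thesis using A_memI [OF s] by blast
    qed
  qed (use add zero in \<open>auto simp: A_add A_zero A_component cring.cring_simprules [OF Q_cring] fun_eq_iff
      intro: cring.cring_simprules(10) [OF Q_cring]\<close>)
  show "comm_monoid A"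
  proof (rule comm_monoidI)
    show "\<one>\<^bsub>A\<^esub> \<otimes>\<^bsub>A\<^esub> a = a" if "a \<in> carrier A" for a
      using that cring.cring_simprules(12) [OF Q_cring] by (simp add: A_mult A_one A_component)
    show "a \<otimes>\<^bsub>A\<^esub> b = b \<otimes>\<^bsub>A\<^esub> a" if "a \<in> carrier A" "b \<in> carrier A" for a b
      using that cring.cring_simprules(14) [OF Q_cring] by (simp add: A_mult A_component)
    show "(a \<otimes>\<^bsub>A\<^esub> b) \<otimes>\<^bsub>A\<^esub> c = a \<otimes>\<^bsub>A\<^esub> (b \<otimes>\<^bsub>A\<^esub> c)" if "a \<in> carrier A" "b \<in> carrier A" "c \<in> carrier A" for a b c
      using that cring.cring_simprules(11) [OF Q_cring] by (simp add: A_mult A_component)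
  qed (use mult one in auto)
qed (auto simp: A_mult A_add A_component cring.cring_simprules [OF Q_cring])

sublocale A: cring A by (rule A_cring)

definition const where "const r = (\<lambda>n. pr n r)"

lemma const_hom: "const \<in> ring_hom R A"
  by (rule ring_hom_memI)
    (auto simp: const_def A_add A_mult A_one pr_add pr_mult pr_one intro!: A_memI coherent_const)

lemma A_finsum_component:
  assumes "f \<in> I \<rightarrow> carrier A"
  shows "(\<Oplus>\<^bsub>A\<^esub>i\<in>I. f i) n = (\<Oplus>\<^bsub>Q n\<^esub>i\<in>I. f i n)"
proof -
  have "(\<lambda>a. a n) \<in> ring_hom A (Q n)"
    by (rule ring_hom_memI) (simp_all add: A_component A_mult A_add A_one)
  then interpret h: ring_hom_cring A "Q n" "\<lambda>a. a n"
    using A_cring Q_cring by (simp add: ring_hom_cring_def ring_hom_cring_axioms_def)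
  show ?thesis using h.hom_finsum [OF assms] by (simp add: comp_def)
qed

end

section \<open>The completion of a local ring is local\<close>

locale completed_local = completed_ring R m for R :: "'a ring" and m +
  assumes m_nonunits: "m = nonunits R" and one_notin: "\<one>\<^bsub>R\<^esub> \<notin> m"
begin

lemma Q1_nontrivial: "\<one>\<^bsub>Q (Suc 0)\<^esub> \<noteq> \<zero>\<^bsub>Q (Suc 0)\<^esub>"
proof
  assume "\<one>\<^bsub>Q (Suc 0)\<^esub> = \<zero>\<^bsub>Q (Suc 0)\<^esub>"
  then have "pr (Suc 0) \<one>\<^bsub>R\<^esub> = pr (Suc 0) \<zero>\<^bsub>R\<^esub>"
    by (simp add: pr_one ring_hom_cring.hom_zero [OF pr_ring_hom_cring])
  then have "\<one>\<^bsub>R\<^esub> \<ominus>\<^bsub>R\<^esub> \<zero>\<^bsub>R\<^esub> \<in> m" using pr_eq_iff J_1 by simp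
  then show False using one_notin by (simp add: a_minus_def)
qed

lemma A_nontrivial: "\<one>\<^bsub>A\<^esub> \<noteq> \<zero>\<^bsub>A\<^esub>"
  using Q1_nontrivial by (auto simp: A_one A_zero fun_eq_iff)

text \<open>Consecutive representatives agree modulo \<open>m\<close> from index
  \<open>Suc 0\<close> on, so a nonzero residue keeps all of them outside \<open>m\<close>, where
  every element is a unit. They are inverted termwise, and uniqueness of inverses in the quotients
  makes the result compatible.\<close>

lemma A_unitI:
  assumes a: "a \<in> carrier A" and ne: "a (Suc 0) \<noteq> \<zero>\<^bsub>Q (Suc 0)\<^esub>"
  shows "a \<in> Units A"
proof -
  obtain r where r: "a = (\<lambda>n. pr n (r n))" "coherent r" using a by (auto simp: A_carrier)
  have rc: "r n \<in> carrier R" for n using r(2) by (simp add: coherent_def)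
  have step: "r (Suc n) \<ominus>\<^bsub>R\<^esub> r n \<in> J n" for n
    using r(2) pr_eq_iff rc by (simp add: coherent_def)
  interpret m: ideal m R by (rule m_ideal)
  have "pr (Suc 0) (r (Suc 0)) \<noteq> pr (Suc 0) \<zero>\<^bsub>R\<^esub>"
    using ne r(1) ring_hom_cring.hom_zero [OF pr_ring_hom_cring] by simp
  then have r1: "r (Suc 0) \<notin> m" using pr_eq_iff [of "r (Suc 0)" "\<zero>\<^bsub>R\<^esub>"] rc by (simp add: J_1 a_minus_def)
  have unit: "r (Suc n) \<in> Units R" for n
  proof -
    have "r (Suc n) \<notin> m"
    proof (induction n)
      case (Suc n)
      have "r (Suc (Suc n)) \<ominus>\<^bsub>R\<^esub> r (Suc n) \<in> m" using step [of "Suc n"] J_subset [of "Suc n"] by blast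
      moreover have "r (Suc n) = r (Suc (Suc n)) \<oplus>\<^bsub>R\<^esub> \<ominus>\<^bsub>R\<^esub> (r (Suc (Suc n)) \<ominus>\<^bsub>R\<^esub> r (Suc n))"
        using rc by (simp add: a_minus_def R.minus_add R.a_assoc [symmetric] R.r_neg)
      ultimately show ?case using Suc m.a_closed m.a_inv_closed by metis
    qed (rule r1)
    then show ?thesis using rc m_nonunits by (simp add: nonunits_def)
  qed
  \<comment> \<open>The shift is needed because \<open>r 0\<close> is arbitrary, \<open>J 0\<close>
    being the whole ring; from index \<open>Suc 0\<close> on the terms are units.\<close>
  define s where "s n = inv\<^bsub>R\<^esub> (r (Suc n))" for n
  have sc: "s n \<in> carrier R" and sr: "s n \<otimes>\<^bsub>R\<^esub> r (Suc n) = \<one>\<^bsub>R\<^esub>" for n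
    using unit by (simp_all add: s_def)
  have inv: "pr n (s n) \<otimes>\<^bsub>Q n\<^esub> pr n (r n) = \<one>\<^bsub>Q n\<^esub>" for n
  proof -
    have "pr n (r n) = pr n (r (Suc n))" using r(2) by (simp add: coherent_def)
    then show ?thesis using pr_mult [of "s n" "r (Suc n)" n] sc rc sr by (simp add: pr_one)
  qed
  have "pr n (s (Suc n)) = pr n (s n)" for n
  proof -
    interpret Q: cring "Q n" by (rule Q_cring)
    have "pr n (r (Suc (Suc n))) = pr n (r n)"
      using pr_eq_iff rc step [of "Suc n"] J_Suc_subset [of n] r(2) by (metis coherent_def subsetD)
    then have "pr n (s (Suc n)) \<otimes>\<^bsub>Q n\<^esub> pr n (r n) = \<one>\<^bsub>Q n\<^esub>"
      using pr_mult [of "s (Suc n)" "r (Suc (Suc n))" n] sc rc sr [of "Suc n"] by (simp add: pr_one)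
    then show ?thesis using inv [of n] sc rc pr_closed Q.inv_unique' Q.m_comm by metis
  qed
  then have s: "coherent s" using sc by (simp add: coherent_def)
  have "(\<lambda>n. pr n (s n)) \<otimes>\<^bsub>A\<^esub> a = \<one>\<^bsub>A\<^esub>"
    using inv r(1) by (simp add: A_mult A_one)
  then show ?thesis
    using A_memI [OF s] a A.m_comm [of "\<lambda>n. pr n (s n)" a] unfolding Units_def by auto
qed

text \<open>Nonunits have residue zero by the preceding criterion, and residues zero cannot add up
  to the residue of \<open>1\<close>.\<close>

lemma A_local:
  assumes "f \<in> I \<rightarrow> carrier A" "(\<Oplus>\<^bsub>A\<^esub>i\<in>I. f i) = \<one>\<^bsub>A\<^esub>"
  shows "\<exists>i\<in>I. f i \<in> Units A"
proof (rule ccontr)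
  interpret Q: cring "Q (Suc 0)" by (rule Q_cring)
  assume "\<not> ?thesis"
  then have "f i (Suc 0) = \<zero>\<^bsub>Q (Suc 0)\<^esub>" if "i \<in> I" for i using assms(1) A_unitI that by blast
  then have "(\<Oplus>\<^bsub>Q (Suc 0)\<^esub>i\<in>I. f i (Suc 0)) = \<zero>\<^bsub>Q (Suc 0)\<^esub>"
    by (subst Q.finsum_cong' [OF refl, of "\<lambda>_. \<zero>\<^bsub>Q (Suc 0)\<^esub>"]) auto
  then have "\<one>\<^bsub>A\<^esub> (Suc 0) = \<zero>\<^bsub>Q (Suc 0)\<^esub>" using A_finsum_component [OF assms(1)] assms(2) by simp
  then show False using Q1_nontrivial by (simp add: A_one)
qed

end

section \<open>Fraction fields\<close>

lemma fraction_field_simps: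
  "carrier (fraction_field R) = {frac R a b | a b. a \<in> carrier R \<and> b \<in> carrier R - {\<zero>\<^bsub>R\<^esub>}}"
  "x \<otimes>\<^bsub>fraction_field R\<^esub> y = (\<Union>(a, b)\<in>x. \<Union>(c, d)\<in>y. frac R (a \<otimes>\<^bsub>R\<^esub> c) (b \<otimes>\<^bsub>R\<^esub> d))"
  "x \<oplus>\<^bsub>fraction_field R\<^esub> y = (\<Union>(a, b)\<in>x. \<Union>(c, d)\<in>y. frac R (a \<otimes>\<^bsub>R\<^esub> d \<oplus>\<^bsub>R\<^esub> c \<otimes>\<^bsub>R\<^esub> b) (b \<otimes>\<^bsub>R\<^esub> d))"
  "\<one>\<^bsub>fraction_field R\<^esub> = frac R \<one>\<^bsub>R\<^esub> \<one>\<^bsub>R\<^esub>"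
  "\<zero>\<^bsub>fraction_field R\<^esub> = frac R \<zero>\<^bsub>R\<^esub> \<one>\<^bsub>R\<^esub>"
  by (simp_all add: fraction_field_def)

lemma frac_mem_iff: "(c, d) \<in> frac R a b \<longleftrightarrow>
    c \<in> carrier R \<and> d \<in> carrier R \<and> d \<noteq> \<zero>\<^bsub>R\<^esub> \<and> a \<otimes>\<^bsub>R\<^esub> d = c \<otimes>\<^bsub>R\<^esub> b"
  by (auto simp: frac_def)

text \<open>
  If \<open>b d = 0\<close> with \<open>b, d \<noteq> 0\<close>, then whether \<open>(f, g)\<close> lies in the product of \<open>1/b\<close> and \<open>1/d\<close> does not
  depend on \<open>f\<close>, which is impossible for a fraction.
\<close>

lemma (in cring) domain_if_fraction_field_closed:
  assumes nontriv: "\<one> \<noteq> \<zero>"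
    and closed: "\<And>x y. \<lbrakk>x \<in> carrier (fraction_field R); y \<in> carrier (fraction_field R)\<rbrakk>
      \<Longrightarrow> x \<otimes>\<^bsub>fraction_field R\<^esub> y \<in> carrier (fraction_field R)"
  shows "domain R"
proof (rule domainI)
  fix b d assume bd: "b \<otimes> d = \<zero>" "b \<in> carrier R" "d \<in> carrier R"
  show "b = \<zero> \<or> d = \<zero>"
  proof (rule ccontr)
    assume "\<not> (b = \<zero> \<or> d = \<zero>)"
    then have ne: "b \<noteq> \<zero>" "d \<noteq> \<zero>" by auto
    have "frac R \<one> b \<otimes>\<^bsub>fraction_field R\<^esub> frac R \<one> d \<in> carrier (fraction_field R)"
      using bd ne by (intro closed) (auto simp: fraction_field_simps)
    then obtain e f where ef: "e \<in> carrier R" "f \<in> carrier R" "f \<noteq> \<zero>"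
      and prod: "frac R \<one> b \<otimes>\<^bsub>fraction_field R\<^esub> frac R \<one> d = frac R e f"
      by (auto simp: fraction_field_simps(1))
    have "(e, f) \<in> frac R e f" using ef by (simp add: frac_mem_iff)
    then obtain a b' c d' where ab: "(a, b') \<in> frac R \<one> b" "(c, d') \<in> frac R \<one> d"
      and mem: "(e, f) \<in> frac R (a \<otimes> c) (b' \<otimes> d')"
      unfolding prod [symmetric] fraction_field_simps by blast
    have cl: "a \<in> carrier R" "c \<in> carrier R" and b': "b' = a \<otimes> b" and d': "d' = c \<otimes> d"
      using ab bd by (auto simp: frac_mem_iff)
    have "b' \<otimes> d' = (a \<otimes> c) \<otimes> (b \<otimes> d)" unfolding b' d' using cl bd by (simp add: m_ac)
    then have zero: "b' \<otimes> d' = \<zero>" using cl bd by simp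
    then have "(a \<otimes> c) \<otimes> f = \<zero>" using mem ef by (simp add: frac_mem_iff)
    then have "(e \<oplus> \<one>, f) \<in> frac R (a \<otimes> c) (b' \<otimes> d')" using zero ef by (simp add: frac_mem_iff)
    then have "(e \<oplus> \<one>, f) \<in> frac R e f"
      unfolding prod [symmetric] fraction_field_simps using ab by blast
    then have "e \<otimes> f = e \<otimes> f \<oplus> f" using ef by (simp add: frac_mem_iff l_distr)
    then show False using ef by (simp add: add.l_cancel_one')
  qed
qed (rule cring_axioms nontriv)+

section \<open>Arithmetic of fractions over a domain\<close>

context "domain"
begin

abbreviation FF where "FF \<equiv> fraction_field R"

lemma frac_closed: "a \<in> carrier R \<Longrightarrow> b \<in> carrier R \<Longrightarrow> b \<noteq> \<zero> \<Longrightarrow> frac R a b \<in> carrier FF"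
  by (auto simp: fraction_field_simps)

text \<open>Equality by cross-multiplication is transitive because the common denominator can be
  cancelled; \<open>imp\<close> is one inclusion and is used in both directions.\<close>

lemma frac_eqI:
  assumes "a \<in> carrier R" "b \<in> carrier R" "b \<noteq> \<zero>" "c \<in> carrier R" "d \<in> carrier R" "d \<noteq> \<zero>"
    "a \<otimes> d = c \<otimes> b"
  shows "frac R a b = frac R c d"
proof -
  have imp: "c \<otimes> f = e \<otimes> d"
    if *: "a \<in> carrier R" "b \<in> carrier R" "b \<noteq> \<zero>" "c \<in> carrier R" "d \<in> carrier R"
      "a \<otimes> d = c \<otimes> b" "e \<in> carrier R" "f \<in> carrier R" "a \<otimes> f = e \<otimes> b" for a b c d e f
  proof -
    have "b \<otimes> (c \<otimes> f) = (c \<otimes> b) \<otimes> f" using * by (simp add: m_ac)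
    also have "\<dots> = (a \<otimes> d) \<otimes> f" using *(6) by simp
    also have "\<dots> = d \<otimes> (a \<otimes> f)" using *(1-5,7,8) by (simp add: m_ac)
    also have "\<dots> = d \<otimes> (e \<otimes> b)" using *(9) by simp
    also have "\<dots> = b \<otimes> (e \<otimes> d)" using *(1-5,7,8) by (simp add: m_ac)
    finally show ?thesis using * by (simp add: m_lcancel)
  qed
  show ?thesis
    unfolding frac_def using imp [of a b c d] imp [of c d a b] assms(1-6) assms(7) assms(7) [symmetric] by blast
qed

lemma frac_eqD:
  assumes "c \<in> carrier R" "d \<in> carrier R" "d \<noteq> \<zero>" "frac R a b = frac R c d"
  shows "a \<otimes> d = c \<otimes> b"
proof -
  have "(c, d) \<in> frac R a b" unfolding assms(4) using assms(1-3) by (simp add: frac_mem_iff)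
  then show ?thesis by (simp add: frac_mem_iff)
qed

text \<open>The product is a union over all representatives. Its members coincide by
  cross-multiplication and there is at least one, so the union collapses to a single
  fraction.\<close>

lemma frac_mult:
  assumes "a \<in> carrier R" "b \<in> carrier R" "b \<noteq> \<zero>" "c \<in> carrier R" "d \<in> carrier R" "d \<noteq> \<zero>"
  shows "frac R a b \<otimes>\<^bsub>FF\<^esub> frac R c d = frac R (a \<otimes> c) (b \<otimes> d)"
proof -
  have "frac R (a' \<otimes> c') (b' \<otimes> d') = frac R (a \<otimes> c) (b \<otimes> d)"
    if "(a', b') \<in> frac R a b" "(c', d') \<in> frac R c d" for a' b' c' d'
  proof (rule frac_eqI)
    have *: "a' \<in> carrier R" "b' \<in> carrier R" "b' \<noteq> \<zero>" "c' \<in> carrier R" "d' \<in> carrier R" "d' \<noteq> \<zero>"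
      "a \<otimes> b' = a' \<otimes> b" "c \<otimes> d' = c' \<otimes> d" using that by (auto simp: frac_mem_iff)
    have "(a' \<otimes> c') \<otimes> (b \<otimes> d) = (a' \<otimes> b) \<otimes> (c' \<otimes> d)" using * assms by (simp add: m_ac)
    also have "\<dots> = (a \<otimes> b') \<otimes> (c \<otimes> d')" using * by simp
    also have "\<dots> = (a \<otimes> c) \<otimes> (b' \<otimes> d')" using *(1-6) assms by (simp add: m_ac)
    finally show "(a' \<otimes> c') \<otimes> (b \<otimes> d) = (a \<otimes> c) \<otimes> (b' \<otimes> d')" .
    show "b' \<otimes> d' \<noteq> \<zero>" "b \<otimes> d \<noteq> \<zero>" using * assms integral_iff by auto
  qed (use that assms in \<open>auto simp: frac_mem_iff\<close>)
  moreover have "(a, b) \<in> frac R a b" "(c, d) \<in> frac R c d" using assms by (auto simp: frac_mem_iff)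
  ultimately show ?thesis unfolding fraction_field_simps by fast
qed

lemma frac_add:
  assumes "a \<in> carrier R" "b \<in> carrier R" "b \<noteq> \<zero>" "c \<in> carrier R" "d \<in> carrier R" "d \<noteq> \<zero>"
  shows "frac R a b \<oplus>\<^bsub>FF\<^esub> frac R c d = frac R (a \<otimes> d \<oplus> c \<otimes> b) (b \<otimes> d)"
proof -
  have "frac R (a' \<otimes> d' \<oplus> c' \<otimes> b') (b' \<otimes> d') = frac R (a \<otimes> d \<oplus> c \<otimes> b) (b \<otimes> d)"
    if "(a', b') \<in> frac R a b" "(c', d') \<in> frac R c d" for a' b' c' d'
  proof (rule frac_eqI)
    have *: "a' \<in> carrier R" "b' \<in> carrier R" "b' \<noteq> \<zero>" "c' \<in> carrier R" "d' \<in> carrier R" "d' \<noteq> \<zero>"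
      "a \<otimes> b' = a' \<otimes> b" "c \<otimes> d' = c' \<otimes> d" using that by (auto simp: frac_mem_iff)
    have "(a' \<otimes> d' \<oplus> c' \<otimes> b') \<otimes> (b \<otimes> d) = (a' \<otimes> b) \<otimes> (d' \<otimes> d) \<oplus> (c' \<otimes> d) \<otimes> (b' \<otimes> b)"
      using *(1-6) assms by (simp add: m_ac l_distr r_distr)
    also have "\<dots> = (a \<otimes> b') \<otimes> (d' \<otimes> d) \<oplus> (c \<otimes> d') \<otimes> (b' \<otimes> b)" using * by simp
    also have "\<dots> = (a \<otimes> d \<oplus> c \<otimes> b) \<otimes> (b' \<otimes> d')"
      using *(1-6) assms by (simp add: m_ac l_distr r_distr)
    finally show "(a' \<otimes> d' \<oplus> c' \<otimes> b') \<otimes> (b \<otimes> d) = (a \<otimes> d \<oplus> c \<otimes> b) \<otimes> (b' \<otimes> d')" .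
    show "b' \<otimes> d' \<noteq> \<zero>" "b \<otimes> d \<noteq> \<zero>" using * assms integral_iff by auto
  qed (use that assms in \<open>auto simp: frac_mem_iff\<close>)
  moreover have "(a, b) \<in> frac R a b" "(c, d) \<in> frac R c d" using assms by (auto simp: frac_mem_iff)
  ultimately show ?thesis unfolding fraction_field_simps by fast
qed

lemma frac_one_hom: "(\<lambda>a. frac R a \<one>) \<in> ring_hom R FF"
  by (rule ring_hom_memI) (simp_all add: frac_closed frac_mult frac_add fraction_field_simps(4))

lemma frac_one_inj: "a \<in> carrier R \<Longrightarrow> b \<in> carrier R \<Longrightarrow> frac R a \<one> = frac R b \<one> \<Longrightarrow> a = b"
  using frac_eqD [of b \<one> a \<one>] by simp

lemma fraction_field_inverse:
  assumes x: "x \<in> carrier FF" "x \<noteq> \<zero>\<^bsub>FF\<^esub>"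
  shows "\<exists>y\<in>carrier FF. y \<otimes>\<^bsub>FF\<^esub> x = \<one>\<^bsub>FF\<^esub>"
proof -
  obtain a b where ab: "a \<in> carrier R" "b \<in> carrier R" "b \<noteq> \<zero>" "x = frac R a b"
    using x(1) by (auto simp: fraction_field_simps)
  have "a \<noteq> \<zero>"
  proof
    assume "a = \<zero>"
    then have "x = frac R \<zero> \<one>" unfolding ab(4) using ab(1-3) by (intro frac_eqI) auto
    then show False using x(2) by (simp add: fraction_field_simps)
  qed
  then have "frac R b a \<otimes>\<^bsub>FF\<^esub> x = frac R \<one> \<one>"
    using ab by (simp add: frac_mult) (rule frac_eqI, auto simp: m_comm integral_iff)
  then show ?thesis using ab \<open>a \<noteq> \<zero>\<close> frac_closed [of b a] by (auto simp: fraction_field_simps(4))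
qed

end

section \<open>The adele ring\<close>

locale adele_curve =
  fixes C :: "('v::finite, 'k::field) point set"
  assumes closed: "zariski_closed C" and nonempty: "C \<noteq> {}" and adele_cring: "cring (adele_ring C)"
begin

sublocale AR: cring "adele_ring C" by (rule adele_cring)

abbreviation AR where "AR \<equiv> adele_ring C"
abbreviation K where "K \<equiv> local_field C"
abbreviation A where "A \<equiv> completed_local_ring C"

lemma adele_simps:
  "\<alpha> \<in> carrier AR \<longleftrightarrow> \<alpha> \<in> extensional C \<and> (\<forall>x\<in>C. \<alpha> x \<in> carrier (K x)) \<and> finite {x \<in> C. \<alpha> x \<notin> local_integers C x}"
  "\<alpha> \<otimes>\<^bsub>AR\<^esub> \<beta> = (\<lambda>x\<in>C. \<alpha> x \<otimes>\<^bsub>K x\<^esub> \<beta> x)" "\<alpha> \<oplus>\<^bsub>AR\<^esub> \<beta> = (\<lambda>x\<in>C. \<alpha> x \<oplus>\<^bsub>K x\<^esub> \<beta> x)"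
  "\<one>\<^bsub>AR\<^esub> = (\<lambda>x\<in>C. \<one>\<^bsub>K x\<^esub>)" "\<zero>\<^bsub>AR\<^esub> = (\<lambda>x\<in>C. \<zero>\<^bsub>K x\<^esub>)"
  by (auto simp: adele_ring_def PiE_def)

definition ext where "ext x k = (\<lambda>y\<in>C. if y = x then k else \<zero>\<^bsub>K y\<^esub>)"

text \<open>Nothing about a single \<open>K y\<close> is established yet, so membership and almost
  everywhere integrality of the zeros at the other places are read off from the zero adele.\<close>

lemma ext_closed:
  assumes "k \<in> carrier (K x)" shows "ext x k \<in> carrier AR"
proof -
  have z: "\<zero>\<^bsub>AR\<^esub> \<in> carrier AR" by (rule AR.zero_closed)
  have "{y \<in> C. ext x k y \<notin> local_integers C y} \<subseteq> insert x {y \<in> C. \<zero>\<^bsub>AR\<^esub> y \<notin> local_integers C y}"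
    by (auto simp: ext_def adele_simps(5))
  then have "finite {y \<in> C. ext x k y \<notin> local_integers C y}"
    using z unfolding adele_simps(1) by (meson finite.insertI finite_subset)
  moreover have "\<zero>\<^bsub>K y\<^esub> \<in> carrier (K y)" if "y \<in> C" for y
    using z that by (auto simp: adele_simps(1,5))
  ultimately show ?thesis using assms by (auto simp: adele_simps(1) ext_def)
qed

lemma ext_same [simp]: "x \<in> C \<Longrightarrow> ext x k x = k"
  by (simp add: ext_def)

text \<open>Each \<open>K\<^sub>x\<close> inherits the ring axioms from the adele ring through extension by zero.\<close>

lemma local_field_cring:
  assumes x: "x \<in> C" shows "cring (K x)"
proof -
  have comp: "(\<alpha> \<oplus>\<^bsub>AR\<^esub> \<beta>) x = \<alpha> x \<oplus>\<^bsub>K x\<^esub> \<beta> x" "(\<alpha> \<otimes>\<^bsub>AR\<^esub> \<beta>) x = \<alpha> x \<otimes>\<^bsub>K x\<^esub> \<beta> x"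
    "\<one>\<^bsub>AR\<^esub> x = \<one>\<^bsub>K x\<^esub>" "\<zero>\<^bsub>AR\<^esub> x = \<zero>\<^bsub>K x\<^esub>" for \<alpha> \<beta>
    using x by (simp_all add: adele_simps)
  have cl: "\<alpha> x \<in> carrier (K x)" if "\<alpha> \<in> carrier AR" for \<alpha> using that x by (simp add: adele_simps(1))
  note e = ext_closed [of _ x] and s = ext_same [OF x]
  show ?thesis
  proof (rule cringI)
    show "abelian_group (K x)"
    proof (rule abelian_groupI)
      show "u \<oplus>\<^bsub>K x\<^esub> v \<in> carrier (K x)" if "u \<in> carrier (K x)" "v \<in> carrier (K x)" for u v
        using cl [OF AR.a_closed [OF e [OF that(1)] e [OF that(2)]]] by (simp add: comp s)
      show "\<zero>\<^bsub>K x\<^esub> \<in> carrier (K x)" using cl [OF AR.zero_closed] by (simp add: comp)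
      show "u \<oplus>\<^bsub>K x\<^esub> v \<oplus>\<^bsub>K x\<^esub> w = u \<oplus>\<^bsub>K x\<^esub> (v \<oplus>\<^bsub>K x\<^esub> w)"
        if "u \<in> carrier (K x)" "v \<in> carrier (K x)" "w \<in> carrier (K x)" for u v w
        using fun_cong [OF AR.a_assoc [OF e [OF that(1)] e [OF that(2)] e [OF that(3)]], of x] by (simp add: comp s)
      show "u \<oplus>\<^bsub>K x\<^esub> v = v \<oplus>\<^bsub>K x\<^esub> u" if "u \<in> carrier (K x)" "v \<in> carrier (K x)" for u v
        using fun_cong [OF AR.a_comm [OF e [OF that(1)] e [OF that(2)]], of x] by (simp add: comp s)
      show "\<zero>\<^bsub>K x\<^esub> \<oplus>\<^bsub>K x\<^esub> u = u" if "u \<in> carrier (K x)" for u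
        using fun_cong [OF AR.l_zero [OF e [OF that]], of x] by (simp add: comp s)
      show "\<exists>v\<in>carrier (K x). v \<oplus>\<^bsub>K x\<^esub> u = \<zero>\<^bsub>K x\<^esub>" if "u \<in> carrier (K x)" for u
        using fun_cong [OF AR.l_neg [OF e [OF that]], of x] cl [OF AR.a_inv_closed [OF e [OF that]]]
        by (auto simp: comp s)
    qed
    show "comm_monoid (K x)"
    proof (rule comm_monoidI)
      show "u \<otimes>\<^bsub>K x\<^esub> v \<in> carrier (K x)" if "u \<in> carrier (K x)" "v \<in> carrier (K x)" for u v
        using cl [OF AR.m_closed [OF e [OF that(1)] e [OF that(2)]]] by (simp add: comp s)
      show "\<one>\<^bsub>K x\<^esub> \<in> carrier (K x)" using cl [OF AR.one_closed] by (simp add: comp)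
      show "u \<otimes>\<^bsub>K x\<^esub> v \<otimes>\<^bsub>K x\<^esub> w = u \<otimes>\<^bsub>K x\<^esub> (v \<otimes>\<^bsub>K x\<^esub> w)"
        if "u \<in> carrier (K x)" "v \<in> carrier (K x)" "w \<in> carrier (K x)" for u v w
        using fun_cong [OF AR.m_assoc [OF e [OF that(1)] e [OF that(2)] e [OF that(3)]], of x] by (simp add: comp s)
      show "u \<otimes>\<^bsub>K x\<^esub> v = v \<otimes>\<^bsub>K x\<^esub> u" if "u \<in> carrier (K x)" "v \<in> carrier (K x)" for u v
        using fun_cong [OF AR.m_comm [OF e [OF that(1)] e [OF that(2)]], of x] by (simp add: comp s)
      show "\<one>\<^bsub>K x\<^esub> \<otimes>\<^bsub>K x\<^esub> u = u" if "u \<in> carrier (K x)" for u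
        using fun_cong [OF AR.l_one [OF e [OF that]], of x] by (simp add: comp s)
    qed
    show "(u \<oplus>\<^bsub>K x\<^esub> v) \<otimes>\<^bsub>K x\<^esub> w = u \<otimes>\<^bsub>K x\<^esub> w \<oplus>\<^bsub>K x\<^esub> v \<otimes>\<^bsub>K x\<^esub> w"
      if "u \<in> carrier (K x)" "v \<in> carrier (K x)" "w \<in> carrier (K x)" for u v w
      using fun_cong [OF AR.l_distr [OF e [OF that(1)] e [OF that(2)] e [OF that(3)]], of x] by (simp add: comp s)
  qed
qed

lemma adele_component_hom: "x \<in> C \<Longrightarrow> (\<lambda>\<alpha>. \<alpha> x) \<in> ring_hom AR (K x)"
  by (rule ring_hom_memI) (auto simp: adele_simps)

lemma adele_direct_factor:
  assumes x: "x \<in> C" shows "direct_factor AR (K x) (\<lambda>\<alpha>. \<alpha> x) (ext x)"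
proof -
  interpret Kx: cring "K x" by (rule local_field_cring [OF x])
  show ?thesis
  proof (intro direct_factor.intro direct_factor_axioms.intro adele_cring Kx.cring_axioms
      adele_component_hom x ext_closed ext_same)
    show "ext x (k \<oplus>\<^bsub>K x\<^esub> l) = ext x k \<oplus>\<^bsub>AR\<^esub> ext x l" for k l
      using cring.cring_simprules(8) [OF local_field_cring] cring.cring_simprules(2) [OF local_field_cring]
      by (auto simp: ext_def adele_simps fun_eq_iff)
    show "ext x (k \<otimes>\<^bsub>K x\<^esub> l) = ext x k \<otimes>\<^bsub>AR\<^esub> ext x l" for k l
      using cring.cring_simprules(26) [OF local_field_cring] cring.cring_simprules(2) [OF local_field_cring]
      by (auto simp: ext_def adele_simps fun_eq_iff)
    show "ext x (\<alpha> x) = ext x \<one>\<^bsub>K x\<^esub> \<otimes>\<^bsub>AR\<^esub> \<alpha>" if "\<alpha> \<in> carrier AR" for \<alpha>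
      using that cring.cring_simprules(26) [OF local_field_cring] Kx.l_one [of "\<alpha> x"] x
      by (auto simp: ext_def adele_simps fun_eq_iff)
  qed
qed

lemma adele_eqI: "\<alpha> \<in> carrier AR \<Longrightarrow> \<beta> \<in> carrier AR \<Longrightarrow> (\<And>x. x \<in> C \<Longrightarrow> \<alpha> x = \<beta> x) \<Longrightarrow> \<alpha> = \<beta>"
  by (rule extensionalityI [of _ C]) (auto simp: adele_simps(1))

lemma adele_zeroI: "\<alpha> \<in> carrier AR \<Longrightarrow> (\<And>x. x \<in> C \<Longrightarrow> \<alpha> x = \<zero>\<^bsub>K x\<^esub>) \<Longrightarrow> \<alpha> = \<zero>\<^bsub>AR\<^esub>"
  by (rule adele_eqI [OF _ AR.zero_closed]) (simp_all add: adele_simps(5))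

lemma adele_finsum_component:
  assumes "x \<in> C" "f \<in> I \<rightarrow> carrier AR"
  shows "(\<Oplus>\<^bsub>AR\<^esub>i\<in>I. f i) x = (\<Oplus>\<^bsub>K x\<^esub>i\<in>I. f i x)"
proof -
  interpret h: ring_hom_cring AR "K x" "\<lambda>\<alpha>. \<alpha> x"
    using adele_cring local_field_cring [OF assms(1)] adele_component_hom [OF assms(1)]
    by (simp add: ring_hom_cring_def ring_hom_cring_axioms_def)
  show ?thesis using h.hom_finsum [OF assms(2)] by (simp add: comp_def)
qed

section \<open>Integers and units at a single place\<close>

lemma closed_point: "x \<in> C \<Longrightarrow> closed_point C x"
  by (simp add: closed_point_def closed)

lemma completed_local: "x \<in> C \<Longrightarrow> completed_local (local_ring_at C x) (nonunits (local_ring_at C x))"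
  using closed_point.local_ring_cring [of C x] closed_point.nonunits_ideal [of C x]
    closed_point.one_not_nonunit [of C x] closed_point [of x]
  by (simp add: completed_local_def completed_ring_def completed_local_axioms_def)

text \<open>Products stay inside \<open>K x\<close>, by the ring axioms inherited from the adele
  ring, and this excludes zero divisors in the completed local ring.\<close>

lemma completed_local_domain:
  assumes x: "x \<in> C" shows "domain (A x)"
proof -
  interpret L: completed_local "local_ring_at C x" "nonunits (local_ring_at C x)" by (rule completed_local [OF x])
  interpret Kx: cring "K x" by (rule local_field_cring [OF x])
  show ?thesis
    using L.A.domain_if_fraction_field_closed [OF L.A_nontrivial] Kx.m_closed
    by (simp add: completed_local_ring_def local_field_def)
qed

abbreviation int_embed where "int_embed x \<equiv> (\<lambda>a. frac (A x) a \<one>\<^bsub>A x\<^esub>)"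

lemma local_integers_eq: "local_integers C x = int_embed x ` carrier (A x)"
  by (simp add: local_integers_def)

lemma int_embed_hom: "x \<in> C \<Longrightarrow> int_embed x \<in> ring_hom (A x) (K x)"
  unfolding local_field_def by (rule domain.frac_one_hom [OF completed_local_domain])

lemma int_embed_hom_cring: "x \<in> C \<Longrightarrow> ring_hom_cring (A x) (K x) (int_embed x)"
  using completed_local_domain [THEN domain.axioms(1)] local_field_cring int_embed_hom
  by (simp add: ring_hom_cring_def ring_hom_cring_axioms_def)

lemma local_field_nontrivial: "x \<in> C \<Longrightarrow> \<one>\<^bsub>K x\<^esub> \<noteq> \<zero>\<^bsub>K x\<^esub>"
proof
  assume x: "x \<in> C" and eq: "\<one>\<^bsub>K x\<^esub> = \<zero>\<^bsub>K x\<^esub>"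
  interpret D: domain "A x" by (rule completed_local_domain [OF x])
  interpret h: ring_hom_cring "A x" "K x" "int_embed x" by (rule int_embed_hom_cring [OF x])
  have "\<one>\<^bsub>A x\<^esub> = \<zero>\<^bsub>A x\<^esub>"
    using eq h.hom_one h.hom_zero by (intro D.frac_one_inj D.one_closed D.zero_closed) simp
  then show False by simp
qed

lemma zero_one_integral: "x \<in> C \<Longrightarrow> \<zero>\<^bsub>K x\<^esub> \<in> local_integers C x" "x \<in> C \<Longrightarrow> \<one>\<^bsub>K x\<^esub> \<in> local_integers C x"
  using domain.axioms(1) [OF completed_local_domain, of x]
  by (auto simp: local_integers_eq local_field_def fraction_field_simps intro!: image_eqI
      cring.cring_simprules(2) cring.cring_simprules(6))

text \<open>Inverting an arbitrary nonzero \<open>w i\<close> in the field could give a non-integral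
  inverse at infinitely many places. Where all \<open>w i\<close> are integral, locality of
  \<open>A x\<close> therefore supplies a unit of \<open>A x\<close>; elsewhere the implication is
  void and any nonzero \<open>w i\<close> will do.\<close>

lemma unit_of_sum:
  assumes x: "x \<in> C" and w: "w \<in> I \<rightarrow> carrier (K x)" "(\<Oplus>\<^bsub>K x\<^esub>i\<in>I. w i) = \<one>\<^bsub>K x\<^esub>"
  shows "\<exists>i\<in>I. \<exists>k\<in>carrier (K x). k \<otimes>\<^bsub>K x\<^esub> w i = \<one>\<^bsub>K x\<^esub> \<and>
    (w \<in> I \<rightarrow> local_integers C x \<longrightarrow> k \<in> local_integers C x)"
proof -
  interpret Kx: cring "K x" by (rule local_field_cring [OF x])
  interpret D: domain "A x" by (rule completed_local_domain [OF x])
  interpret h: ring_hom_cring "A x" "K x" "int_embed x" by (rule int_embed_hom_cring [OF x])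
  interpret L: completed_local "local_ring_at C x" "nonunits (local_ring_at C x)" by (rule completed_local [OF x])
  show ?thesis
  proof (cases "w \<in> I \<rightarrow> local_integers C x")
    case True
    then have "\<forall>i\<in>I. \<exists>a. a \<in> carrier (A x) \<and> w i = int_embed x a" by (auto simp: local_integers_eq)
    then obtain a where a: "\<And>i. i \<in> I \<Longrightarrow> a i \<in> carrier (A x)" "\<And>i. i \<in> I \<Longrightarrow> w i = int_embed x (a i)" by metis
    have acl: "a \<in> I \<rightarrow> carrier (A x)" using a(1) by blast
    have "int_embed x (\<Oplus>\<^bsub>A x\<^esub>i\<in>I. a i) = (\<Oplus>\<^bsub>K x\<^esub>i\<in>I. w i)"
      unfolding h.hom_finsum [OF acl] using a(2) w(1) by (intro Kx.finsum_cong') auto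
    also have "\<dots> = int_embed x \<one>\<^bsub>A x\<^esub>" using w(2) h.hom_one by simp
    finally have "(\<Oplus>\<^bsub>A x\<^esub>i\<in>I. a i) = \<one>\<^bsub>A x\<^esub>"
      using acl by (intro D.frac_one_inj D.finsum_closed D.one_closed)
    then obtain i where i: "i \<in> I" "a i \<in> Units (A x)"
      using L.A_local acl unfolding completed_local_ring_def by blast
    then obtain b where b: "b \<in> carrier (A x)" "b \<otimes>\<^bsub>A x\<^esub> a i = \<one>\<^bsub>A x\<^esub>" by (auto simp: Units_def)
    have "int_embed x b \<otimes>\<^bsub>K x\<^esub> w i = \<one>\<^bsub>K x\<^esub>"
      using h.hom_mult [OF b(1) a(1) [OF i(1)]] b(2) a(2) [OF i(1)] h.hom_one by simp
    then show ?thesis using b(1) i(1) h.hom_closed [OF b(1)] by (auto simp: local_integers_eq)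
  next
    case False
    have "\<exists>i\<in>I. w i \<noteq> \<zero>\<^bsub>K x\<^esub>"
    proof (rule ccontr)
      assume "\<not> ?thesis"
      then have "(\<Oplus>\<^bsub>K x\<^esub>i\<in>I. w i) = (\<Oplus>\<^bsub>K x\<^esub>i\<in>I. \<zero>\<^bsub>K x\<^esub>)" by (intro Kx.finsum_cong') auto
      then show False using w(2) local_field_nontrivial [OF x] by simp
    qed
    then obtain i where i: "i \<in> I" "w i \<noteq> \<zero>\<^bsub>K x\<^esub>" by blast
    then obtain k where "k \<in> carrier (K x)" "k \<otimes>\<^bsub>K x\<^esub> w i = \<one>\<^bsub>K x\<^esub>"
      using D.fraction_field_inverse [of "w i"] w(1) unfolding local_field_def by blast
    then show ?thesis using i False by blast
  qed
qed

text \<open>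
  A partition of unity: since only finitely many places see a non-integral \<open>w\<^sub>p\<close>, inverting at every
  place one \<open>w\<^sub>p\<close> that is a unit there gives an adele.
\<close>

lemma adele_partition:
  assumes fin: "finite I" and w: "w \<in> I \<rightarrow> carrier AR" "(\<Oplus>\<^bsub>AR\<^esub>i\<in>I. w i) = \<one>\<^bsub>AR\<^esub>"
  obtains \<eta> b where "\<eta> \<in> I \<rightarrow> carrier AR" "b \<in> I \<rightarrow> carrier AR"
    "\<forall>i\<in>I. \<forall>j\<in>I. i \<noteq> j \<longrightarrow> \<eta> i \<otimes>\<^bsub>AR\<^esub> b j = \<zero>\<^bsub>AR\<^esub>" "(\<Oplus>\<^bsub>AR\<^esub>i\<in>I. (\<eta> i \<otimes>\<^bsub>AR\<^esub> b i) \<otimes>\<^bsub>AR\<^esub> w i) = \<one>\<^bsub>AR\<^esub>"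
proof -
  have wx: "(\<lambda>i. w i x) \<in> I \<rightarrow> carrier (K x)" if "x \<in> C" for x
    using w(1) that by (auto simp: adele_simps(1) Pi_iff)
  have sum1: "(\<Oplus>\<^bsub>K x\<^esub>i\<in>I. w i x) = \<one>\<^bsub>K x\<^esub>" if "x \<in> C" for x
    using adele_finsum_component [OF that w(1)] w(2) that by (simp add: adele_simps)
  have "\<forall>x\<in>C. \<exists>i k. i \<in> I \<and> k \<in> carrier (K x) \<and> k \<otimes>\<^bsub>K x\<^esub> w i x = \<one>\<^bsub>K x\<^esub> \<and>
      ((\<lambda>i. w i x) \<in> I \<rightarrow> local_integers C x \<longrightarrow> k \<in> local_integers C x)"
    using unit_of_sum [OF _ wx sum1] by blast
  then obtain \<tau> \<kappa> where \<tau>: "\<And>x. x \<in> C \<Longrightarrow> \<tau> x \<in> I" and \<kappa>: "\<And>x. x \<in> C \<Longrightarrow> \<kappa> x \<in> carrier (K x)"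
    and \<kappa>w: "\<And>x. x \<in> C \<Longrightarrow> \<kappa> x \<otimes>\<^bsub>K x\<^esub> w (\<tau> x) x = \<one>\<^bsub>K x\<^esub>"
    and int: "\<And>x. x \<in> C \<Longrightarrow> (\<lambda>i. w i x) \<in> I \<rightarrow> local_integers C x \<Longrightarrow> \<kappa> x \<in> local_integers C x"
    by metis
  \<comment> \<open>\<open>\<tau>\<close> assigns to each place an index whose \<open>w\<close> is
    inverted there by \<open>\<kappa>\<close>. \<open>\<eta> i\<close> is the idempotent of the
    places assigned to \<open>i\<close>, and \<open>b i\<close> carries the inverses at the same
    places, so different indices have disjoint supports.\<close>
  define \<eta> where "\<eta> i = (\<lambda>x\<in>C. if i = \<tau> x then \<one>\<^bsub>K x\<^esub> else \<zero>\<^bsub>K x\<^esub>)" for i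
  define b where "b i = (\<lambda>x\<in>C. if i = \<tau> x then \<kappa> x else \<zero>\<^bsub>K x\<^esub>)" for i
  have K01: "\<zero>\<^bsub>K x\<^esub> \<in> carrier (K x)" "\<one>\<^bsub>K x\<^esub> \<in> carrier (K x)" if "x \<in> C" for x
    using local_field_cring [OF that] by (simp_all add: cring.cring_simprules)
  have \<eta>: "\<eta> i \<in> carrier AR" for i
  proof -
    have "{x \<in> C. \<eta> i x \<notin> local_integers C x} = {}" using zero_one_integral by (auto simp: \<eta>_def)
    then have "finite {x \<in> C. \<eta> i x \<notin> local_integers C x}" by (simp only: finite.emptyI)
    then show ?thesis using K01 by (simp add: adele_simps(1)) (simp add: \<eta>_def)
  qed
  have b: "b i \<in> carrier AR" for i
  proof -
    have "{x \<in> C. b i x \<notin> local_integers C x} \<subseteq> (\<Union>j\<in>I. {x \<in> C. w j x \<notin> local_integers C x})"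
    proof
      fix x assume "x \<in> {x \<in> C. b i x \<notin> local_integers C x}"
      then have x: "x \<in> C" "\<kappa> x \<notin> local_integers C x"
        using zero_one_integral by (auto simp: b_def split: if_splits)
      then have "\<not> (\<lambda>i. w i x) \<in> I \<rightarrow> local_integers C x" using int by blast
      then show "x \<in> (\<Union>j\<in>I. {x \<in> C. w j x \<notin> local_integers C x})" using x(1) by auto
    qed
    moreover have "finite (\<Union>j\<in>I. {x \<in> C. w j x \<notin> local_integers C x})"
      using fin w(1) by (auto simp: adele_simps(1))
    ultimately have "finite {x \<in> C. b i x \<notin> local_integers C x}" by (rule finite_subset)
    then show ?thesis using K01 \<kappa> by (simp add: adele_simps(1)) (simp add: b_def)
  qed
  have "\<eta> i \<otimes>\<^bsub>AR\<^esub> b j = \<zero>\<^bsub>AR\<^esub>" if "i \<noteq> j" for i j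
  proof (rule adele_zeroI)
    fix x assume x: "x \<in> C"
    interpret Kx: cring "K x" by (rule local_field_cring [OF x])
    show "(\<eta> i \<otimes>\<^bsub>AR\<^esub> b j) x = \<zero>\<^bsub>K x\<^esub>"
      using that x \<kappa> [OF x] by (auto simp: adele_simps(2) \<eta>_def b_def)
  qed (use \<eta> b in simp)
  moreover have "(\<Oplus>\<^bsub>AR\<^esub>i\<in>I. (\<eta> i \<otimes>\<^bsub>AR\<^esub> b i) \<otimes>\<^bsub>AR\<^esub> w i) = \<one>\<^bsub>AR\<^esub>"
  proof (rule adele_eqI)
    have cl: "(\<lambda>i. (\<eta> i \<otimes>\<^bsub>AR\<^esub> b i) \<otimes>\<^bsub>AR\<^esub> w i) \<in> I \<rightarrow> carrier AR" using \<eta> b w(1) by auto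
    then show "(\<Oplus>\<^bsub>AR\<^esub>i\<in>I. (\<eta> i \<otimes>\<^bsub>AR\<^esub> b i) \<otimes>\<^bsub>AR\<^esub> w i) \<in> carrier AR" by (rule AR.finsum_closed)
    fix x assume x: "x \<in> C"
    interpret Kx: cring "K x" by (rule local_field_cring [OF x])
    have "(\<Oplus>\<^bsub>AR\<^esub>i\<in>I. (\<eta> i \<otimes>\<^bsub>AR\<^esub> b i) \<otimes>\<^bsub>AR\<^esub> w i) x
        = (\<Oplus>\<^bsub>K x\<^esub>i\<in>I. if \<tau> x = i then \<kappa> x \<otimes>\<^bsub>K x\<^esub> w i x else \<zero>\<^bsub>K x\<^esub>)"
      unfolding adele_finsum_component [OF x cl]
      using x \<kappa> [OF x] wx [OF x]
      by (intro Kx.finsum_cong') (auto simp: adele_simps(2) \<eta>_def b_def Pi_iff)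
    also have "\<dots> = \<kappa> x \<otimes>\<^bsub>K x\<^esub> w (\<tau> x) x"
      using \<tau> [OF x] fin \<kappa> [OF x] wx [OF x] by (intro Kx.finsum_singleton) auto
    finally show "(\<Oplus>\<^bsub>AR\<^esub>i\<in>I. (\<eta> i \<otimes>\<^bsub>AR\<^esub> b i) \<otimes>\<^bsub>AR\<^esub> w i) x = \<one>\<^bsub>AR\<^esub> x"
      using \<kappa>w [OF x] x by (simp add: adele_simps(4))
  qed simp
  ultimately show thesis using that [of \<eta> b] \<eta> b by blast
qed

section \<open>Constant adeles\<close>

lemma adele_const_component:
  assumes x: "x \<in> C"
  shows "adele_const C c x = int_embed x (completed_ring.const (local_ring_at C x) (nonunits (local_ring_at C x)) (local_ring_const C x c))"
proof -
  interpret L: completed_local "local_ring_at C x" "nonunits (local_ring_at C x)" by (rule completed_local [OF x])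
  show ?thesis using x by (simp add: adele_const_def Let_def L.const_def L.pr_def)
qed

definition local_const where
  "local_const x c = completed_ring.const (local_ring_at C x) (nonunits (local_ring_at C x)) (local_ring_const C x c)"

lemma local_const:
  assumes x: "x \<in> C"
  shows "local_const x c \<in> carrier (A x)" "local_const x (c + d) = local_const x c \<oplus>\<^bsub>A x\<^esub> local_const x d"
    "local_const x (c * d) = local_const x c \<otimes>\<^bsub>A x\<^esub> local_const x d" "local_const x 1 = \<one>\<^bsub>A x\<^esub>"
proof -
  interpret L: completed_local "local_ring_at C x" "nonunits (local_ring_at C x)" by (rule completed_local [OF x])
  interpret P: closed_point C x by (rule closed_point [OF x])
  note h = L.const_hom [folded completed_local_ring_def]
  note c = P.local_ring_const_closed
  show "local_const x c \<in> carrier (A x)" unfolding local_const_def by (rule ring_hom_closed [OF h c])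
  show "local_const x (c + d) = local_const x c \<oplus>\<^bsub>A x\<^esub> local_const x d"
    unfolding local_const_def P.local_ring_const_add by (rule ring_hom_add [OF h c c])
  show "local_const x (c * d) = local_const x c \<otimes>\<^bsub>A x\<^esub> local_const x d"
    unfolding local_const_def P.local_ring_const_mult by (rule ring_hom_mult [OF h c c])
  show "local_const x 1 = \<one>\<^bsub>A x\<^esub>"
    unfolding local_const_def P.local_ring_const_one by (rule ring_hom_one [OF h])
qed

lemma adele_const_eq: "x \<in> C \<Longrightarrow> adele_const C c x = int_embed x (local_const x c)"
  by (simp add: adele_const_component local_const_def)

lemma adele_const_closed: "adele_const C c \<in> carrier AR"
proof -
  have "adele_const C c x \<in> local_integers C x" "adele_const C c x \<in> carrier (K x)" if x: "x \<in> C" for x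
    using x local_const(1) [OF x] ring_hom_closed [OF int_embed_hom [OF x]]
    by (auto simp: adele_const_eq local_integers_eq)
  moreover from this(1) have "{x \<in> C. adele_const C c x \<notin> local_integers C x} = {}" by blast
  then have "finite {x \<in> C. adele_const C c x \<notin> local_integers C x}" by (simp only: finite.emptyI)
  moreover have "adele_const C c \<in> extensional C" by (simp add: adele_const_def)
  ultimately show ?thesis by (simp add: adele_simps(1))
qed

lemma adele_const_add: "adele_const C (c + d) = adele_const C c \<oplus>\<^bsub>AR\<^esub> adele_const C d"
  by (rule adele_eqI [OF adele_const_closed AR.a_closed [OF adele_const_closed adele_const_closed]])
    (simp add: adele_simps(3) adele_const_eq local_const ring_hom_add [OF int_embed_hom])

lemma adele_const_mult: "adele_const C (c * d) = adele_const C c \<otimes>\<^bsub>AR\<^esub> adele_const C d"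
  by (rule adele_eqI [OF adele_const_closed AR.m_closed [OF adele_const_closed adele_const_closed]])
    (simp add: adele_simps(2) adele_const_eq local_const ring_hom_mult [OF int_embed_hom])

lemma adele_const_one: "adele_const C 1 = \<one>\<^bsub>AR\<^esub>"
  by (rule adele_eqI [OF adele_const_closed AR.one_closed])
    (simp add: adele_simps(4) adele_const_eq local_const ring_hom_one [OF int_embed_hom])

lemma adele_const_zero: "adele_const C 0 = \<zero>\<^bsub>AR\<^esub>"
  using adele_const_add [of 0 0] adele_const_closed [of 0] by (simp add: AR.add.l_cancel_one')

lemma adele_const_pow: "adele_const C (c ^ n) = adele_const C c [^]\<^bsub>AR\<^esub> n"
  by (induction n) (simp_all add: adele_const_one adele_const_mult AR.m_comm adele_const_closed)

lemma adele_const_sum: "finite I \<Longrightarrow> adele_const C (\<Sum>i\<in>I. f i) = (\<Oplus>\<^bsub>AR\<^esub>i\<in>I. adele_const C (f i))"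
  by (induction I rule: finite_induct)
    (simp_all add: adele_const_zero adele_const_add adele_const_closed)

end

section \<open>Characters of a cyclic group of prime order\<close>

lemma of_nat_prime_neq_0:
  assumes "Factorial_Ring.prime p" "p \<noteq> CHAR('k::field)"
  shows "(of_nat p :: 'k) \<noteq> 0"
proof
  assume "(of_nat p :: 'k) = 0"
  then have "CHAR('k) dvd p" by (simp add: of_nat_eq_0_iff_char_dvd)
  then have "CHAR('k) = 1" using assms by (auto simp: prime_nat_iff)
  then have "(of_nat 1 :: 'k) = 0" by (simp only: of_nat_eq_0_iff_char_dvd one_dvd)
  then show False by simp
qed

text \<open>Take a root of \<open>1 + x + ... + x^(p-1)\<close>, which exists by algebraic
  closedness. It differs from \<open>1\<close> because the value there is \<open>p\<close>, nonzero
  in the field.\<close>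

lemma nontrivial_root_of_unity:
  assumes p: "Factorial_Ring.prime p" "p \<noteq> CHAR('k::alg_closed_field)"
  obtains \<zeta> :: "'k::alg_closed_field" where "\<zeta> \<noteq> 1" "\<zeta> ^ p = 1"
proof -
  have p2: "p \<ge> 2" using p(1) by (simp add: prime_ge_2_nat)
  then have "\<exists>x::'k. (\<Sum>k\<le>p - 1. 1 * x ^ k) = 0" by (intro alg_closed) auto
  then obtain x :: 'k where "(\<Sum>k\<le>p - 1. x ^ k) = 0" by auto
  moreover have "{..p - 1} = {..<p}" using p2 by auto
  ultimately have x: "(\<Sum>k<p. x ^ k) = 0" by simp
  have "x ^ p - 1 = (x - 1) * (\<Sum>k<p. x ^ k)" by (rule power_diff_1_eq)
  then have "x ^ p = 1" using x by simp
  moreover have "x \<noteq> 1" using x of_nat_prime_neq_0 [OF p] by auto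
  ultimately show thesis using that by blast
qed

text \<open>If \<open>p\<close> does not divide \<open>n\<close>, Bezout gives a multiple of
  \<open>n\<close> that is one more than a multiple of \<open>p\<close>, and then
  \<open>\<zeta>^n = 1\<close> forces \<open>\<zeta> = 1\<close>.\<close>

lemma root_of_unity_power_eq_1_iff:
  fixes \<zeta> :: "'k::field"
  assumes p: "Factorial_Ring.prime p" and \<zeta>: "\<zeta> \<noteq> 1" "\<zeta> ^ p = 1"
  shows "\<zeta> ^ n = 1 \<longleftrightarrow> p dvd n"
proof
  assume n: "\<zeta> ^ n = 1"
  show "p dvd n"
  proof (rule ccontr)
    assume "\<not> p dvd n"
    then have "coprime p n" "n \<noteq> 0" using p prime_imp_coprime by (blast, auto intro: ccontr)
    then have "gcd n p = 1" "n \<noteq> 0" by (simp_all add: coprime_iff_gcd_eq_1 gcd.commute)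
    then obtain a b where "n * a = p * b + 1" using bezout_nat [of n p] by auto
    then have "\<zeta> ^ (n * a) = \<zeta> ^ (p * b) * \<zeta>" by (simp add: power_add)
    then show False using n \<zeta> by (simp add: power_mult)
  qed
qed (use \<zeta> in \<open>auto simp: power_mult elim!: dvdE\<close>)

lemma sum_powers_root_of_unity:
  fixes y :: "'k::field"
  assumes "y ^ p = 1"
  shows "(\<Sum>m<p. y ^ m) = (if y = 1 then of_nat p else 0)"
  using power_diff_1_eq [of y p] assms by auto

text \<open>A generator is sent to a nontrivial \<open>p\<close>-th root of unity. The exponent
  \<open>l g\<close> is chosen arbitrarily; the power of \<open>\<zeta>\<close> does not depend on
  the choice since the generator has order \<open>p\<close>, and it is \<open>1\<close> exactly when
  \<open>p\<close> divides the exponent.\<close>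

lemma faithful_character_exists:
  fixes G :: "'g monoid"
  assumes G: "group G" "cyclic_group G" "Coset.order G = p"
    and p: "Factorial_Ring.prime p" "p \<noteq> CHAR('k::alg_closed_field)"
  obtains \<chi> :: "'g \<Rightarrow> 'k::alg_closed_field" where "\<chi> \<in> hom G (roots_of_unity_group p)"
    "\<And>g. g \<in> carrier G \<Longrightarrow> \<chi> g = 1 \<longleftrightarrow> g = \<one>\<^bsub>G\<^esub>"
proof -
  interpret group G by (rule G)
  obtain \<zeta> :: 'k where \<zeta>: "\<zeta> \<noteq> 1" "\<zeta> ^ p = 1" by (rule nontrivial_root_of_unity [OF p])
  obtain a where a: "a \<in> carrier G" and gen: "carrier G = range (\<lambda>n::int. a [^]\<^bsub>G\<^esub> n)"
    using G(2) cyclic_group by blast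
  have p2: "p \<ge> 2" using p(1) by (simp add: prime_ge_2_nat)
  have fin: "finite (carrier G)" using G(3) p2 by (simp add: order_gt_0_iff_finite [symmetric])
  have "ord a dvd p" using ord_dvd_group_order [OF a] G(3) by simp
  moreover have "ord a \<noteq> 1"
  proof
    assume "ord a = 1"
    then have "a = \<one>\<^bsub>G\<^esub>" using ord_eq_1 [OF a] by simp
    then have "carrier G = {\<one>\<^bsub>G\<^esub>}" using gen by auto
    then show False using G(3) p2 by (simp add: Coset.order_def)
  qed
  ultimately have ord: "ord a = p" using p(1) by (auto simp: prime_nat_iff)
  have "\<exists>n::nat. a [^]\<^bsub>G\<^esub> n = g" if g: "g \<in> carrier G" for g
  proof -
    obtain k :: int where k: "g = a [^]\<^bsub>G\<^esub> k" using g gen by auto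
    have "a [^]\<^bsub>G\<^esub> k = a [^]\<^bsub>G\<^esub> (k mod int p)"
      using a ord by (simp add: int_pow_eq mod_eq_dvd_iff [symmetric])
    also have "\<dots> = a [^]\<^bsub>G\<^esub> int (nat (k mod int p))" using p2 by simp
    finally show ?thesis using k by (metis int_pow_int)
  qed
  then obtain l :: "'g \<Rightarrow> nat" where l: "\<And>g. g \<in> carrier G \<Longrightarrow> a [^]\<^bsub>G\<^esub> l g = g" by metis
  have dvd: "a [^]\<^bsub>G\<^esub> m = a [^]\<^bsub>G\<^esub> n \<Longrightarrow> \<zeta> ^ m = \<zeta> ^ n" for m n :: nat
  proof (induction m n rule: linorder_wlog)
    case (le m n)
    have "a [^]\<^bsub>G\<^esub> int m = a [^]\<^bsub>G\<^esub> int n" using le(2) by (simp add: int_pow_int)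
    then have "int p dvd int n - int m" using a ord by (simp add: int_pow_eq)
    then have "int p dvd int (n - m)" using le(1) by (simp add: of_nat_diff)
    then have "p dvd n - m" by (simp only: int_dvd_int_iff)
    then have "\<zeta> ^ (n - m) = 1" using root_of_unity_power_eq_1_iff [OF p(1) \<zeta>] by blast
    then have "\<zeta> ^ (m + (n - m)) = \<zeta> ^ m" by (simp only: power_add) simp
    then show ?case using le(1) by simp
  qed simp
  define \<chi> where "\<chi> g = \<zeta> ^ l g" for g
  show thesis
  proof (rule that [of \<chi>])
    show "\<chi> \<in> hom G (roots_of_unity_group p)"
    proof (rule homI)
      show "\<chi> g \<in> carrier (roots_of_unity_group p)" for g
        using \<zeta>(2) by (simp add: \<chi>_def roots_of_unity_group_def) (metis mult.commute power_mult power_one)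
      fix g h assume gh: "g \<in> carrier G" "h \<in> carrier G"
      have "a [^]\<^bsub>G\<^esub> l (g \<otimes>\<^bsub>G\<^esub> h) = a [^]\<^bsub>G\<^esub> (l g + l h)"
        unfolding nat_pow_mult [OF a, symmetric] l [OF gh(1)] l [OF gh(2)] l [OF m_closed [OF gh]] ..
      then show "\<chi> (g \<otimes>\<^bsub>G\<^esub> h) = \<chi> g \<otimes>\<^bsub>roots_of_unity_group p\<^esub> \<chi> h"
        using dvd [of "l (g \<otimes>\<^bsub>G\<^esub> h)" "l g + l h"] by (simp add: \<chi>_def roots_of_unity_group_def power_add)
    qed
    fix g assume g: "g \<in> carrier G"
    have "\<chi> g = 1 \<longleftrightarrow> p dvd l g" unfolding \<chi>_def by (rule root_of_unity_power_eq_1_iff [OF p(1) \<zeta>])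
    also have "\<dots> \<longleftrightarrow> a [^]\<^bsub>G\<^esub> l g = \<one>\<^bsub>G\<^esub>" using a ord by (simp add: pow_eq_id)
    finally show "\<chi> g = 1 \<longleftrightarrow> g = \<one>\<^bsub>G\<^esub>" using l [OF g] by simp
  qed
qed

section \<open>Orthogonality of characters\<close>

context
  fixes G :: "'g monoid" and \<chi> :: "'g \<Rightarrow> 'k::field" and p :: nat
  assumes G: "group G" "finite (carrier G)" "Coset.order G = p" and p: "Factorial_Ring.prime p"
    and hom: "\<chi> \<in> hom G (roots_of_unity_group p)"
begin

interpretation group G by (rule G)

lemma hom_roots_mult: "g \<in> carrier G \<Longrightarrow> h \<in> carrier G \<Longrightarrow> \<chi> (g \<otimes>\<^bsub>G\<^esub> h) = \<chi> g * \<chi> h"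
  using hom by (auto simp: hom_def roots_of_unity_group_def)

lemma hom_roots_pow: "g \<in> carrier G \<Longrightarrow> \<chi> g ^ p = 1"
  using hom by (auto simp: hom_def roots_of_unity_group_def)

lemma hom_roots_nonzero: "g \<in> carrier G \<Longrightarrow> \<chi> g \<noteq> 0"
  using hom_roots_pow [of g] p by (auto simp: power_0_left prime_gt_0_nat split: if_splits)

lemma hom_roots_one: "\<chi> \<one>\<^bsub>G\<^esub> = 1"
  using hom_roots_mult [of "\<one>\<^bsub>G\<^esub>" "\<one>\<^bsub>G\<^esub>"] hom_roots_nonzero [of "\<one>\<^bsub>G\<^esub>"] by simp

lemma hom_roots_inv: "g \<in> carrier G \<Longrightarrow> \<chi> (inv\<^bsub>G\<^esub> g) * \<chi> g = 1"
  using hom_roots_mult [of "inv\<^bsub>G\<^esub> g" g] hom_roots_one by simp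

text \<open>For \<open>k \<noteq> m\<close> translation by an \<open>a\<close> other than the
  identity multiplies the sum by \<open>\<psi> a\<close>, and \<open>\<psi> a \<noteq> 1\<close>
  makes it vanish. The latter holds because a \<open>p\<close>-th root of unity other than
  \<open>1\<close> has distinct powers below \<open>p\<close>.\<close>

lemma hom_roots_sum:
  assumes faithful: "\<And>g. g \<in> carrier G \<Longrightarrow> \<chi> g = 1 \<longleftrightarrow> g = \<one>\<^bsub>G\<^esub>" and km: "k < p" "m < p"
  shows "(\<Sum>g\<in>carrier G. \<chi> (inv\<^bsub>G\<^esub> g) ^ k * \<chi> g ^ m) = (if k = m then of_nat p else 0)"
proof (cases "k = m")
  case True
  have "(\<Sum>g\<in>carrier G. \<chi> (inv\<^bsub>G\<^esub> g) ^ k * \<chi> g ^ m) = (\<Sum>g\<in>carrier G. 1)"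
    using hom_roots_inv by (intro sum.cong) (auto simp: True power_mult_distrib [symmetric])
  then show ?thesis using True G(3) by (simp add: Coset.order_def)
next
  case False
  define \<psi> where "\<psi> g = \<chi> (inv\<^bsub>G\<^esub> g) ^ k * \<chi> g ^ m" for g
  have "carrier G \<noteq> {\<one>\<^bsub>G\<^esub>}"
    using G(3) prime_ge_2_nat [OF p] by (auto simp: Coset.order_def)
  then obtain a where a: "a \<in> carrier G" "a \<noteq> \<one>\<^bsub>G\<^esub>" by auto
  have \<psi>: "\<psi> (a \<otimes>\<^bsub>G\<^esub> g) = \<psi> a * \<psi> g" if g: "g \<in> carrier G" for g
    using a(1) g by (simp add: \<psi>_def inv_mult_group hom_roots_mult power_mult_distrib mult_ac)
  have "\<psi> a \<noteq> 1"
  proof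
    assume 1: "\<psi> a = 1"
    have pow: "\<chi> a ^ k = \<chi> a ^ m"
    proof -
      have "\<chi> a ^ k = \<chi> a ^ k * (\<chi> (inv\<^bsub>G\<^esub> a) ^ k * \<chi> a ^ m)" using 1 by (simp add: \<psi>_def)
      also have "\<dots> = (\<chi> (inv\<^bsub>G\<^esub> a) * \<chi> a) ^ k * \<chi> a ^ m" by (simp add: power_mult_distrib mult_ac)
      finally show ?thesis using hom_roots_inv [OF a(1)] by simp
    qed
    have \<zeta>: "\<chi> a \<noteq> 1" "\<chi> a ^ p = 1" using a faithful hom_roots_pow by auto
    \<comment> \<open>Stated for ordered exponents because it divides powers by subtracting natural
      numbers; it is applied to \<open>k\<close> and \<open>m\<close> in both orders.\<close>
    have impossible: False if "i < j" "j < p" "\<chi> a ^ i = \<chi> a ^ j" for i j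
    proof -
      have "\<chi> a ^ i * \<chi> a ^ (j - i) = \<chi> a ^ j" using that(1) by (simp flip: power_add)
      then have "\<chi> a ^ i * \<chi> a ^ (j - i) = \<chi> a ^ i * 1" using that(3) by simp
      then have "\<chi> a ^ (j - i) = 1" using hom_roots_nonzero [OF a(1)] by simp
      then have "p dvd j - i" using root_of_unity_power_eq_1_iff [OF p \<zeta>] by blast
      then show False using that by (auto dest: dvd_imp_le)
    qed
    show False using impossible [of k m] impossible [of m k] pow km False by (metis linorder_neqE_nat)
  qed
  have "\<psi> a * (\<Sum>g\<in>carrier G. \<psi> g) = (\<Sum>g\<in>carrier G. \<psi> (a \<otimes>\<^bsub>G\<^esub> g))"
    using \<psi> by (simp add: sum_distrib_left)
  also have "\<dots> = (\<Sum>g\<in>(\<lambda>g. a \<otimes>\<^bsub>G\<^esub> g) ` carrier G. \<psi> g)"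
    using a(1) by (subst sum.reindex) (auto intro!: inj_onI simp: comp_def)
  also have "(\<lambda>g. a \<otimes>\<^bsub>G\<^esub> g) ` carrier G = carrier G" by (rule surj_const_mult [OF a(1)])
  finally have "(\<psi> a - 1) * (\<Sum>g\<in>carrier G. \<psi> g) = 0" by (simp add: algebra_simps)
  then have "(\<Sum>g\<in>carrier G. \<psi> g) = 0" using \<open>\<psi> a \<noteq> 1\<close> by simp
  then show ?thesis using False by (simp add: \<psi>_def)
qed

end

section \<open>Galois algebras over the adele ring\<close>

context algebra_action
begin

lemma eigenspace_finsum:
  assumes c: "character c" and J: "finite J" "f \<in> J \<rightarrow> eigenspace c"
  shows "(\<Oplus>\<^bsub>S\<^esub>i\<in>J. f i) \<in> eigenspace c"
proof -
  have f: "f i \<in> carrier S" "\<And>g. g \<in> carrier G \<Longrightarrow> \<rho> g (f i) = c g \<odot>\<^bsub>S\<^esub> f i" if "i \<in> J" for i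
    using J(2) that by (auto simp: eigenspace_def)
  have "\<rho> g (\<Oplus>\<^bsub>S\<^esub>i\<in>J. f i) = c g \<odot>\<^bsub>S\<^esub> (\<Oplus>\<^bsub>S\<^esub>i\<in>J. f i)" if g: "g \<in> carrier G" for g
  proof -
    have "\<rho> g (\<Oplus>\<^bsub>S\<^esub>i\<in>J. f i) = (\<Oplus>\<^bsub>S\<^esub>i\<in>J. \<rho> g (f i))" using f by (intro act_finsum g) auto
    also have "\<dots> = (\<Oplus>\<^bsub>S\<^esub>i\<in>J. c g \<odot>\<^bsub>S\<^esub> f i)"
      using f g characterD(1) [OF c g] by (intro S.finsum_cong') auto
    also have "\<dots> = c g \<odot>\<^bsub>S\<^esub> (\<Oplus>\<^bsub>S\<^esub>i\<in>J. f i)"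
      using f characterD(1) [OF c g] by (intro Mod.finsum_smult_ldistr [symmetric] J(1)) auto
    finally show ?thesis .
  qed
  then show ?thesis using f by (auto simp: eigenspace_def intro!: S.finsum_closed)
qed

text \<open>Put \<open>U = \<Sum> \<eta>_i u_i\<close> and \<open>V = \<Sum> b_j v_j\<close>.
  Orthogonality kills the mixed terms of the product, and the diagonal adds up to \<open>1\<close>.
  The hypothesis \<open>partition\<close> abstracts \<open>adele_partition\<close>; its index type
  is that of the Galois coordinates.\<close>

lemma eigenspace_unit:
  assumes gal: "galois_extension G R S \<rho>" and c: "character c"
    and comm: "\<And>g h. g \<in> carrier G \<Longrightarrow> h \<in> carrier G \<Longrightarrow> g \<otimes>\<^bsub>G\<^esub> h = h \<otimes>\<^bsub>G\<^esub> g"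
    and n: "n \<in> carrier R" "n \<otimes>\<^bsub>R\<^esub> (\<Oplus>\<^bsub>R\<^esub>g\<in>carrier G. \<one>\<^bsub>R\<^esub>) = \<one>\<^bsub>R\<^esub>"
    and partition: "\<And>(J :: ('s \<times> 's) set) w. \<lbrakk>finite J; w \<in> J \<rightarrow> carrier R; (\<Oplus>\<^bsub>R\<^esub>i\<in>J. w i) = \<one>\<^bsub>R\<^esub>\<rbrakk> \<Longrightarrow>
      \<exists>\<eta> b. \<eta> \<in> J \<rightarrow> carrier R \<and> b \<in> J \<rightarrow> carrier R \<and>
        (\<forall>i\<in>J. \<forall>j\<in>J. i \<noteq> j \<longrightarrow> \<eta> i \<otimes>\<^bsub>R\<^esub> b j = \<zero>\<^bsub>R\<^esub>) \<and> (\<Oplus>\<^bsub>R\<^esub>i\<in>J. (\<eta> i \<otimes>\<^bsub>R\<^esub> b i) \<otimes>\<^bsub>R\<^esub> w i) = \<one>\<^bsub>R\<^esub>"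
  obtains u v where "u \<in> eigenspace c" "v \<in> eigenspace (\<lambda>g. c (inv\<^bsub>G\<^esub> g))" "u \<otimes>\<^bsub>S\<^esub> v = \<one>\<^bsub>S\<^esub>"
proof -
  have inj: "inj_on (\<lambda>r. r \<odot>\<^bsub>S\<^esub> \<one>\<^bsub>S\<^esub>) (carrier R)"
    and fixed: "fixed_ring = (\<lambda>r. r \<odot>\<^bsub>S\<^esub> \<one>\<^bsub>S\<^esub>) ` carrier R"
    using gal by (auto simp: galois_extension_def fixed_ring_def)
  let ?d = "\<lambda>g. c (inv\<^bsub>G\<^esub> g)"
  have d: "character ?d" by (rule character_inverse [OF c comm])
  obtain J :: "('s \<times> 's) set" and u v where J: "finite J" and u: "u \<in> J \<rightarrow> eigenspace c"
    and v: "v \<in> J \<rightarrow> eigenspace ?d" and uv: "(\<Oplus>\<^bsub>S\<^esub>i\<in>J. u i \<otimes>\<^bsub>S\<^esub> v i) = \<one>\<^bsub>S\<^esub>"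
    by (rule eigen_coordinates [OF gal c comm n])
  have us: "u i \<in> carrier S" and vs: "v i \<in> carrier S" if "i \<in> J" for i
    using u v that by (auto simp: eigenspace_def)
  have "\<forall>i\<in>J. \<exists>r. r \<in> carrier R \<and> u i \<otimes>\<^bsub>S\<^esub> v i = r \<odot>\<^bsub>S\<^esub> \<one>\<^bsub>S\<^esub>"
    using eigenspace_mult_inverse [OF c] u v fixed by blast
  then obtain w where w: "\<And>i. i \<in> J \<Longrightarrow> w i \<in> carrier R" "\<And>i. i \<in> J \<Longrightarrow> u i \<otimes>\<^bsub>S\<^esub> v i = w i \<odot>\<^bsub>S\<^esub> \<one>\<^bsub>S\<^esub>"
    by metis
  have wcl: "w \<in> J \<rightarrow> carrier R" using w(1) by blast
  have "(\<Oplus>\<^bsub>R\<^esub>i\<in>J. w i) \<odot>\<^bsub>S\<^esub> \<one>\<^bsub>S\<^esub> = (\<Oplus>\<^bsub>S\<^esub>i\<in>J. u i \<otimes>\<^bsub>S\<^esub> v i)"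
    unfolding smult_finsum_left [OF wcl S.one_closed] using w us vs by (intro S.finsum_cong') auto
  also have "\<dots> = \<one>\<^bsub>R\<^esub> \<odot>\<^bsub>S\<^esub> \<one>\<^bsub>S\<^esub>" using uv by simp
  finally have w1: "(\<Oplus>\<^bsub>R\<^esub>i\<in>J. w i) = \<one>\<^bsub>R\<^esub>"
    by (rule inj_onD [OF inj _ R.finsum_closed [OF wcl] R.one_closed])
  obtain \<eta> b where \<eta>: "\<eta> \<in> J \<rightarrow> carrier R" and b: "b \<in> J \<rightarrow> carrier R"
    and orth: "\<And>i j. \<lbrakk>i \<in> J; j \<in> J; i \<noteq> j\<rbrakk> \<Longrightarrow> \<eta> i \<otimes>\<^bsub>R\<^esub> b j = \<zero>\<^bsub>R\<^esub>"
    and sum: "(\<Oplus>\<^bsub>R\<^esub>i\<in>J. (\<eta> i \<otimes>\<^bsub>R\<^esub> b i) \<otimes>\<^bsub>R\<^esub> w i) = \<one>\<^bsub>R\<^esub>"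
    using partition [OF J wcl w1] by blast
  have \<eta>': "\<eta> i \<in> carrier R" and b': "b i \<in> carrier R" if "i \<in> J" for i using \<eta> b that by auto
  define U where "U = (\<Oplus>\<^bsub>S\<^esub>i\<in>J. \<eta> i \<odot>\<^bsub>S\<^esub> u i)"
  define V where "V = (\<Oplus>\<^bsub>S\<^esub>i\<in>J. b i \<odot>\<^bsub>S\<^esub> v i)"
  have U: "U \<in> eigenspace c"
    unfolding U_def using u \<eta> eigenspace_smult [OF c] by (intro eigenspace_finsum [OF c J]) blast
  have V: "V \<in> eigenspace ?d"
    unfolding V_def using v b eigenspace_smult [OF d] by (intro eigenspace_finsum [OF d J]) blast
  have Vs: "V \<in> carrier S" using V by (simp add: eigenspace_def)
  have row: "(\<eta> i \<odot>\<^bsub>S\<^esub> u i) \<otimes>\<^bsub>S\<^esub> V = ((\<eta> i \<otimes>\<^bsub>R\<^esub> b i) \<otimes>\<^bsub>R\<^esub> w i) \<odot>\<^bsub>S\<^esub> \<one>\<^bsub>S\<^esub>" if i: "i \<in> J" for i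
  proof -
    have "(\<eta> i \<odot>\<^bsub>S\<^esub> u i) \<otimes>\<^bsub>S\<^esub> V = (\<Oplus>\<^bsub>S\<^esub>j\<in>J. (\<eta> i \<odot>\<^bsub>S\<^esub> u i) \<otimes>\<^bsub>S\<^esub> (b j \<odot>\<^bsub>S\<^esub> v j))"
      unfolding V_def using i us vs \<eta>' b' by (intro S.finsum_rdistr J) auto
    also have "\<dots> = (\<Oplus>\<^bsub>S\<^esub>j\<in>J. if i = j then (\<eta> j \<otimes>\<^bsub>R\<^esub> b j) \<odot>\<^bsub>S\<^esub> (u j \<otimes>\<^bsub>S\<^esub> v j) else \<zero>\<^bsub>S\<^esub>)"
    proof (rule S.finsum_cong')
      fix j assume j: "j \<in> J"
      have "(\<eta> i \<odot>\<^bsub>S\<^esub> u i) \<otimes>\<^bsub>S\<^esub> (b j \<odot>\<^bsub>S\<^esub> v j) = (\<eta> i \<otimes>\<^bsub>R\<^esub> b j) \<odot>\<^bsub>S\<^esub> (u i \<otimes>\<^bsub>S\<^esub> v j)"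
        using i j us vs \<eta>' b'
        by (simp add: smult_mult_left smult_mult_right Mod.smult_assoc1 [symmetric] R.m_comm)
      then show "(\<eta> i \<odot>\<^bsub>S\<^esub> u i) \<otimes>\<^bsub>S\<^esub> (b j \<odot>\<^bsub>S\<^esub> v j)
          = (if i = j then (\<eta> j \<otimes>\<^bsub>R\<^esub> b j) \<odot>\<^bsub>S\<^esub> (u j \<otimes>\<^bsub>S\<^esub> v j) else \<zero>\<^bsub>S\<^esub>)"
        using orth [OF i j] i j us vs by auto
    qed (use us vs \<eta>' b' in auto)
    also have "\<dots> = (\<eta> i \<otimes>\<^bsub>R\<^esub> b i) \<odot>\<^bsub>S\<^esub> (u i \<otimes>\<^bsub>S\<^esub> v i)"
      using us vs \<eta>' b' by (intro S.finsum_singleton i J) auto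
    also have "\<dots> = ((\<eta> i \<otimes>\<^bsub>R\<^esub> b i) \<otimes>\<^bsub>R\<^esub> w i) \<odot>\<^bsub>S\<^esub> \<one>\<^bsub>S\<^esub>"
      unfolding w(2) [OF i] using w(1) [OF i] \<eta>' [OF i] b' [OF i] by (simp add: Mod.smult_assoc1)
    finally show ?thesis .
  qed
  have "U \<otimes>\<^bsub>S\<^esub> V = (\<Oplus>\<^bsub>S\<^esub>i\<in>J. (\<eta> i \<odot>\<^bsub>S\<^esub> u i) \<otimes>\<^bsub>S\<^esub> V)"
    unfolding U_def using us \<eta>' Vs by (intro S.finsum_ldistr J) auto
  also have "\<dots> = (\<Oplus>\<^bsub>S\<^esub>i\<in>J. ((\<eta> i \<otimes>\<^bsub>R\<^esub> b i) \<otimes>\<^bsub>R\<^esub> w i) \<odot>\<^bsub>S\<^esub> \<one>\<^bsub>S\<^esub>)"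
    using row w(1) \<eta>' b' by (intro S.finsum_cong') auto
  also have "\<dots> = \<one>\<^bsub>R\<^esub> \<odot>\<^bsub>S\<^esub> \<one>\<^bsub>S\<^esub>"
    unfolding sum [symmetric] using w(1) \<eta>' b' by (intro smult_finsum_left [symmetric]) auto
  finally have "U \<otimes>\<^bsub>S\<^esub> V = \<one>\<^bsub>S\<^esub>" by simp
  then show thesis using that U V by blast
qed

end

theorem theorem3p14:
  fixes C :: "('v::finite, 'k::alg_closed_field) point set"
    and S :: "(('v, 'k) adele, 's) module"
    and G :: "'g monoid"
    and \<rho> :: "'g \<Rightarrow> 's \<Rightarrow> 's"
    and p :: nat
  assumes "nonsingular_projective_curve C"
    and "Factorial_Ring.prime p" and "p \<noteq> CHAR('k)"
    and "algebra (adele_ring C) S"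
    and "separable_algebra (adele_ring C) S"
    and "finitely_generated_module (adele_ring C) S"
    and "projective_module (adele_ring C) S"
    and "group G" and "cyclic_group G" and "Coset.order G = p"
    and "acts_by_algebra_automorphisms G (adele_ring C) S \<rho>"
  shows "(galois_extension G (adele_ring C) S \<rho> \<longleftrightarrow>
      (\<forall>x\<in>C. galois_extension G (local_field C x)
        (localised_algebra C S x) (localised_action C S \<rho> x))) \<and>
    (galois_extension G (adele_ring C) S \<rho> \<longrightarrow>
      (\<forall>\<chi> \<in> hom G (roots_of_unity_group p).
        free_of_rank (adele_ring C) (eigen_module C G S \<rho> \<chi>) 1) \<and>
      free_of_rank (adele_ring C) S p)"
proof -
  note p = assms(2,3)
  \<comment> \<open>That the base is a commutative ring is part of \<open>algebra\<close>; the
    structure of the local fields is derived from it.\<close>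
  interpret AC: adele_curve C
    using assms(1) algebra.R_cring [OF assms(4)]
    by (simp add: adele_curve_def nonsingular_projective_curve_def irreducible_closed_def)
  interpret G: group G by (rule assms(8))
  interpret T: algebra_action "adele_ring C" S G \<rho>
    by (intro algebra_action.intro comm_algebra.intro algebra_action_axioms.intro assms)
  have comm: "g \<otimes>\<^bsub>G\<^esub> h = h \<otimes>\<^bsub>G\<^esub> g" if "g \<in> carrier G" "h \<in> carrier G" for g h
    using comm_monoid.m_comm [OF comm_group.axioms(1) [OF G.cyclic_imp_abelian_group [OF assms(9)]]] that by blast
  have fin: "finite (carrier G)"
    using assms(10) prime_gt_0_nat [OF p(1)] by (simp add: G.order_gt_0_iff_finite [symmetric])
  have p0: "(of_nat p :: 'k) \<noteq> 0" by (rule of_nat_prime_neq_0 [OF p])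
  \<comment> \<open>The inverse of the group order, as a constant adele.\<close>
  let ?n = "adele_const C (inverse (of_nat p))"
  have n: "?n \<in> carrier AC.AR" by (rule AC.adele_const_closed)
  have n_sum: "?n \<otimes>\<^bsub>AC.AR\<^esub> (\<Oplus>\<^bsub>AC.AR\<^esub>i\<in>I. adele_const C (f i)) = adele_const C (inverse (of_nat p) * (\<Sum>i\<in>I. f i))"
    if "finite I" for I :: "'i set" and f
    using that by (simp add: AC.adele_const_mult AC.adele_const_sum)
  have n_order: "?n \<otimes>\<^bsub>AC.AR\<^esub> (\<Oplus>\<^bsub>AC.AR\<^esub>g\<in>carrier G. \<one>\<^bsub>AC.AR\<^esub>) = \<one>\<^bsub>AC.AR\<^esub>"
    using n_sum [OF fin, of "\<lambda>_. 1"] assms(10) p0 by (simp add: AC.adele_const_one Coset.order_def)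
  have loc: "localised_algebra C S x = base_change AC.AR S (algebra_via (AC.K x) (\<lambda>\<alpha>. \<alpha> x))"
    "localised_action C S \<rho> x = (\<lambda>g. tensor_map_left AC.AR S (algebra_via (AC.K x) (\<lambda>\<alpha>. \<alpha> x)) (\<rho> g))" for x
    by (simp_all add: localised_algebra_def localised_action_def local_field_algebra_def fun_eq_iff)
  have "galois_extension G (AC.K x) (localised_algebra C S x) (localised_action C S \<rho> x)"
    if gal: "galois_extension G AC.AR S \<rho>" and x: "x \<in> C" for x
  proof -
    interpret F: factor_action AC.AR S "AC.K x" "\<lambda>\<alpha>. \<alpha> x" "AC.ext x" G \<rho>
      by (intro factor_action.intro factor_algebra.intro AC.adele_direct_factor x T.comm_algebra_axioms T.algebra_action_axioms)
    show ?thesis unfolding loc by (rule F.galois_base_change [OF gal AC.local_field_nontrivial [OF x]])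
  qed
  moreover have "galois_extension G AC.AR S \<rho>"
    if "\<forall>x\<in>C. galois_extension G (AC.K x) (localised_algebra C S x) (localised_action C S \<rho> x)"
  proof (rule T.galois_local_global [where K = AC.K and \<pi> = "\<lambda>x \<alpha>. \<alpha> x" and \<iota> = AC.ext and Y = C,
        OF AC.adele_direct_factor AC.nonempty AC.adele_zeroI assms(7,5) fin n n_order])
    show "galois_extension G (AC.K x) (base_change AC.AR S (algebra_via (AC.K x) (\<lambda>\<alpha>. \<alpha> x)))
        (\<lambda>g. tensor_map_left AC.AR S (algebra_via (AC.K x) (\<lambda>\<alpha>. \<alpha> x)) (\<rho> g))" if "x \<in> C" for x
      using that \<open>\<forall>x\<in>C. _ x\<close> unfolding loc by blast
  qed
  moreover have "(\<forall>\<chi> \<in> hom G (roots_of_unity_group p). free_of_rank AC.AR (eigen_module C G S \<rho> \<chi>) 1) \<and>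
      free_of_rank AC.AR S p"
    if gal: "galois_extension G AC.AR S \<rho>"
  proof
    \<comment> \<open>Field-valued characters act on \<open>S\<close> through the constant
      adeles.\<close>
    let ?c = "\<lambda>(\<chi> :: 'g \<Rightarrow> 'k) g. adele_const C (\<chi> g)"
    have char: "T.character (?c \<chi>)" if \<chi>: "\<chi> \<in> hom G (roots_of_unity_group p)" for \<chi>
      unfolding T.character_def
      using hom_roots_mult [OF assms(8) fin assms(10) p(1) \<chi>] hom_roots_one [OF assms(8) fin assms(10) p(1) \<chi>]
      by (auto intro!: homI simp: AC.adele_const_closed AC.adele_const_mult AC.adele_const_one)
    have unit: "\<exists>u v. u \<in> T.eigenspace (?c \<chi>) \<and> v \<in> T.eigenspace (\<lambda>g. ?c \<chi> (inv\<^bsub>G\<^esub> g)) \<and> u \<otimes>\<^bsub>S\<^esub> v = \<one>\<^bsub>S\<^esub>"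
      if \<chi>: "\<chi> \<in> hom G (roots_of_unity_group p)" for \<chi>
    proof (rule T.eigenspace_unit [OF gal char [OF \<chi>] comm n n_order])
      \<comment> \<open>The arithmetic of adeles enters the construction of \<open>u\<close> and
        \<open>v\<close> here, through the choice of inverses place by place.\<close>
      fix J :: "('s \<times> 's) set" and w
      assume "finite J" "w \<in> J \<rightarrow> carrier AC.AR" "(\<Oplus>\<^bsub>AC.AR\<^esub>i\<in>J. w i) = \<one>\<^bsub>AC.AR\<^esub>"
      then show "\<exists>\<eta> b. \<eta> \<in> J \<rightarrow> carrier AC.AR \<and> b \<in> J \<rightarrow> carrier AC.AR \<and>
        (\<forall>i\<in>J. \<forall>j\<in>J. i \<noteq> j \<longrightarrow> \<eta> i \<otimes>\<^bsub>AC.AR\<^esub> b j = \<zero>\<^bsub>AC.AR\<^esub>) \<and>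
        (\<Oplus>\<^bsub>AC.AR\<^esub>i\<in>J. (\<eta> i \<otimes>\<^bsub>AC.AR\<^esub> b i) \<otimes>\<^bsub>AC.AR\<^esub> w i) = \<one>\<^bsub>AC.AR\<^esub>"
        by (rule AC.adele_partition) blast
    qed blast+
    show "\<forall>\<chi> \<in> hom G (roots_of_unity_group p). free_of_rank AC.AR (eigen_module C G S \<rho> \<chi>) 1"
    proof
      fix \<chi> :: "'g \<Rightarrow> 'k" assume \<chi>: "\<chi> \<in> hom G (roots_of_unity_group p)"
      obtain u v where uv: "u \<in> T.eigenspace (?c \<chi>)" "v \<in> T.eigenspace (\<lambda>g. ?c \<chi> (inv\<^bsub>G\<^esub> g))"
        "u \<otimes>\<^bsub>S\<^esub> v = \<one>\<^bsub>S\<^esub>" using unit [OF \<chi>] by blast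
      have "eigen_module C G S \<rho> \<chi> = S\<lparr>carrier := T.eigenspace (?c \<chi>)\<rparr>"
        by (simp add: eigen_module_def T.eigenspace_def)
      then show "free_of_rank AC.AR (eigen_module C G S \<rho> \<chi>) 1"
        using T.eigenspace_free_of_rank_one [OF gal char [OF \<chi>] uv] by simp
    qed
    \<comment> \<open>The powers of one character have to account for the whole of \<open>S\<close>,
      which calls for a faithful one: both orthogonality relations fail for the trivial
      character.\<close>
    obtain \<chi> :: "'g \<Rightarrow> 'k" where \<chi>: "\<chi> \<in> hom G (roots_of_unity_group p)"
      and faithful: "\<And>g. g \<in> carrier G \<Longrightarrow> \<chi> g = 1 \<longleftrightarrow> g = \<one>\<^bsub>G\<^esub>"
      using faithful_character_exists [OF assms(8-10) p] by blast
    obtain u v where uv: "u \<in> T.eigenspace (?c \<chi>)" "v \<in> T.eigenspace (\<lambda>g. ?c \<chi> (inv\<^bsub>G\<^esub> g))"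
      "u \<otimes>\<^bsub>S\<^esub> v = \<one>\<^bsub>S\<^esub>" using unit [OF \<chi>] by blast
    show "free_of_rank AC.AR S p"
    proof (rule T.free_of_rank_eigen [OF gal char [OF \<chi>] uv comm n])
      fix g assume g: "g \<in> carrier G"
      have "?n \<otimes>\<^bsub>AC.AR\<^esub> (\<Oplus>\<^bsub>AC.AR\<^esub>m\<in>{..<p}. ?c \<chi> (inv\<^bsub>G\<^esub> g) [^]\<^bsub>AC.AR\<^esub> m)
          = adele_const C (inverse (of_nat p) * (\<Sum>m<p. \<chi> (inv\<^bsub>G\<^esub> g) ^ m))"
        using n_sum [of "{..<p}" "\<lambda>m. \<chi> (inv\<^bsub>G\<^esub> g) ^ m"] by (simp add: AC.adele_const_pow)
      \<comment> \<open>A geometric sum in a \<open>p\<close>-th root of unity, which is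
        \<open>1\<close> only at the identity because \<open>\<chi>\<close> is faithful.\<close>
      also have "(\<Sum>m<p. \<chi> (inv\<^bsub>G\<^esub> g) ^ m) = (if g = \<one>\<^bsub>G\<^esub> then of_nat p else 0)"
        using sum_powers_root_of_unity [OF hom_roots_pow [OF assms(8) fin assms(10) p(1) \<chi> G.inv_closed [OF g]]]
          faithful [OF G.inv_closed [OF g]] g by (simp add: G.inv_eq_1_iff)
      finally show "?n \<otimes>\<^bsub>AC.AR\<^esub> (\<Oplus>\<^bsub>AC.AR\<^esub>m\<in>{..<p}. ?c \<chi> (inv\<^bsub>G\<^esub> g) [^]\<^bsub>AC.AR\<^esub> m)
          = (if g = \<one>\<^bsub>G\<^esub> then \<one>\<^bsub>AC.AR\<^esub> else \<zero>\<^bsub>AC.AR\<^esub>)"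
        using p0 by (simp add: AC.adele_const_one AC.adele_const_zero)
    next
      fix k m assume km: "k < p" "m < p"
      have "?n \<otimes>\<^bsub>AC.AR\<^esub> (\<Oplus>\<^bsub>AC.AR\<^esub>g\<in>carrier G. ?c \<chi> (inv\<^bsub>G\<^esub> g) [^]\<^bsub>AC.AR\<^esub> k \<otimes>\<^bsub>AC.AR\<^esub> ?c \<chi> g [^]\<^bsub>AC.AR\<^esub> m)
          = adele_const C (inverse (of_nat p) * (\<Sum>g\<in>carrier G. \<chi> (inv\<^bsub>G\<^esub> g) ^ k * \<chi> g ^ m))"
        using n_sum [OF fin, of "\<lambda>g. \<chi> (inv\<^bsub>G\<^esub> g) ^ k * \<chi> g ^ m"]
        by (simp add: AC.adele_const_pow AC.adele_const_mult)
      also have "(\<Sum>g\<in>carrier G. \<chi> (inv\<^bsub>G\<^esub> g) ^ k * \<chi> g ^ m) = (if k = m then of_nat p else 0)"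
        by (rule hom_roots_sum [OF assms(8) fin assms(10) p(1) \<chi> faithful km])
      finally show "?n \<otimes>\<^bsub>AC.AR\<^esub> (\<Oplus>\<^bsub>AC.AR\<^esub>g\<in>carrier G. ?c \<chi> (inv\<^bsub>G\<^esub> g) [^]\<^bsub>AC.AR\<^esub> k \<otimes>\<^bsub>AC.AR\<^esub> ?c \<chi> g [^]\<^bsub>AC.AR\<^esub> m)
          = (if k = m then \<one>\<^bsub>AC.AR\<^esub> else \<zero>\<^bsub>AC.AR\<^esub>)"
        using p0 by (simp add: AC.adele_const_one AC.adele_const_zero)
    qed
  qed
  ultimately show ?thesis by blast
qed

end
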